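(* Let $\Omega$ be a bounded domain in $\mathbb{R}^n$ and let $A$ be a symmetric nonnegative semidefinite matrix-valued function on $\Omega$ such that $\sqrt A$ is bounded and Lipschitz. Let $\mathcal{A}(x,z)$ be a symmetric nonnegative semidefinite matrix defined for $(x,z)\in\Omega\times\mathbb{R}$ such that for some $0<\lambda\le\Lambda<\infty$ $$0\le\lambda\,\xi^{\mathrm{tr}}A(x)\xi\le \xi^{\mathrm{tr}}\mathcal{A}(x,z)\xi\le\Lambda\,\xi^{\mathrm{tr}}A(x)\xi$$ for a.e. $x\in\Omega$, all $\xi\in\mathbb{R}^n$, $z\in\mathbb{R}$. Suppose that: (1) the pair $(\phi_0,\vec\phi_1)$ is $A$-admissible for $\Omega$; (2) the global $(\Phi,A)$-Orlicz–Sobolev bump inequality holds in $\Omega$ with $\Phi=\Phi_m$ for some $m>2$, i.e. there is a constant $C_S$ with $$\Phi^{-1}\Big(\int_\Omega\Phi(|w|)\,dx\Big)\le C_S\,\|\nabla_Aw\|_{L^1(\Omega)}\qquad\text{for all }w\in\mathrm{Lip}_c(\Omega).$$ Let $u\in W^{1,2}_A(\Omega)$ be a weak subsolution of $-\nabla^{\mathrm{tr}}\mathcal A(x,u(x))\nabla u=\phi_0-\mathrm{div}_A\vec\phi_1$ in $\Omega$. Then $$\operatorname*{ess\,sup}_{x\in\Omega}u(x)\le\sup_{x\in\partial\Omega}u(x)+C\,\|(\phi_0,\vec\phi_1)\|_{\mathcal X(\Omega)},$$ where the constant $C$ depends only on $n,m,\lambda,\Lambda,A,\Phi$ and $\Om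ega$.
   Context: **Differential structure.** $\nabla_Av=\sqrt{A}\,\nabla v$, $\mathrm{div}_A\vec w=\mathrm{div}(\sqrt A\,\vec w)$. $\mathrm{Lip}_c(\Omega)$: Lipschitz functions with compact support in $\Omega$. $W^{1,2}_A(\Omega)$ is the Hilbert space of $u\in L^2(\Omega)$ with weak $A$-gradient $\nabla_Au\in L^2(\Omega)^n$ (i.e. $\int\nabla_Au\cdot\vec v=-\int u\,\mathrm{div}_A\vec v$ for all $\vec v\in(\mathrm{Lip}_c(\Omega))^n$), with norm $(\int_\Omega |u|^2+|\nabla_Au|^2)^{1/2}$; $W^{1,2}_{A,0}(\Omega)$ is the closure of $\mathrm{Lip}_c(\Omega)$ in it. $W^{1,1}_{A,0}(\Omega)$ is the closure of $\mathrm{Lip}_c(\Omega)$ in the norm $\int_\Omega|v|+|\nabla_Av|$. If $\tilde A$ is symmetric with $\lambda\xi^{\mathrm{tr}}A\xi\le\xi^{\mathrm{tr}}\tilde A\xi\le\Lambda\xi^{\mathrm{tr}}A\xi$, then $\sqrt{\tilde A}=M\sqrt A$ with $M$ bounded, $\nabla_{\tilde A}u:=M\nabla_Au$, and $\int\tilde A\nabla u\cdot\nabla w$ means $\int\nabla_{\tilde A}u\cdot\nabla_{\tilde A}w$. **Weak subsolution.** $u\in W^{1,2}_A(\Omega)$ such that, with $\tilde A(x)=\mathcal A(x,u(x))$, $\int_\Omega\tilde A\nabla u\cdot\nabla w\le\int_\Omega(\phi_0w+\vec\phi_1\cdot\nabla_Aw)$ for all nonnegative $w\in\mathrm{Lip}_c(\Omega)$.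 **Admissibility.** $\phi_0:\Omega\to\mathbb{R}$, $\vec\phi_1:\Omega\to\mathbb{R}^n$ are locally integrable; the pair is $A$-admissible for $\Omega$ if, with $\mathcal W_1=\{v\in W^{1,1}_{A,0}(\Omega):\int_\Omega|\nabla_Av|=1\}$, $$\|(\phi_0,\vec\phi_1)\|_{\mathcal X(\Omega)}:=\sup_{v\in\mathcal W_1}\Big|\int_\Omega v\phi_0\Big|+\sup_{v\in\mathcal W_1}\Big|\int_\Omega\nabla_Av\cdot\vec\phi_1\Big|<\infty.$$ **Young function.** With $E=e^{2^m}$, $F=e^{3^m}$: $\Phi_m(t)=e^{((\ln t)^{1/m}+1)^m}$ for $t\ge E$, $\Phi_m(t)=\frac FEt$ for $0\le t\le E$. **Boundary supremum.** $\sup_{x\in\partial\Omega}u(x):=\inf\{\ell\in\mathbb{R}:(u-\ell)^+\in W^{1,2}_{A,0}(\Omega)\}$ (with $\inf\emptyset=+\infty$). *)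

theory Defs
  imports "HOL-Analysis.Analysis" "HOL-Probability.Essential_Supremum"
begin

text \<open>Functions on \<open>\<Omega>\<close> are total functions on \<open>real ^ 'n\<close> of which only the values on \<open>\<Omega>\<close> matter,
  and all integrals are Lebesgue integrals over \<open>lebesgue_on \<Omega>\<close>. The completed measure is used so
  that values on null sets (for instance of a gradient at points of non-differentiability) are
  irrelevant also for measurability.\<close>

definition sym_psd :: "real ^ 'n ^ 'n \<Rightarrow> bool" where
  "sym_psd M \<longleftrightarrow> transpose M = M \<and> (\<forall>\<xi>. 0 \<le> \<xi> \<bullet> (M *v \<xi>))"

definition mat_sqrt :: "real ^ 'n ^ 'n \<Rightarrow> real ^ 'n ^ 'n" where
  "mat_sqrt M = (THE S. sym_psd S \<and> S ** S = M)"

definition grad :: "(real ^ 'n \<Rightarrow> real) \<Rightarrow> real ^ 'n \<Rightarrow> real ^ 'n" where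
  "grad v x = (\<chi> i. frechet_derivative v (at x) (axis i 1))"

definition grad_A :: "(real ^ 'n \<Rightarrow> real ^ 'n ^ 'n) \<Rightarrow> (real ^ 'n \<Rightarrow> real) \<Rightarrow> real ^ 'n \<Rightarrow> real ^ 'n" where
  "grad_A A v x = mat_sqrt (A x) *v grad v x"

definition div_A :: "(real ^ 'n \<Rightarrow> real ^ 'n ^ 'n) \<Rightarrow> (real ^ 'n \<Rightarrow> real ^ 'n) \<Rightarrow> real ^ 'n \<Rightarrow> real" where
  "div_A A w x = trace (jacobian (\<lambda>y. mat_sqrt (A y) *v w y) (at x))"

text \<open>A Lipschitz function with compact support in the open set \<open>\<Omega>\<close> is identified with its extension
  by zero, which is Lipschitz on the whole space.\<close>

definition Lip_c :: "(real ^ 'n) set \<Rightarrow> (real ^ 'n \<Rightarrow> real) set" where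
  "Lip_c \<Omega> = {v. (\<exists>L. L-lipschitz_on UNIV v) \<and>
     compact (closure {x. v x \<noteq> 0}) \<and> closure {x. v x \<noteq> 0} \<subseteq> \<Omega>}"

definition L2 :: "(real ^ 'n) set \<Rightarrow> (real ^ 'n \<Rightarrow> 'b::euclidean_space) set" where
  "L2 \<Omega> = {f. f \<in> borel_measurable (lebesgue_on \<Omega>) \<and>
     integrable (lebesgue_on \<Omega>) (\<lambda>x. (norm (f x))\<^sup>2)}"

definition is_weak_grad ::
  "(real ^ 'n) set \<Rightarrow> (real ^ 'n \<Rightarrow> real ^ 'n ^ 'n) \<Rightarrow> (real ^ 'n \<Rightarrow> real) \<Rightarrow> (real ^ 'n \<Rightarrow> real ^ 'n) \<Rightarrow> bool"
  where
  "is_weak_grad \<Omega> A u g \<longleftrightarrow> g \<in> L2 \<Omega> \<and>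
     (\<forall>v. (\<forall>i. (\<lambda>x. v x $ i) \<in> Lip_c \<Omega>) \<longrightarrow>
       (LINT x|lebesgue_on \<Omega>. g x \<bullet> v x) = - (LINT x|lebesgue_on \<Omega>. u x * div_A A v x))"

definition W12 :: "(real ^ 'n) set \<Rightarrow> (real ^ 'n \<Rightarrow> real ^ 'n ^ 'n) \<Rightarrow> (real ^ 'n \<Rightarrow> real) set" where
  "W12 \<Omega> A = {u. u \<in> L2 \<Omega> \<and> (\<exists>g. is_weak_grad \<Omega> A u g)}"

text \<open>The weak gradient is unique up to null sets.\<close>

definition weak_grad ::
  "(real ^ 'n) set \<Rightarrow> (real ^ 'n \<Rightarrow> real ^ 'n ^ 'n) \<Rightarrow> (real ^ 'n \<Rightarrow> real) \<Rightarrow> real ^ 'n \<Rightarrow> real ^ 'n" where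
  "weak_grad \<Omega> A u = (SOME g. is_weak_grad \<Omega> A u g)"

definition W12_norm ::
  "(real ^ 'n) set \<Rightarrow> (real ^ 'n \<Rightarrow> real ^ 'n ^ 'n) \<Rightarrow> (real ^ 'n \<Rightarrow> real) \<Rightarrow> real" where
  "W12_norm \<Omega> A u = sqrt (LINT x|lebesgue_on \<Omega>. \<bar>u x\<bar>\<^sup>2 + (norm (weak_grad \<Omega> A u x))\<^sup>2)"

definition W12_0 :: "(real ^ 'n) set \<Rightarrow> (real ^ 'n \<Rightarrow> real ^ 'n ^ 'n) \<Rightarrow> (real ^ 'n \<Rightarrow> real) set" where
  "W12_0 \<Omega> A = {u \<in> W12 \<Omega> A. \<forall>\<epsilon>>0. \<exists>w\<in>Lip_c \<Omega>. W12_norm \<Omega> A (\<lambda>x. u x - w x) < \<epsilon>}"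

text \<open>The closure of \<open>Lip_c \<Omega>\<close> in the norm \<open>\<integral> \<bar>v\<bar> + \<bar>\<nabla>\<^sub>A v\<bar>\<close>, as the set of pairs \<open>(v, \<nabla>\<^sub>A v)\<close>. When
  \<open>\<surd>A\<close> is bounded and Lipschitz, integration by parts against Lipschitz fields shows that the second
  component is determined by the first up to null sets.\<close>

definition W11_0 ::
  "(real ^ 'n) set \<Rightarrow> (real ^ 'n \<Rightarrow> real ^ 'n ^ 'n) \<Rightarrow> ((real ^ 'n \<Rightarrow> real) \<times> (real ^ 'n \<Rightarrow> real ^ 'n)) set"
  where
  "W11_0 \<Omega> A = {(v, g). integrable (lebesgue_on \<Omega>) v \<and> integrable (lebesgue_on \<Omega>) g \<and>
     (\<forall>\<epsilon>>0. \<exists>w\<in>Lip_c \<Omega>.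
        (LINT x|lebesgue_on \<Omega>. \<bar>v x - w x\<bar> + norm (g x - grad_A A w x)) < \<epsilon>)}"

definition unit_W11_0 ::
  "(real ^ 'n) set \<Rightarrow> (real ^ 'n \<Rightarrow> real ^ 'n ^ 'n) \<Rightarrow> ((real ^ 'n \<Rightarrow> real) \<times> (real ^ 'n \<Rightarrow> real ^ 'n)) set"
  where
  "unit_W11_0 \<Omega> A = {(v, g) \<in> W11_0 \<Omega> A. (LINT x|lebesgue_on \<Omega>. norm (g x)) = 1}"

definition X_norm ::
  "(real ^ 'n) set \<Rightarrow> (real ^ 'n \<Rightarrow> real ^ 'n ^ 'n) \<Rightarrow> (real ^ 'n \<Rightarrow> real) \<Rightarrow> (real ^ 'n \<Rightarrow> real ^ 'n) \<Rightarrow> ennreal"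
  where
  "X_norm \<Omega> A \<phi>\<^sub>0 \<phi>\<^sub>1 =
     (SUP (v, g) \<in> unit_W11_0 \<Omega> A. ennreal \<bar>LINT x|lebesgue_on \<Omega>. v x * \<phi>\<^sub>0 x\<bar>) +
     (SUP (v, g) \<in> unit_W11_0 \<Omega> A. ennreal \<bar>LINT x|lebesgue_on \<Omega>. g x \<bullet> \<phi>\<^sub>1 x\<bar>)"

text \<open>For locally integrable data the integrals in \<open>X_norm\<close> need not exist, and \<open>LINT\<close> would then be \<open>0\<close>;
  admissibility includes their existence.\<close>

definition admissible ::
  "(real ^ 'n) set \<Rightarrow> (real ^ 'n \<Rightarrow> real ^ 'n ^ 'n) \<Rightarrow> (real ^ 'n \<Rightarrow> real) \<Rightarrow> (real ^ 'n \<Rightarrow> real ^ 'n) \<Rightarrow> bool"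
  where
  "admissible \<Omega> A \<phi>\<^sub>0 \<phi>\<^sub>1 \<longleftrightarrow>
     (\<forall>K. compact K \<and> K \<subseteq> \<Omega> \<longrightarrow> \<phi>\<^sub>0 absolutely_integrable_on K \<and> \<phi>\<^sub>1 absolutely_integrable_on K) \<and>
     (\<forall>(v, g) \<in> unit_W11_0 \<Omega> A. integrable (lebesgue_on \<Omega>) (\<lambda>x. v x * \<phi>\<^sub>0 x) \<and>
        integrable (lebesgue_on \<Omega>) (\<lambda>x. g x \<bullet> \<phi>\<^sub>1 x)) \<and>
     X_norm \<Omega> A \<phi>\<^sub>0 \<phi>\<^sub>1 < \<infinity>"

text \<open>\<open>M\<close> need not be unique off the range of \<open>\<surd>A\<close>, but \<open>A\<close>-gradients take values in that range almost
  everywhere, so the choice of \<open>M\<close> in \<open>weak_subsolution\<close> is immaterial.\<close>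

definition sqrt_factor ::
  "(real ^ 'n) set \<Rightarrow> (real ^ 'n \<Rightarrow> real ^ 'n ^ 'n) \<Rightarrow> (real ^ 'n \<Rightarrow> real ^ 'n ^ 'n) \<Rightarrow>
   (real ^ 'n \<Rightarrow> real ^ 'n ^ 'n) \<Rightarrow> bool" where
  "sqrt_factor \<Omega> A B M \<longleftrightarrow> bounded (M ` \<Omega>) \<and>
     (AE x in lebesgue_on \<Omega>. mat_sqrt (B x) = M x ** mat_sqrt (A x))"

text \<open>No measurability is imposed on \<open>\<A>\<close> itself; that the left-hand integral exists is part of being
  a weak subsolution. (The right-hand one always exists for locally integrable data.)\<close>

definition weak_subsolution ::
  "(real ^ 'n) set \<Rightarrow> (real ^ 'n \<Rightarrow> real ^ 'n ^ 'n) \<Rightarrow> (real ^ 'n \<Rightarrow> real \<Rightarrow> real ^ 'n ^ 'n) \<Rightarrow>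
   (real ^ 'n \<Rightarrow> real) \<Rightarrow> (real ^ 'n \<Rightarrow> real ^ 'n) \<Rightarrow> (real ^ 'n \<Rightarrow> real) \<Rightarrow> bool" where
  "weak_subsolution \<Omega> A \<A> \<phi>\<^sub>0 \<phi>\<^sub>1 u \<longleftrightarrow> u \<in> W12 \<Omega> A \<and>
     (\<exists>M. sqrt_factor \<Omega> A (\<lambda>x. \<A> x (u x)) M \<and>
       (\<forall>w\<in>Lip_c \<Omega>. (\<forall>x. 0 \<le> w x) \<longrightarrow>
          integrable (lebesgue_on \<Omega>) (\<lambda>x. (M x *v weak_grad \<Omega> A u x) \<bullet> (M x *v grad_A A w x)) \<and>
          (LINT x|lebesgue_on \<Omega>. (M x *v weak_grad \<Omega> A u x) \<bullet> (M x *v grad_A A w x))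
            \<le> (LINT x|lebesgue_on \<Omega>. \<phi>\<^sub>0 x * w x + \<phi>\<^sub>1 x \<bullet> grad_A A w x)))"

definition Young :: "real \<Rightarrow> real \<Rightarrow> real" where
  "Young m t = (if t \<ge> exp (2 powr m) then exp ((ln t powr (1 / m) + 1) powr m)
     else exp (3 powr m) / exp (2 powr m) * t)"

definition orlicz_sobolev_bump ::
  "(real ^ 'n) set \<Rightarrow> (real ^ 'n \<Rightarrow> real ^ 'n ^ 'n) \<Rightarrow> (real \<Rightarrow> real) \<Rightarrow> bool" where
  "orlicz_sobolev_bump \<Omega> A \<Phi> \<longleftrightarrow> (\<exists>C\<^sub>S. \<forall>w\<in>Lip_c \<Omega>.
     inv_into {0..} \<Phi> (LINT x|lebesgue_on \<Omega>. \<Phi> \<bar>w x\<bar>)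
       \<le> C\<^sub>S * (LINT x|lebesgue_on \<Omega>. norm (grad_A A w x)))"

definition boundary_sup ::
  "(real ^ 'n) set \<Rightarrow> (real ^ 'n \<Rightarrow> real ^ 'n ^ 'n) \<Rightarrow> (real ^ 'n \<Rightarrow> real) \<Rightarrow> ereal" where
  "boundary_sup \<Omega> A u = Inf {ereal l | l. (\<lambda>x. max (u x - l) 0) \<in> W12_0 \<Omega> A}"

end

theory Submission
  imports Defs "HOL-Real_Asymp.Real_Asymp"
begin

text \<open>Let \<open>v = max (u - l) 0\<close> belong to \<open>W12_0 \<Omega> A\<close> and let \<open>X\<close> be the admissibility norm of the data. Testing the
  equation with \<open>max (v - k) 0\<close> gives \<open>\<lambda> \<integral>\<bar>p\<bar>\<^sup>2 \<le> X \<integral>\<bar>p\<bar>\<close> for \<open>p = \<nabla>\<^sub>A v\<close> restricted to \<open>{v > k}\<close>, hence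
  \<open>\<integral>\<bar>p\<bar> \<le> (X / \<lambda>) \<mu> k\<close> where \<open>\<mu> k\<close> is the measure of \<open>{v > k}\<close>. The Orlicz-Sobolev inequality applied to a multiple of
  \<open>max (v - k) 0\<close> then bounds \<open>\<mu> (k + d)\<close> in terms of \<open>\<mu> k\<close>, and for the Young function with \<open>m > 2\<close> the De Giorgi
  iteration of this bound reaches \<open>\<mu> k = 0\<close> at some \<open>k\<close> proportional to \<open>X / \<lambda>\<close>.

  The test functions are truncations of approximations of \<open>v\<close> in \<open>Lip_c \<Omega>\<close>, and passing to the limit requires
  that weak \<open>A\<close>-gradients vanish almost everywhere on level sets. This locality rests on
  Friedrichs' commutator estimate for the fields given by the columns of \<open>\<surd>A\<close>, and integration by parts against Lipschitz
  fields rests on Rademacher's theorem.\<close>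

subsection \<open>Square roots of positive semidefinite matrices\<close>

text \<open>The iteration lives on a slight superlinearity,
  \<open>Young m t \<ge> t * exp (sqrt (ln t))\<close>, and this is where the size of
  \<open>m\<close> enters: a linear Young function yields no decay over increments with a finite
  sum. Estimates are made with the L1 norm of the gradient, because admissibility pairs the data
  with L1 gradients only; the measure of the level set gives the passage from L2.

  The obstacle is the degeneracy of \<open>A\<close>: a weak \<open>A\<close>-gradient does not
  control the ordinary gradient, so the truncation rules of Sobolev theory do not apply as such.
  Locality replaces them in three places: the uniqueness of the weak gradient, the vanishing of the
  gradient of \<open>v\<close> on \<open>{v = k}\<close>, which makes truncation continuous along
  the approximations, and the equality of the gradients of \<open>u\<close> and \<open>v\<close> on
  \<open>{v > k}\<close>. Beyond \<open>v\<close> itself only Lipschitz functions are ever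
  truncated.

  Levels are measured in units proportional to the norm of the data divided by the ellipticity
  constant. In these units the decay estimate no longer mentions the data, which makes the final
  constant uniform.\<close>

lemma symmetric_matrix_inner:
  fixes M :: "real ^ 'n ^ 'n"
  assumes "transpose M = M"
  shows "x \<bullet> (M *v y) = (M *v x) \<bullet> y"
  by (metis assms dot_lmul_matrix transpose_matrix_vector vector_transpose_matrix)

lemma symmetric_matrixI:
  fixes M :: "real ^ 'n ^ 'n"
  assumes "\<And>x y. x \<bullet> (M *v y) = (M *v x) \<bullet> y"
  shows "transpose M = M"
  unfolding matrix_eq
  by (metis (no_types, lifting) assms dot_lmul_matrix inner_commute transpose_matrix_vector vector_eq_rdot)

text \<open>The maximiser \<open>e\<close> of the quadratic form on the unit sphere of
  \<open>V\<close> is the eigenvector: moving from \<open>e\<close> along the residual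
  \<open>r\<close>, which is orthogonal to \<open>e\<close>, would increase the form at first order
  by a multiple of \<open>r \<bullet> r\<close>, so \<open>r = 0\<close>.\<close>

lemma symmetric_matrix_eigenvector:
  fixes M :: "real ^ 'n ^ 'n"
  assumes sym: "transpose M = M" and V: "subspace V" "\<And>x. x \<in> V \<Longrightarrow> M *v x \<in> V" "V \<noteq> {0}"
  obtains e c where "e \<in> V" "norm e = 1" "M *v e = c *\<^sub>R e"
proof -
  define q where "q x = x \<bullet> (M *v x)" for x
  have cont: "continuous_on S q" for S
    unfolding q_def by (intro continuous_intros matrix_vector_mult_linear_continuous_on)
  obtain x where x: "x \<in> V" "x \<noteq> 0" using V subspace_0 by blast
  have "x /\<^sub>R norm x \<in> sphere 0 1 \<inter> V"
    using x V(1) by (auto simp: subspace_scale)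
  moreover have "compact (sphere 0 1 \<inter> V)"
    by (intro compact_Int_closed compact_sphere closed_subspace V)
  ultimately obtain e where e: "e \<in> sphere 0 1 \<inter> V" "\<And>y. y \<in> sphere 0 1 \<inter> V \<Longrightarrow> q y \<le> q e"
    using continuous_attains_sup[of "sphere 0 1 \<inter> V" q] cont by (metis empty_iff)
  have ne: "norm e = 1" "e \<in> V" "e \<bullet> e = 1" using e by (auto simp: norm_eq_1)
  have hom: "q (c *\<^sub>R y) = c\<^sup>2 * q y" for c y
    by (simp add: q_def matrix_vector_mult_scaleR power2_eq_square)
  have le: "q y \<le> q e * (norm y)\<^sup>2" if "y \<in> V" for y
  proof (cases "y = 0")
    case False
    then have "y /\<^sub>R norm y \<in> sphere 0 1 \<inter> V" using that V(1) by (auto simp: subspace_scale)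
    then have "q (y /\<^sub>R norm y) \<le> q e" using e by blast
    then show ?thesis using False by (simp add: hom field_simps power_divide)
  qed (simp add: q_def)
  define r where "r = M *v e - q e *\<^sub>R e"
  have rV: "r \<in> V" unfolding r_def by (intro subspace_diff subspace_scale V ne)
  have re: "r \<bullet> e = 0" using ne by (simp add: r_def q_def inner_diff_left inner_commute[of "M *v e"])
  have "r \<bullet> (M *v e) = r \<bullet> r"
    using re by (simp add: r_def inner_diff_right inner_commute)
  have key: "2 * t * (r \<bullet> r) \<le> t\<^sup>2 * (q e * (r \<bullet> r) - q r)" for t
  proof -
    have "e + t *\<^sub>R r \<in> V" by (intro subspace_add subspace_scale V ne rV)
    then have "q (e + t *\<^sub>R r) \<le> q e * (norm (e + t *\<^sub>R r))\<^sup>2" by (rule le)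
    also have "(norm (e + t *\<^sub>R r))\<^sup>2 = 1 + t\<^sup>2 * (r \<bullet> r)"
      using ne re unfolding power2_norm_eq_inner
      by (simp add: inner_add_left inner_add_right inner_commute power2_eq_square)
    also have "q (e + t *\<^sub>R r) = q e + 2 * t * (r \<bullet> r) + t\<^sup>2 * q r"
      using \<open>r \<bullet> (M *v e) = r \<bullet> r\<close> symmetric_matrix_inner[OF sym, of e r]
      unfolding q_def
      by (simp add: inner_add_left inner_add_right matrix_vector_mult_scaleR matrix_vector_right_distrib
          inner_commute power2_eq_square algebra_simps)
    finally show ?thesis by (simp add: algebra_simps)
  qed
  have "r \<bullet> r \<le> 0"
  proof (rule ccontr)
    assume "\<not> ?thesis"
    then have rr: "r \<bullet> r > 0" by (simp only: not_le)
    define d where "d = q e * (r \<bullet> r) - q r"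
    \<comment> \<open>Small enough that \<open>t * d\<close> stays below
      \<open>r \<bullet> r\<close>, which contradicts the lower bound
      \<open>2 * (r \<bullet> r)\<close>.\<close>
    define t where "t = (r \<bullet> r) / (\<bar>d\<bar> + 1)"
    have t: "t > 0" using rr by (simp add: t_def)
    have "2 * t * (r \<bullet> r) \<le> t\<^sup>2 * d" using key[of t] by (simp add: d_def)
    then have "2 * (r \<bullet> r) \<le> t * d" using t by (simp add: power2_eq_square)
    also have "\<dots> \<le> t * (\<bar>d\<bar> + 1)" using t by (intro mult_left_mono) auto
    also have "\<dots> = r \<bullet> r" by (simp add: t_def)
    finally show False using rr by simp
  qed
  then have "r = 0" by (metis inner_gt_zero_iff not_le)
  then show ?thesis using that[of e "q e"] ne by (simp add: r_def)
qed

text \<open>Induction over invariant subspaces: once an eigenvector is split off, symmetry keeps its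
  orthogonal complement within \<open>V\<close> invariant, and that complement has smaller
  dimension.\<close>

lemma symmetric_matrix_orthonormal_eigenbasis:
  fixes M :: "real ^ 'n ^ 'n"
  assumes sym: "transpose M = M"
  shows "subspace V \<Longrightarrow> (\<And>x. x \<in> V \<Longrightarrow> M *v x \<in> V) \<Longrightarrow>
    \<exists>B. finite B \<and> B \<subseteq> V \<and> span B = V \<and> pairwise orthogonal B \<and>
      (\<forall>b\<in>B. norm b = 1 \<and> (\<exists>c. M *v b = c *\<^sub>R b))"
proof (induction "dim V" arbitrary: V rule: less_induct)
  case (less V)
  show ?case
  proof (cases "V = {0}")
    case True
    then show ?thesis by (intro exI[of _ "{}"]) auto
  next
    case False
    obtain e c where e: "e \<in> V" "norm e = 1" "M *v e = c *\<^sub>R e"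
      using symmetric_matrix_eigenvector[OF sym less.prems False] by metis
    have ee: "e \<bullet> e = 1" using e by (simp add: norm_eq_1)
    define W where "W = {y \<in> V. y \<bullet> e = 0}"
    have W: "subspace W" using less.prems(1)
      by (auto simp: W_def subspace_def inner_add_left)
    have inv: "M *v y \<in> W" if "y \<in> W" for y
      using that less.prems(2)[of y] e symmetric_matrix_inner[OF sym, of y e]
      by (auto simp: W_def inner_commute)
    have "e \<notin> W" using ee by (simp add: W_def)
    moreover have "W \<subseteq> V" by (auto simp: W_def)
    ultimately have "W \<subset> V" using e(1) by blast
    then have "dim W < dim V" by (metis W less.prems(1) dim_psubset span_eq_iff)
    from less.hyps[OF this W inv] obtain B where B: "finite B" "B \<subseteq> W" "span B = W"
      "pairwise orthogonal B" "\<forall>b\<in>B. norm b = 1 \<and> (\<exists>c. M *v b = c *\<^sub>R b)" by blast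
    have "span (insert e B) = V"
    proof
      show "span (insert e B) \<subseteq> V" using less.prems(1) e B \<open>W \<subset> V\<close> by (intro span_minimal) auto
      show "V \<subseteq> span (insert e B)"
      proof
        fix x assume "x \<in> V"
        then have "x - (x \<bullet> e) *\<^sub>R e \<in> W"
          using less.prems(1) e ee by (auto simp: W_def inner_diff_left intro: subspace_diff subspace_scale)
        then have "x - (x \<bullet> e) *\<^sub>R e \<in> span (insert e B)"
          using B span_mono[of B "insert e B"] by blast
        moreover have "(x \<bullet> e) *\<^sub>R e \<in> span (insert e B)" by (intro span_scale span_base) simp
        ultimately show "x \<in> span (insert e B)" using span_add by fastforce
      qed
    qed
    moreover have "pairwise orthogonal (insert e B)"
      using B(2,4) by (auto simp: pairwise_insert orthogonal_def W_def inner_commute)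
    ultimately show ?thesis
      using B e \<open>W \<subset> V\<close> by (intro exI[of _ "insert e B"]) auto
  qed
qed

lemma psd_sqrt_exists:
  assumes "sym_psd M"
  shows "\<exists>S. sym_psd S \<and> S ** S = M"
proof -
  have sym: "transpose M = M" and psd: "\<And>\<xi>. 0 \<le> \<xi> \<bullet> (M *v \<xi>)" using assms by (auto simp: sym_psd_def)
  obtain B where B: "finite B" "span B = UNIV" "pairwise orthogonal B"
    and B1: "\<And>b. b \<in> B \<Longrightarrow> norm b = 1" and "\<And>b. b \<in> B \<Longrightarrow> \<exists>c. M *v b = c *\<^sub>R b"
    using symmetric_matrix_orthonormal_eigenbasis[OF sym, of UNIV] by auto
  then obtain c where c: "\<And>b. b \<in> B \<Longrightarrow> M *v b = c b *\<^sub>R b" by metis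
  have c0: "0 \<le> c b" if "b \<in> B" for b
    using psd[of b] c[OF that] B1[OF that] by (simp add: norm_eq_1)
  define f where "f x = (\<Sum>b\<in>B. (sqrt (c b) * (x \<bullet> b)) *\<^sub>R b)" for x
  have lin: "linear f"
    by (rule linearI) (simp_all add: f_def inner_add_left algebra_simps sum.distrib scaleR_sum_right)
  define S where "S = matrix f"
  have S: "S *v x = f x" for x using lin by (simp add: S_def matrix_works)
  have fb: "f x \<bullet> b = sqrt (c b) * (x \<bullet> b)" if "b \<in> B" for x b
  proof -
    have "f x \<bullet> b = (\<Sum>a\<in>B. sqrt (c a) * (x \<bullet> a) * (a \<bullet> b))" by (simp add: f_def inner_sum_left)
    also have "\<dots> = (\<Sum>a\<in>B. if a = b then sqrt (c b) * (x \<bullet> b) else 0)"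
      using B(3) B1[OF that] that
      by (intro sum.cong) (auto simp: pairwise_def orthogonal_def norm_eq_1)
    finally show ?thesis using that B(1) by simp
  qed
  have "x \<bullet> f y = (\<Sum>b\<in>B. sqrt (c b) * (x \<bullet> b) * (y \<bullet> b))" for x y
    by (simp add: f_def inner_sum_right algebra_simps)
  note xf = this
  have "x \<bullet> f y = f x \<bullet> y" for x y
    unfolding xf inner_commute[of "f x" y] by (intro sum.cong) auto
  moreover have "0 \<le> x \<bullet> f x" for x
    unfolding xf by (intro sum_nonneg) (simp add: c0 mult.assoc)
  ultimately have "sym_psd S" by (auto simp: sym_psd_def S intro!: symmetric_matrixI)
  moreover have "S ** S = M"
    unfolding matrix_eq
  proof
    fix x
    have x: "x = (\<Sum>b\<in>B. (x \<bullet> b) *\<^sub>R b)"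
      using orthonormal_basis_expand[OF B(3) B1, of x] B by auto
    have "S ** S *v x = f (f x)" by (simp add: S flip: matrix_vector_mul_assoc)
    also have "\<dots> = (\<Sum>b\<in>B. (c b * (x \<bullet> b)) *\<^sub>R b)"
      unfolding f_def[of "f x"] by (intro sum.cong) (auto simp: fb c0)
    also have "\<dots> = M *v (\<Sum>b\<in>B. (x \<bullet> b) *\<^sub>R b)"
      by (simp add: linear_sum[OF matrix_vector_mul_linear] o_def matrix_vector_mult_scaleR c mult.commute)
    finally show "S ** S *v x = M *v x" using x by simp
  qed
  ultimately show ?thesis by blast
qed

text \<open>With a square root \<open>T\<close> of \<open>S\<close>, the quadratic form is the
  squared norm of \<open>T *v y\<close>.\<close>

lemma sym_psd_eq_0:
  assumes "sym_psd S" "y \<bullet> (S *v y) = 0"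
  shows "S *v y = 0"
proof -
  obtain T where T: "sym_psd T" "T ** T = S" using psd_sqrt_exists[OF assms(1)] by blast
  have "(T *v y) \<bullet> (T *v y) = y \<bullet> (S *v y)"
    using T by (metis matrix_vector_mul_assoc sym_psd_def symmetric_matrix_inner)
  then have "T *v y = 0" using assms by simp
  then show ?thesis using T by (metis matrix_vector_mul_assoc matrix_vector_mult_0_right)
qed

lemma psd_sqrt_unique:
  fixes S T :: "real ^ 'n ^ 'n"
  assumes S: "sym_psd S" and T: "sym_psd T" and eq: "S ** S = T ** T"
  shows "S = T"
proof -
  define D where "D x = S *v x - T *v x" for x
  have sym: "x \<bullet> (S *v y) = (S *v x) \<bullet> y" "x \<bullet> (T *v y) = (T *v x) \<bullet> y" for x y
    using S T by (auto simp: sym_psd_def intro: symmetric_matrix_inner)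
  have lin: "S *v (x - y) = S *v x - S *v y" "T *v (x - y) = T *v x - T *v y" for x y
    by (simp_all add: matrix_vector_mult_diff_distrib)
  have Dsym: "x \<bullet> D y = D x \<bullet> y" for x y by (simp add: D_def sym inner_diff_left inner_diff_right)
  have "S *v (S *v x) = T *v (T *v x)" for x using eq by (metis matrix_vector_mul_assoc)
  then have SDDT: "S *v D x + D (T *v x) = 0" for x by (simp add: D_def lin)
  have psd: "0 \<le> x \<bullet> (S *v x)" "0 \<le> x \<bullet> (T *v x)" for x using S T by (auto simp: sym_psd_def)
  \<comment> \<open>\<open>D = S - T\<close> satisfies \<open>S D + D T = 0\<close>; multiplying by \<open>D\<close> and taking the trace gives
    \<open>tr (D S D) + tr (D T D) = 0\<close>, a sum of two nonnegative terms.\<close>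
  define a where "a i = axis i (1::real)" for i :: 'n
  define t where "t i j = a i \<bullet> D (a j)" for i j
  have ax: "x = (\<Sum>j\<in>UNIV. (x \<bullet> a j) *\<^sub>R a j)" for x
    by (simp add: a_def inner_axis basis_expansion flip: scalar_mult_eq_scaleR)
  have parse: "x \<bullet> y = (\<Sum>j\<in>UNIV. (x \<bullet> a j) * (y \<bullet> a j))" for x y
    by (simp add: a_def inner_axis) (simp add: inner_vec_def)
  have "(\<Sum>i\<in>UNIV. D (a i) \<bullet> (S *v D (a i))) + (\<Sum>i\<in>UNIV. D (a i) \<bullet> (T *v D (a i))) = 0"
  proof -
    have "(\<Sum>i\<in>UNIV. D (a i) \<bullet> (T *v D (a i))) = (\<Sum>i\<in>UNIV. \<Sum>j\<in>UNIV. (D (a i) \<bullet> a j) * ((T *v D (a i)) \<bullet> a j))"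
      by (subst parse) simp
    also have "\<dots> = (\<Sum>i\<in>UNIV. \<Sum>j\<in>UNIV. (D (a j) \<bullet> a i) * (D (T *v (a j)) \<bullet> a i))"
      using Dsym sym by (intro sum.cong refl) (metis inner_commute)
    also have "\<dots> = (\<Sum>j\<in>UNIV. D (a j) \<bullet> D (T *v a j))"
      by (subst sum.swap) (subst parse, simp)
    finally show ?thesis using SDDT by (simp flip: sum.distrib inner_add_right)
  qed
  moreover have "0 \<le> (\<Sum>i\<in>UNIV. D (a i) \<bullet> (S *v D (a i)))" "0 \<le> (\<Sum>i\<in>UNIV. D (a i) \<bullet> (T *v D (a i)))"
    by (auto intro!: sum_nonneg psd)
  ultimately have "(\<Sum>i\<in>UNIV. D (a i) \<bullet> (S *v D (a i))) = 0" "(\<Sum>i\<in>UNIV. D (a i) \<bullet> (T *v D (a i))) = 0"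
    by linarith+
  then have "D (a i) \<bullet> (S *v D (a i)) = 0" "D (a i) \<bullet> (T *v D (a i)) = 0" for i
    using sum_nonneg_eq_0_iff[of UNIV "\<lambda>i. D (a i) \<bullet> (S *v D (a i))"]
      sum_nonneg_eq_0_iff[of UNIV "\<lambda>i. D (a i) \<bullet> (T *v D (a i))"] by (auto simp: psd)
  \<comment> \<open>Both \<open>S\<close> and \<open>T\<close> kill \<open>D (a i)\<close>, so the
    square of \<open>D\<close> vanishes, and a symmetric operator with zero square is zero.\<close>
  then have "D (D (a i)) = 0" for i
    using S T by (simp add: D_def[of "D (a i)"] sym_psd_eq_0)
  then have "D (a i) = 0" for i by (metis Dsym inner_eq_zero_iff inner_zero_right)
  then have "D (\<Sum>j\<in>UNIV. (x \<bullet> a j) *\<^sub>R a j) = 0" for x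
  proof -
    have "linear D" unfolding D_def by (intro linear_compose_sub matrix_vector_mul_linear)
    then show ?thesis using \<open>\<And>i. D (a i) = 0\<close> by (simp add: linear_sum linear_cmul)
  qed
  then have "D x = 0" for x using ax by metis
  then show "S = T" by (simp add: D_def matrix_eq)
qed

lemma mat_sqrt:
  assumes "sym_psd M"
  shows "sym_psd (mat_sqrt M)" "mat_sqrt M ** mat_sqrt M = M"
proof -
  have "\<exists>!S. sym_psd S \<and> S ** S = M"
    using psd_sqrt_exists[OF assms] psd_sqrt_unique by metis
  from theI'[OF this] show "sym_psd (mat_sqrt M)" "mat_sqrt M ** mat_sqrt M = M"
    by (auto simp: mat_sqrt_def)
qed

lemma inner_mat_sqrt:
  assumes "sym_psd M"
  shows "x \<bullet> (mat_sqrt M *v y) = (mat_sqrt M *v x) \<bullet> y"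
  using mat_sqrt(1)[OF assms] by (auto simp: sym_psd_def intro: symmetric_matrix_inner)

lemma norm_mat_sqrt:
  assumes "sym_psd M"
  shows "(norm (mat_sqrt M *v x))\<^sup>2 = x \<bullet> (M *v x)"
  unfolding power2_norm_eq_inner inner_mat_sqrt[OF assms, symmetric]
  by (simp add: matrix_vector_mul_assoc mat_sqrt(2)[OF assms])

subsection \<open>The Young function and the iteration of level sets\<close>

text \<open>The surplus \<open>y powr (m - 1)\<close> is the whole gain of the Young function: with
  \<open>y\<close> the \<open>m\<close>-th root of \<open>ln t\<close>, the right side is the
  logarithm of \<open>Young m t\<close>, and \<open>y powr m\<close> is \<open>ln t\<close>.\<close>

lemma add_one_powr_ge:
  fixes y m :: real
  assumes "0 < y" "1 \<le> m"
  shows "y powr m + y powr (m - 1) \<le> (y + 1) powr m"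
proof -
  have "(y + 1) powr m = (y + 1) * (y + 1) powr (m - 1)"
    using assms powr_add[of "y + 1" 1 "m - 1"] by simp
  also have "\<dots> \<ge> (y + 1) * y powr (m - 1)"
    using assms by (intro mult_left_mono powr_mono2) auto
  moreover have "(y + 1) * y powr (m - 1) = y powr m + y powr (m - 1)"
    using assms powr_add[of y 1 "m - 1"] by (simp add: algebra_simps)
  ultimately show ?thesis by linarith
qed

lemma ln_ge_iff_powr:
  fixes m t :: real
  assumes "1 < m" "exp (2 powr m) \<le> t"
  shows "2 \<le> ln t powr (1 / m)" "0 < t" "1 \<le> ln t"
proof -
  show t: "0 < t" using assms by (meson exp_gt_zero less_le_trans)
  have l: "2 powr m \<le> ln t" using assms t by (simp add: ln_ge_iff)
  have "(2::real) = (2 powr m) powr (1 / m)" using assms by (simp add: powr_powr)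
  also have "\<dots> \<le> ln t powr (1 / m)" using l assms by (intro powr_mono2) auto
  finally show "2 \<le> ln t powr (1 / m)" .
  have "(1::real) \<le> 2 powr m" using assms by (simp add: ge_one_powr_ge_zero)
  then show "1 \<le> ln t" using l by linarith
qed

text \<open>The linear branch stays below \<open>exp (3 powr m)\<close> and the exponential branch
  starts at this value, so the pieces join without a drop. Strictness later shows that a function
  whose Young integral is zero vanishes.\<close>

lemma Young_strict_mono:
  assumes m: "1 < m" and st: "0 \<le> s" "s < t"
  shows "Young m s < Young m t"
proof -
  let ?E = "exp (2 powr m) :: real" and ?F = "exp (3 powr m) :: real"
  have low: "Young m r < ?F" if "r < ?E" for r
    using that by (simp add: Young_def field_simps)
  have high: "?F \<le> Young m r" if "?E \<le> r" for r
    using that ln_ge_iff_powr[OF m that] m by (auto simp: Young_def intro!: powr_mono2)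
  consider "t < ?E" | "s < ?E" "?E \<le> t" | "?E \<le> s" by linarith
  then show ?thesis
  proof cases
    case 1
    then show ?thesis using st by (simp add: Young_def divide_strict_right_mono)
  next
    case 2
    then show ?thesis using low high by (meson less_le_trans)
  next
    case 3
    then have "ln s powr (1 / m) < ln t powr (1 / m)"
    proof (intro powr_less_mono2)
      show "0 < 1 / m" using m by simp
      show "0 \<le> ln s" using ln_ge_iff_powr(3)[OF m 3] by linarith
      show "ln s < ln t" using ln_ge_iff_powr(2)[OF m 3] st by simp
    qed
    then have "(ln s powr (1 / m) + 1) powr m < (ln t powr (1 / m) + 1) powr m"
      using m by (intro powr_less_mono2) auto
    then show ?thesis using 3 st by (simp add: Young_def)
  qed
qed

lemma Young_mono: "1 < m \<Longrightarrow> 0 \<le> s \<Longrightarrow> s \<le> t \<Longrightarrow> Young m s \<le> Young m t"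
  using Young_strict_mono[of m s t] by (cases "s = t") auto

lemma Young_0 [simp]: "Young m 0 = 0"
  by (simp add: Young_def not_le)

lemma Young_nonneg: "1 < m \<Longrightarrow> 0 \<le> t \<Longrightarrow> 0 \<le> Young m t"
  using Young_mono[of m 0 t] by simp

text \<open>The Orlicz-Sobolev inequality is stated with \<open>inv_into\<close>, a right inverse on
  the range only; surjectivity onto the nonnegative reals makes it usable. Above
  \<open>exp (3 powr m)\<close> the exponent formula is solved explicitly.\<close>

lemma Young_surj:
  assumes m: "1 < m" and y: "0 \<le> y"
  shows "y \<in> Young m ` {0..}"
proof (cases "y < exp (3 powr m)")
  case True
  let ?t = "y * exp (2 powr m) / exp (3 powr m)"
  have "?t < exp (2 powr m)" using True by (simp add: field_simps)
  then have "Young m ?t = y" by (simp add: Young_def)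
  then show ?thesis using y by (intro image_eqI[of _ _ ?t]) auto
next
  case False
  then have y0: "0 < y" by (meson exp_gt_zero less_le_trans not_less)
  have ly: "3 powr m \<le> ln y" using False y0 by (simp add: not_less ln_ge_iff)
  have "(3::real) = (3 powr m) powr (1 / m)" using m by (simp add: powr_powr)
  also have "\<dots> \<le> ln y powr (1 / m)" using ly m by (intro powr_mono2) auto
  finally have 3: "3 \<le> ln y powr (1 / m)" .
  let ?s = "(ln y powr (1 / m) - 1) powr m"
  have "2 powr m \<le> ?s" using 3 m by (intro powr_mono2) auto
  moreover have "?s powr (1 / m) = ln y powr (1 / m) - 1" using 3 m by (simp add: powr_powr)
  moreover have "0 < ln y" using ly by (smt (verit) powr_gt_zero)
  ultimately have "Young m (exp ?s) = y" using m y0 by (simp add: Young_def powr_powr)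
  then show ?thesis by (intro image_eqI[of _ _ "exp ?s"]) auto
qed

lemma Young_le_if_inv_le:
  assumes "1 < m" "0 \<le> y" "inv_into {0..} (Young m) y \<le> s"
  shows "y \<le> Young m s"
  using Young_mono[OF assms(1) _ assms(3)] f_inv_into_f[OF Young_surj[OF assms(1,2)]]
    inv_into_into[OF Young_surj[OF assms(1,2)]] by auto

text \<open>The exponent exceeds \<open>ln t\<close> by at least \<open>y powr (m - 1)\<close>,
  where \<open>y\<close> is the \<open>m\<close>-th root of \<open>ln t\<close>. Since
  \<open>y \<ge> 2\<close> and \<open>m / 2 \<le> m - 1\<close>, this surplus dominates
  \<open>y powr (m / 2)\<close>, which is \<open>sqrt (ln t)\<close>. The iteration sees the Young
  function through this lower bound.\<close>

lemma Young_ge: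
  assumes m: "2 \<le> m" and t: "exp (2 powr m) \<le> t"
  shows "t * exp (sqrt (ln t)) \<le> Young m t"
proof -
  have m1: "1 < m" using m by simp
  note l = ln_ge_iff_powr[OF m1 t]
  define y where "y = ln t powr (1 / m)"
  have y: "2 \<le> y" "y powr m = ln t" using l m by (auto simp: y_def powr_powr)
  have "sqrt (ln t) = (y powr m) powr (1 / 2)" using y l by (simp only: powr_half_sqrt)
  also have "\<dots> = y powr (m * (1 / 2))" by (simp only: powr_powr)
  also have "\<dots> \<le> y powr (m - 1)" using y m by (intro powr_mono) auto
  finally have "ln t + sqrt (ln t) \<le> y powr m + y powr (m - 1)" using y by simp
  also have "\<dots> \<le> (y + 1) powr m" using y m by (intro add_one_powr_ge) auto
  finally have "exp (ln t + sqrt (ln t)) \<le> Young m t"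
    using t by (simp add: Young_def y_def)
  then show ?thesis using l by (simp add: exp_add)
qed

section \<open>De Giorgi iteration\<close>

text \<open>A linear function beats the square of a logarithm, and \<open>N\<close> absorbs the
  finitely many exceptions. The left side is what one step of the iteration demands of the exponent:
  the square makes room for the loss \<open>c + 2 ln (j + 1)\<close> under a square root, and the
  second summand pays for the increment \<open>1 / (j + 1)\<^sup>2\<close> inside the
  logarithm.\<close>

lemma degiorgi_start:
  "\<exists>N::real. \<forall>j::nat. (c + 2 * ln (real j + 1))\<^sup>2 + 2 * ln (real j + 1) \<le> N + real j"
proof -
  define f where "f j = (c + 2 * ln (real j + 1))\<^sup>2 + 2 * ln (real j + 1) - real j" for j :: nat
  have "filterlim f at_bot sequentially" unfolding f_def by real_asymp
  then have "eventually (\<lambda>j. f j \<le> 0) sequentially" by (simp add: filterlim_at_bot)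
  then obtain J where J: "\<And>j. j \<ge> J \<Longrightarrow> f j \<le> 0" by (auto simp: eventually_sequentially)
  define N where "N = (\<Sum>j<J. \<bar>f j\<bar>)"
  have "f j \<le> N" for j
  proof (cases "j < J")
    case True
    then have "\<bar>f j\<bar> \<le> N" unfolding N_def by (intro member_le_sum) auto
    then show ?thesis by simp
  next
    case False
    moreover have "0 \<le> N" by (simp add: N_def sum_nonneg)
    ultimately show ?thesis using J[of j] by simp
  qed
  then show ?thesis by (intro exI[of _ N]) (simp add: f_def algebra_simps)
qed

text \<open>With increments \<open>1 / (j + 1)\<^sup>2\<close> the bound \<open>\<nu> \<le> e\<^sup>-\<^sup>N\<^sup>-\<^sup>j\<close> reproduces itself, because the gain
  \<open>sqrt (N + j)\<close> in the exponent beats the loss \<open>2 ln (j + 1)\<close>.\<close>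

lemma degiorgi_iteration:
  fixes m V :: real
  assumes m: "2 \<le> m" and V: "0 < V"
  shows "\<exists>k>0. \<forall>\<nu>::real \<Rightarrow> real. (\<forall>s\<ge>0. 0 \<le> \<nu> s \<and> \<nu> s \<le> V) \<longrightarrow> (\<forall>s\<ge>0. \<forall>t\<ge>s. \<nu> t \<le> \<nu> s) \<longrightarrow>
    (\<forall>s\<ge>0. \<forall>d>0. 0 < \<nu> s \<longrightarrow>
      \<nu> (s + d) * Young m (exp (2 powr m) * d / \<nu> s) \<le> exp (3 powr m)) \<longrightarrow> \<nu> k = 0"
proof -
  let ?E = "exp (2 powr m) :: real" and ?F = "exp (3 powr m) :: real"
  have m1: "1 < m" using m by simp
  have E1: "1 \<le> ?E" by simp
  \<comment> \<open>\<open>ln (?F / ?E)\<close> cancels the prefactor in \<open>step'\<close>; the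
    additional \<open>1\<close> is the net gain of a factor \<open>exp (- 1)\<close> per
    step.\<close>
  define c where "c = 1 + ln (?F / ?E)"
  have FE: "0 < ?F / ?E" by simp
  obtain N0 where N0: "\<And>j::nat. (c + 2 * ln (real j + 1))\<^sup>2 + 2 * ln (real j + 1) \<le> N0 + real j"
    using degiorgi_start by metis
  have c0: "0 \<le> c"
  proof -
    have "(2::real) powr m \<le> 3 powr m" using m by (intro powr_mono2) auto
    then show ?thesis by (simp add: c_def ln_div)
  qed
  define d where "d j = 1 / (real j + 1)\<^sup>2" for j :: nat
  have d0: "0 < d j" for j by (simp add: d_def)
  have ln_d: "ln (d j) = - 2 * ln (real j + 1)" for j
    by (simp add: d_def ln_div ln_realpow)
  have sd: "summable d" using inverse_squares_sums unfolding d_def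
    by (auto simp: sums_iff add.commute)
  \<comment> \<open>The starting level is reached in one jump: \<open>V \<le> k0\<close> puts the
    argument of the Young function above its threshold, and the second summand brings the measure
    down to \<open>exp (- N0)\<close>.\<close>
  define k0 where "k0 = V + ?F / ?E * V * exp N0"
  have k0: "V \<le> k0" "?F / ?E * V * exp N0 \<le> k0" "0 < k0"
    using V by (auto simp: k0_def add_pos_pos)
  define s where "s j = k0 + (\<Sum>i<j. d i)" for j
  \<comment> \<open>Finite because the increments are summable; it depends on \<open>m\<close> and
    \<open>V\<close> but not on \<open>\<nu>\<close>.\<close>
  define k where "k = k0 + suminf d"
  have sk: "s j \<le> k" for j unfolding s_def k_def using sum_le_suminf[OF sd] d0 by (simp add: less_imp_le)
  have s0: "0 < s j" for j using k0 d0 by (simp add: s_def add_pos_nonneg sum_nonneg less_imp_le)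
  show ?thesis
  proof (intro exI[of _ k] conjI allI impI)
    show "0 < k" using sk[of 0] s0[of 0] by linarith
    fix \<nu> :: "real \<Rightarrow> real"
    assume b: "\<forall>s\<ge>0. 0 \<le> \<nu> s \<and> \<nu> s \<le> V" and mono: "\<forall>s\<ge>0. \<forall>t\<ge>s. \<nu> t \<le> \<nu> s"
      and step: "\<forall>s\<ge>0. \<forall>d>0. 0 < \<nu> s \<longrightarrow> \<nu> (s + d) * Young m (?E * d / \<nu> s) \<le> ?F"
    \<comment> \<open>The side condition \<open>\<nu> s \<le> d\<close> says that the argument
      \<open>?E * d / \<nu> s\<close> lies in the exponential branch, where \<open>Young_ge\<close>
      applies.\<close>
    have step': "\<nu> (s + d) \<le> ?F / ?E * \<nu> s / d * exp (- sqrt (ln (?E * d / \<nu> s)))"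
      if "0 \<le> s" "0 < \<nu> s" "\<nu> s \<le> d" for s d
    proof -
      have d: "0 < d" using that by linarith
      have "1 \<le> d / \<nu> s" using that by simp
      then have "?E * 1 \<le> ?E * (d / \<nu> s)" by (intro mult_left_mono) auto
      then have "?E * d / \<nu> s * exp (sqrt (ln (?E * d / \<nu> s))) \<le> Young m (?E * d / \<nu> s)"
        by (intro Young_ge m) simp
      then have "\<nu> (s + d) * (?E * d / \<nu> s * exp (sqrt (ln (?E * d / \<nu> s)))) \<le> ?F"
        using step that d b by (meson add_nonneg_nonneg less_imp_le mult_left_mono order_trans)
      moreover have "0 < ?E * d / \<nu> s * exp (sqrt (ln (?E * d / \<nu> s)))" using that d by simp
      ultimately have "\<nu> (s + d) \<le> ?F / (?E * d / \<nu> s * exp (sqrt (ln (?E * d / \<nu> s))))"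
        by (simp only: pos_le_divide_eq)
      also have "\<dots> = ?F / ?E * \<nu> s / d * exp (- sqrt (ln (?E * d / \<nu> s)))"
        by (simp add: exp_minus field_simps)
      finally show ?thesis .
    qed
    have main: "\<nu> (s j) \<le> exp (- (N0 + real j))" for j
    proof (induction j)
      case 0
      show ?case
      proof (cases "\<nu> 0 = 0")
        case True
        have "\<nu> (s 0) \<le> \<nu> 0" using mono s0[of 0] by auto
        then show ?thesis using True by (simp add: order_trans[OF _ less_imp_le[OF exp_gt_zero]])
      next
        case False
        then have n0: "0 < \<nu> 0" "\<nu> 0 \<le> V" using b by (auto simp: less_le)
        have "0 \<le> ln (?E * k0 / \<nu> 0)"
        proof -
          have "1 \<le> k0 / \<nu> 0" using n0 k0 by simp
          then have "1 * 1 \<le> ?E * (k0 / \<nu> 0)" using E1 by (intro mult_mono) auto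
          then show ?thesis by simp
        qed
        then have "exp (- sqrt (ln (?E * k0 / \<nu> 0))) \<le> 1" by simp
        moreover have "\<nu> (0 + k0) \<le> ?F / ?E * \<nu> 0 / k0 * exp (- sqrt (ln (?E * k0 / \<nu> 0)))"
          using n0 k0 by (intro step') auto
        moreover have "?F / ?E * \<nu> 0 / k0 * exp (- sqrt (ln (?E * k0 / \<nu> 0))) \<le> ?F / ?E * \<nu> 0 / k0 * 1"
          using n0 k0 calculation(1) by (intro mult_left_mono) auto
        moreover have "?F / ?E * \<nu> 0 / k0 \<le> ?F / ?E * V / k0"
          using n0 k0 by (intro divide_right_mono mult_left_mono) auto
        moreover have "?F / ?E * V / k0 \<le> exp (- N0)"
          using k0 by (simp add: exp_minus field_simps)
        ultimately show ?thesis by (simp add: s_def)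
      qed
    next
      case (Suc j)
      have ss: "s (Suc j) = s j + d j" by (simp add: s_def)
      show ?case
      proof (cases "\<nu> (s j) = 0")
        case True
        have "\<nu> (s (Suc j)) \<le> \<nu> (s j)" using mono s0[of j] d0[of j] by (auto simp: ss)
        then show ?thesis using True by (simp add: order_trans[OF _ less_imp_le[OF exp_gt_zero]])
      next
        case False
        then have n0: "0 < \<nu> (s j)" using b s0[of j] by (auto simp: less_le)
        then have ln_n: "ln (\<nu> (s j)) \<le> - (N0 + real j)"
          using Suc by (metis exp_gt_zero ln_exp ln_le_cancel_iff)
        let ?l = "2 * ln (real j + 1)"
        have l0: "0 \<le> ?l" by simp
        have N: "(c + ?l)\<^sup>2 + ?l \<le> N0 + real j" by (rule N0)
        have "?l \<le> N0 + real j" using N zero_le_power2[of "c + ?l"] by linarith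
        then have "ln (\<nu> (s j)) \<le> ln (d j)" using ln_n by (simp add: ln_d)
        then have nd: "\<nu> (s j) \<le> d j" using n0 d0 by simp
        have lnE: "ln (?E * d j / \<nu> (s j)) = 2 powr m - ?l - ln (\<nu> (s j))"
          using n0 d0[of j] by (simp add: ln_div ln_mult ln_d)
        have "(0::real) \<le> 2 powr m" by simp
        then have "(c + ?l)\<^sup>2 \<le> ln (?E * d j / \<nu> (s j))" unfolding lnE using ln_n N by linarith
        then have sq: "c + ?l \<le> sqrt (ln (?E * d j / \<nu> (s j)))" using c0 l0 by (intro real_le_rsqrt)
        have "\<nu> (s (Suc j)) \<le> ?F / ?E * \<nu> (s j) / d j * exp (- sqrt (ln (?E * d j / \<nu> (s j))))"
          unfolding ss using n0 nd s0[of j] by (intro step') auto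
        also have "\<dots> \<le> ?F / ?E * \<nu> (s j) / d j * exp (- (c + ?l))"
          using n0 d0[of j] sq by (intro mult_left_mono) auto
        also have "\<dots> = \<nu> (s j) * exp (- 1)"
        proof -
          have "exp (- (c + ?l)) = exp (- 1) / (?F / ?E) * d j"
          proof -
            have "- (c + ?l) = - 1 - ln (?F / ?E) + ln (d j)" by (simp add: c_def ln_d)
            also have "exp \<dots> = exp (- 1) / exp (ln (?F / ?E)) * exp (ln (d j))"
              by (simp only: exp_add exp_diff)
            finally show ?thesis using d0[of j] by simp
          qed
          then show ?thesis using d0[of j] by simp
        qed
        also have "\<dots> \<le> exp (- (N0 + real j)) * exp (- 1)" using Suc by (intro mult_right_mono) auto
        finally show ?thesis by (simp add: algebra_simps flip: exp_add)
      qed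
    qed
    have "\<nu> k \<le> exp (- (N0 + real j))" for j
      using main[of j] mono sk[of j] s0[of j] by (meson less_imp_le order_trans)
    moreover have "(\<lambda>j. exp (- (N0 + real j))) \<longlonglongrightarrow> 0" by real_asymp
    ultimately have "\<nu> k \<le> 0" by (intro LIMSEQ_le_const) auto
    then show "\<nu> k = 0" using b sk[of 0] s0[of 0] by (meson antisym less_imp_le order_trans)
  qed
qed

subsection \<open>Averages and mollifiers\<close>

lemma nn_integral_translation:
  fixes f :: "'a::euclidean_space \<Rightarrow> ennreal"
  assumes [measurable]: "f \<in> borel_measurable borel"
  shows "(\<integral>\<^sup>+x. f (x + h) \<partial>lborel) = (\<integral>\<^sup>+x. f x \<partial>lborel)"
proof -
  have "(\<integral>\<^sup>+x. f x \<partial>lborel) = (\<integral>\<^sup>+x. f x \<partial>distr lborel borel ((+) h))"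
    by (simp add: lborel_distr_plus)
  also have "\<dots> = (\<integral>\<^sup>+x. f (x + h) \<partial>lborel)"
    by (subst nn_integral_distr) (auto simp: add.commute)
  finally show ?thesis ..
qed

text \<open>Squeeze \<open>B\<close> between a compact \<open>K\<close> and an open \<open>U\<close>
  with \<open>U - K\<close> of measure at most \<open>e / 2\<close>. For \<open>h\<close> shorter
  than the distance from \<open>K\<close> to the complement of \<open>U\<close>, the indicator can
  change between \<open>x\<close> and \<open>x + h\<close> only if one of the two points lies in
  \<open>U - K\<close>.\<close>

lemma translation_indicator:
  fixes B :: "'a::euclidean_space set"
  assumes B: "B \<in> sets borel" "emeasure lborel B < \<infinity>" and e: "0 < e"
  shows "\<exists>d>0. \<forall>h. norm h < d \<longrightarrow>
    (\<integral>\<^sup>+x. ennreal \<bar>indicator B (x + h) - indicator B x :: real\<bar> \<partial>lborel) \<le> ennreal e"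
proof -
  have Bl: "B \<in> sets lebesgue" "B \<in> lmeasurable" using B by (auto simp: fmeasurable_def)
  obtain U where U: "open U" "B \<subseteq> U" "U - B \<in> lmeasurable" "emeasure lebesgue (U - B) < ennreal (e / 4)"
    using sets_lebesgue_outer_open[OF Bl(1), of "e / 4"] e by auto
  obtain K where K: "compact K" "K \<subseteq> B" "emeasure lebesgue (B - K) < ennreal (e / 4)"
  proof -
    obtain N C where C: "negligible N" "\<And>n::nat. compact (C n)" "B = (\<Union>n. C n) \<union> N"
      using lebesgue_regular_inner[OF Bl(1)] by blast
    define D where "D n = B - (\<Union>i\<le>n. C i)" for n
    have D: "D n \<in> sets lebesgue" for n
      unfolding D_def using C(2) by (intro sets.Diff Bl(1) sets.finite_UN fmeasurableD lmeasurable_compact) auto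
    have "(\<lambda>n. emeasure lebesgue (D n)) \<longlonglongrightarrow> emeasure lebesgue (\<Inter>n. D n)"
    proof (rule Lim_emeasure_decseq)
      show "emeasure lebesgue (D n) \<noteq> \<infinity>" for n
        using emeasure_mono[of "D n" B lebesgue] Bl B by (auto simp: D_def top_unique)
    qed (use D in \<open>auto simp: D_def decseq_def\<close>)
    moreover have "(\<Inter>n. D n) \<subseteq> N" using C(3) by (auto simp: D_def)
    then have "emeasure lebesgue (\<Inter>n. D n) = 0"
      using C(1) by (metis negligible_subset negligible_iff_emeasure0 negligible_imp_sets)
    ultimately have "(\<lambda>n. emeasure lebesgue (D n)) \<longlonglongrightarrow> 0" by simp
    then have "eventually (\<lambda>n. emeasure lebesgue (D n) < ennreal (e / 4)) sequentially"
      using e by (intro order_tendstoD) auto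
    then obtain n where "emeasure lebesgue (D n) < ennreal (e / 4)" by (auto simp: eventually_sequentially)
    then show ?thesis using C by (intro that[of "\<Union>i\<le>n. C i"]) (auto simp: D_def intro!: compact_UN)
  qed
  obtain d where d: "0 < d" "\<And>x y. x \<in> K \<Longrightarrow> dist x y < d \<Longrightarrow> y \<in> U"
  proof -
    have "closed (- U)" "K \<inter> (- U) = {}" using U K by auto
    then obtain d where "d > 0" "\<forall>x\<in>K. \<forall>y\<in>-U. d \<le> dist x y"
      using separate_compact_closed[OF K(1)] by metis
    then show ?thesis by (intro that[of d]) force+
  qed
  show ?thesis
  proof (intro exI[of _ d] conjI allI impI)
    show "0 < d" by fact
    fix h :: 'a assume h: "norm h < d"
    have [measurable]: "K \<in> sets borel" "U \<in> sets borel" "B \<in> sets borel"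
      using K(1) U(1) B by (auto simp: compact_imp_closed)
    have "\<bar>indicator B (x + h) - indicator B x :: real\<bar> \<le> indicator (U - K) x + indicator (U - K) (x + h)" for x
      using d(2)[of x "x + h"] d(2)[of "x + h" x] h U(2) K(2)
      by (auto simp: indicator_def dist_norm split: if_splits)
    then have "(\<integral>\<^sup>+x. ennreal \<bar>indicator B (x + h) - indicator B x :: real\<bar> \<partial>lborel) \<le>
       (\<integral>\<^sup>+x. ennreal (indicator (U - K) x + indicator (U - K) (x + h)) \<partial>lborel)"
      by (intro nn_integral_mono ennreal_leI)
    also have "\<dots> = (\<integral>\<^sup>+x. indicator (U - K) x \<partial>lborel) + (\<integral>\<^sup>+x. indicator (U - K) (x + h) \<partial>lborel)"
      by (simp add: nn_integral_add ennreal_indicator)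
    also have "(\<integral>\<^sup>+x. indicator (U - K) (x + h) \<partial>lborel) = (\<integral>\<^sup>+x. indicator (U - K) x \<partial>lborel)"
      by (rule nn_integral_translation) measurable
    also have "(\<integral>\<^sup>+x. indicator (U - K) x \<partial>lborel) = emeasure lebesgue ((U - B) \<union> (B - K))"
      using U(2) K(2) by (subst nn_integral_indicator) (auto intro!: arg_cong[where f="emeasure lborel"])
    finally have *: "(\<integral>\<^sup>+x. ennreal \<bar>indicator B (x + h) - indicator B x :: real\<bar> \<partial>lborel) \<le>
        emeasure lebesgue ((U - B) \<union> (B - K)) + emeasure lebesgue ((U - B) \<union> (B - K))" .
    have "emeasure lebesgue ((U - B) \<union> (B - K)) \<le> emeasure lebesgue (U - B) + emeasure lebesgue (B - K)"
      by (rule emeasure_subadditive) (auto intro!: sets.Diff)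
    also have "\<dots> \<le> ennreal (e / 4) + ennreal (e / 4)" using U K by (intro add_mono) auto
    also have "\<dots> = ennreal (e / 2)" using e by (simp flip: ennreal_plus)
    finally have "emeasure lebesgue ((U - B) \<union> (B - K)) \<le> ennreal (e / 2)" .
    then have "emeasure lebesgue ((U - B) \<union> (B - K)) + emeasure lebesgue ((U - B) \<union> (B - K)) \<le>
        ennreal (e / 2) + ennreal (e / 2)" by (intro add_mono)
    also have "\<dots> = ennreal e" using e by (simp flip: ennreal_plus)
    finally show "(\<integral>\<^sup>+x. ennreal \<bar>indicator B (x + h) - indicator B x :: real\<bar> \<partial>lborel) \<le> ennreal e"
      using * by (rule order_trans[rotated])
  qed
qed

text \<open>The functions with this property include the indicators of sets of finite measure and
  are closed under sums and dominated limits, the latter because translation preserves L1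
  distances.\<close>

lemma translation_continuous_L1:
  fixes f :: "'a::euclidean_space \<Rightarrow> real"
  assumes "integrable lborel f" "0 < e"
  shows "\<exists>d>0. \<forall>h. norm h < d \<longrightarrow> (\<integral>\<^sup>+x. ennreal \<bar>f (x + h) - f x\<bar> \<partial>lborel) \<le> ennreal e"
  using assms
proof (induction arbitrary: e rule: integrable_induct)
  case (base A c e)
  show ?case
  proof (cases "c = 0")
    case False
    then have "0 < e / \<bar>c\<bar>" using base by simp
    then obtain d where d: "d > 0" "\<And>h. norm h < d \<Longrightarrow>
      (\<integral>\<^sup>+x. ennreal \<bar>indicator A (x + h) - indicator A x :: real\<bar> \<partial>lborel) \<le> ennreal (e / \<bar>c\<bar>)"
      using translation_indicator[of A "e / \<bar>c\<bar>"] base by auto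
    have [measurable]: "A \<in> sets borel" using base by simp
    show ?thesis
    proof (intro exI[of _ d] conjI allI impI d(1))
      fix h :: 'a assume h: "norm h < d"
      have "(\<integral>\<^sup>+x. ennreal \<bar>indicator A (x + h) *\<^sub>R c - indicator A x *\<^sub>R c\<bar> \<partial>lborel) =
        (\<integral>\<^sup>+x. ennreal \<bar>c\<bar> * ennreal \<bar>indicator A (x + h) - indicator A x :: real\<bar> \<partial>lborel)"
      proof (intro nn_integral_cong)
        fix x
        have "\<bar>a *\<^sub>R c - b *\<^sub>R c\<bar> = \<bar>c\<bar> * \<bar>a - b\<bar>" for a b :: real
          by (metis abs_mult mult.commute real_scaleR_def scaleR_left_diff_distrib)
        then show "ennreal \<bar>indicator A (x + h) *\<^sub>R c - indicator A x *\<^sub>R c\<bar> =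
            ennreal \<bar>c\<bar> * ennreal \<bar>indicator A (x + h) - indicator A x :: real\<bar>"
          by (simp only: ennreal_mult'' abs_ge_zero)
      qed
      also have "\<dots> = ennreal \<bar>c\<bar> * (\<integral>\<^sup>+x. ennreal \<bar>indicator A (x + h) - indicator A x :: real\<bar> \<partial>lborel)"
        by (rule nn_integral_cmult) measurable
      also have "\<dots> \<le> ennreal \<bar>c\<bar> * ennreal (e / \<bar>c\<bar>)" using d(2)[OF h] by (rule mult_left_mono) simp
      also have "\<dots> = ennreal e" using False less_imp_le[OF base(3)] by (subst ennreal_mult[symmetric]) auto
      finally show "(\<integral>\<^sup>+x. ennreal \<bar>indicator A (x + h) *\<^sub>R c - indicator A x *\<^sub>R c\<bar> \<partial>lborel) \<le> ennreal e" .
    qed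
  qed (auto intro: exI[of _ 1])
next
  case (add f g e)
  have [measurable]: "f \<in> borel_measurable borel" "g \<in> borel_measurable borel"
    using add.hyps by (auto dest: borel_measurable_integrable)
  have e: "e / 2 > 0" using add by simp
  obtain d where d: "d > 0" "\<And>h. norm h < d \<Longrightarrow> (\<integral>\<^sup>+x. ennreal \<bar>f (x + h) - f x\<bar> \<partial>lborel) \<le> ennreal (e / 2)"
    using add.IH(1)[OF e] by blast
  obtain d' where d': "d' > 0" "\<And>h. norm h < d' \<Longrightarrow> (\<integral>\<^sup>+x. ennreal \<bar>g (x + h) - g x\<bar> \<partial>lborel) \<le> ennreal (e / 2)"
    using add.IH(2)[OF e] by blast
  show ?case
  proof (intro exI[of _ "min d d'"] conjI allI impI)
    fix h :: 'a assume h: "norm h < min d d'"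
    have "(\<integral>\<^sup>+x. ennreal \<bar>f (x + h) + g (x + h) - (f x + g x)\<bar> \<partial>lborel) \<le>
      (\<integral>\<^sup>+x. ennreal \<bar>f (x + h) - f x\<bar> + ennreal \<bar>g (x + h) - g x\<bar> \<partial>lborel)"
      by (intro nn_integral_mono) (simp flip: ennreal_plus)
    also have "\<dots> = (\<integral>\<^sup>+x. ennreal \<bar>f (x + h) - f x\<bar> \<partial>lborel) + (\<integral>\<^sup>+x. ennreal \<bar>g (x + h) - g x\<bar> \<partial>lborel)"
      by (rule nn_integral_add) measurable
    also have "\<dots> \<le> ennreal (e / 2) + ennreal (e / 2)" using d d' h by (intro add_mono) auto
    also have "\<dots> = ennreal e" using add by (simp flip: ennreal_plus)
    finally show "(\<integral>\<^sup>+x. ennreal \<bar>f (x + h) + g (x + h) - (f x + g x)\<bar> \<partial>lborel) \<le> ennreal e" .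
  qed (use d d' in auto)
next
  case (lim f s e)
  have sm [measurable]: "\<And>i. s i \<in> borel_measurable borel" "f \<in> borel_measurable borel"
    using lim.hyps by (auto dest: borel_measurable_integrable)
  have "(\<lambda>i. \<integral>\<^sup>+x. ennreal (norm (f x - s i x)) \<partial>lborel) \<longlonglongrightarrow> 0"
  proof (rule nn_integral_dominated_convergence_norm[of _ _ _ "\<lambda>x. 2 * norm (f x)"])
    show "(\<integral>\<^sup>+x. ennreal (2 * norm (f x)) \<partial>lborel) < \<infinity>"
      using lim.hyps(4) integrable_iff_bounded[of lborel "\<lambda>x. 2 * f x"] by (simp add: abs_mult)
  qed (use lim.hyps in auto)
  then have "eventually (\<lambda>i. (\<integral>\<^sup>+x. ennreal (norm (f x - s i x)) \<partial>lborel) < ennreal (e / 3)) sequentially"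
    using lim.prems by (intro order_tendstoD) auto
  then obtain i where i: "(\<integral>\<^sup>+x. ennreal \<bar>s i x - f x\<bar> \<partial>lborel) < ennreal (e / 3)"
    by (auto simp: eventually_sequentially abs_minus_commute)
  have "e / 3 > 0" using lim.prems by simp
  then obtain d where d: "d > 0" "\<And>h. norm h < d \<Longrightarrow>
    (\<integral>\<^sup>+x. ennreal \<bar>s i (x + h) - s i x\<bar> \<partial>lborel) \<le> ennreal (e / 3)"
    using lim.IH[of "e / 3" i] by blast
  show ?case
  proof (intro exI[of _ d] conjI allI impI d(1))
    fix h :: 'a assume h: "norm h < d"
    have "(\<integral>\<^sup>+x. ennreal \<bar>f (x + h) - f x\<bar> \<partial>lborel) \<le>
      (\<integral>\<^sup>+x. ennreal \<bar>s i (x + h) - f (x + h)\<bar> + ennreal \<bar>s i (x + h) - s i x\<bar> + ennreal \<bar>s i x - f x\<bar> \<partial>lborel)"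
      by (intro nn_integral_mono) (simp flip: ennreal_plus)
    also have "\<dots> = (\<integral>\<^sup>+x. ennreal \<bar>s i (x + h) - f (x + h)\<bar> \<partial>lborel) + (\<integral>\<^sup>+x. ennreal \<bar>s i (x + h) - s i x\<bar> \<partial>lborel)
       + (\<integral>\<^sup>+x. ennreal \<bar>s i x - f x\<bar> \<partial>lborel)"
      by (simp add: nn_integral_add)
    also have "(\<integral>\<^sup>+x. ennreal \<bar>s i (x + h) - f (x + h)\<bar> \<partial>lborel) = (\<integral>\<^sup>+x. ennreal \<bar>s i x - f x\<bar> \<partial>lborel)"
      by (rule nn_integral_translation[of "\<lambda>x. ennreal \<bar>s i x - f x\<bar>"]) measurable
    also have "(\<integral>\<^sup>+x. ennreal \<bar>s i x - f x\<bar> \<partial>lborel) + (\<integral>\<^sup>+x. ennreal \<bar>s i (x + h) - s i x\<bar> \<partial>lborel)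
       + (\<integral>\<^sup>+x. ennreal \<bar>s i x - f x\<bar> \<partial>lborel) \<le> ennreal (e / 3) + ennreal (e / 3) + ennreal (e / 3)"
      using d(2)[OF h] i by (intro add_mono) auto
    also have "\<dots> = ennreal e" using lim.prems by (simp flip: ennreal_plus)
    finally show "(\<integral>\<^sup>+x. ennreal \<bar>f (x + h) - f x\<bar> \<partial>lborel) \<le> ennreal e" .
  qed
qed

text \<open>The prefactor is the reciprocal volume of the cube, so this is a mean oscillation over a
  cube with \<open>x\<close> as its lower corner. It is valued in \<open>ennreal\<close> so that
  Tonelli applies without integrability side conditions; the mollification errors below are all
  bounded by it.\<close>

definition avg_osc :: "('a::euclidean_space \<Rightarrow> real) \<Rightarrow> nat \<Rightarrow> 'a \<Rightarrow> ennreal" where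
  "avg_osc f k x = ennreal (real (Suc k) ^ DIM('a)) *
     (\<integral>\<^sup>+h. indicator (cbox 0 (One /\<^sub>R real (Suc k))) h * ennreal \<bar>f (x + h) - f x\<bar> \<partial>lborel)"

lemma measurable_avg_osc [measurable]:
  fixes f :: "'a::euclidean_space \<Rightarrow> real"
  assumes [measurable]: "f \<in> borel_measurable borel"
  shows "avg_osc f k \<in> borel_measurable borel"
  unfolding avg_osc_def by measurable

lemma emeasure_small_cube:
  "ennreal (real (Suc k) ^ DIM('a)) * emeasure lborel (cbox 0 (One /\<^sub>R real (Suc k) :: 'a::euclidean_space)) = 1"
proof -
  have "emeasure lborel (cbox 0 (One /\<^sub>R real (Suc k) :: 'a)) = ennreal ((1 / real (Suc k)) ^ DIM('a))"
    by (subst emeasure_lborel_cbox) (auto simp: inverse_eq_divide)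
  then show ?thesis by (simp flip: ennreal_mult' add: power_one_over)
qed

text \<open>After Tonelli, the inner integral is the L1 distance from \<open>f\<close> to a
  translate, which is small uniformly over the shrinking cube.\<close>

lemma avg_osc_tendsto_0:
  fixes f :: "'a::euclidean_space \<Rightarrow> real"
  assumes f: "integrable lborel f"
  shows "(\<lambda>k. \<integral>\<^sup>+x. avg_osc f k x \<partial>lborel) \<longlonglongrightarrow> 0"
proof -
  have [measurable]: "f \<in> borel_measurable borel" using f by (auto dest: borel_measurable_integrable)
  have "eventually (\<lambda>k. (\<integral>\<^sup>+x. avg_osc f k x \<partial>lborel) \<le> ennreal e) sequentially" if e: "0 < e" for e
  proof -
    obtain d where d: "d > 0" "\<And>h. norm h < d \<Longrightarrow> (\<integral>\<^sup>+x. ennreal \<bar>f (x + h) - f x\<bar> \<partial>lborel) \<le> ennreal e"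
      using translation_continuous_L1[OF f e] by blast
    have "(\<lambda>k. norm (One::'a) / real (Suc k)) \<longlonglongrightarrow> 0" by (intro lim_const_over_n LIMSEQ_Suc)
    then have "eventually (\<lambda>k. norm (One::'a) / real (Suc k) < d) sequentially"
      using d(1) by (rule order_tendstoD)
    then show ?thesis
    proof eventually_elim
      case (elim k)
      let ?Q = "cbox 0 (One /\<^sub>R real (Suc k)) :: 'a set"
      let ?n = "ennreal (real (Suc k) ^ DIM('a))"
      have small: "norm h < d" if "h \<in> ?Q" for h
      proof -
        have "norm h \<le> norm (One /\<^sub>R real (Suc k) :: 'a)"
          using that by (intro norm_le_componentwise) (auto simp: mem_box)
        also have "\<dots> = norm (One::'a) / real (Suc k)" by (simp add: divide_inverse_commute)
        finally show ?thesis using elim by simp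
      qed
      have "(\<integral>\<^sup>+x. avg_osc f k x \<partial>lborel) =
        ?n * (\<integral>\<^sup>+x. \<integral>\<^sup>+h. indicator ?Q h * ennreal \<bar>f (x + h) - f x\<bar> \<partial>lborel \<partial>lborel)"
        unfolding avg_osc_def by (rule nn_integral_cmult) measurable
      also have "(\<integral>\<^sup>+x. \<integral>\<^sup>+h. indicator ?Q h * ennreal \<bar>f (x + h) - f x\<bar> \<partial>lborel \<partial>lborel) =
        (\<integral>\<^sup>+h. \<integral>\<^sup>+x. indicator ?Q h * ennreal \<bar>f (x + h) - f x\<bar> \<partial>lborel \<partial>lborel)"
        by (rule lborel_pair.Fubini'[symmetric]) measurable
      also have "\<dots> = (\<integral>\<^sup>+h. indicator ?Q h * (\<integral>\<^sup>+x. ennreal \<bar>f (x + h) - f x\<bar> \<partial>lborel) \<partial>lborel)"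
        by (intro nn_integral_cong nn_integral_cmult) measurable
      also have "\<dots> \<le> (\<integral>\<^sup>+h. indicator ?Q h * ennreal e \<partial>lborel)"
        using d(2) small by (intro nn_integral_mono) (auto simp: indicator_def)
      also have "\<dots> = emeasure lborel ?Q * ennreal e" by (simp add: nn_integral_multc)
      finally have "(\<integral>\<^sup>+x. avg_osc f k x \<partial>lborel) \<le> ?n * (emeasure lborel ?Q * ennreal e)"
        by (simp add: mult_left_mono)
      also have "\<dots> = ennreal e" by (simp only: mult.assoc[symmetric] emeasure_small_cube mult_1)
      finally show ?case .
    qed
  qed
  note ev = this
  have "eventually (\<lambda>k. (\<integral>\<^sup>+x. avg_osc f k x \<partial>lborel) < u) sequentially" if u: "0 < u" for u
  proof -
    obtain v where v: "0 < v" "v < u" using dense[OF u] by blast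
    then have "v < top" using less_le_trans top_greatest by blast
    with v have "0 < enn2real v" "ennreal (enn2real v) < u" by (auto simp: enn2real_positive_iff)
    then obtain e where "0 < e" "ennreal e < u" by blast
    with ev[of e] show ?thesis by (auto elim: eventually_mono)
  qed
  then show ?thesis by (intro order_tendstoI) auto
qed

section \<open>One-sided differentiability of Lipschitz functions on the line\<close>

text \<open>Adding a multiple of \<open>t\<close> turns \<open>h\<close> into an increasing
  bi-Lipschitz function \<open>F\<close>. The measure that assigns to a set the length of its image
  under \<open>F\<close> is absolutely continuous, and differentiation of integrals makes its
  density the derivative almost everywhere. Right derivatives come out because the averages are over
  intervals starting at the point.\<close>

lemma Lipschitz_right_differentiable_real:
  fixes h :: "real \<Rightarrow> real"
  assumes lip: "L-lipschitz_on UNIV h"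
  shows "AE t in lborel. \<exists>l. ((\<lambda>s. (h (t + s) - h t) / s) \<longlongrightarrow> l) (at_right 0)"
proof -
  \<comment> \<open>The slope of \<open>F\<close> is at least one, so its inverse is 1-Lipschitz and
    hence measurable.\<close>
  define F where "F t = h t + (L + 1) * t" for t
  have L0: "0 \<le> L" using lip lipschitz_on_nonneg by blast
  have hb: "\<bar>h x - h y\<bar> \<le> L * \<bar>x - y\<bar>" for x y
    using lipschitz_onD[OF lip, of x y] by (simp add: dist_real_def)
  have F1: "y - x \<le> F y - F x" if "x \<le> y" for x y
    using hb[of x y] that by (auto simp: F_def abs_if algebra_simps split: if_splits)
  have Fmono: "F x < F y" if "x < y" for x y using F1[of x y] that by auto
  have Finj: "inj F" by (metis Fmono injI linorder_neqE_linordered_idom order_less_irrefl)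
  have Flip: "(2 * L + 1)-lipschitz_on UNIV F"
  proof (rule lipschitz_onI)
    fix x y :: real
    have "\<bar>F x - F y\<bar> = \<bar>(h x - h y) + (L + 1) * (x - y)\<bar>" by (simp add: F_def algebra_simps)
    also have "\<dots> \<le> \<bar>h x - h y\<bar> + (L + 1) * \<bar>x - y\<bar>"
      using L0 by (intro order_trans[OF abs_triangle_ineq]) (simp add: abs_mult)
    also have "\<dots> \<le> L * \<bar>x - y\<bar> + (L + 1) * \<bar>x - y\<bar>" using hb[of x y] by simp
    finally show "dist (F x) (F y) \<le> (2 * L + 1) * dist x y" by (simp add: dist_real_def algebra_simps)
  qed (use L0 in simp)
  have Fcont: "continuous_on UNIV F" using Flip by (rule lipschitz_on_continuous_on)
  have Fsurj: "\<exists>x. F x = y" for y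
  proof -
    have "F 0 - \<bar>y - F 0\<bar> \<ge> F (- \<bar>y - F 0\<bar>)" using F1[of "- \<bar>y - F 0\<bar>" 0] by simp
    moreover have "F 0 + \<bar>y - F 0\<bar> \<le> F \<bar>y - F 0\<bar>" using F1[of 0 "\<bar>y - F 0\<bar>"] by simp
    ultimately have "F (- \<bar>y - F 0\<bar>) \<le> y" "y \<le> F \<bar>y - F 0\<bar>" by linarith+
    then show ?thesis
      using IVT'[of F "- \<bar>y - F 0\<bar>" y "\<bar>y - F 0\<bar>"] continuous_on_subset[OF Fcont] by auto
  qed
  define G where "G = inv F"
  have FG: "F (G y) = y" and GF: "G (F x) = x" for x y
    using Fsurj Finj by (auto simp: G_def f_inv_into_f image_iff) (metis f_inv_into_f rangeI)
  have "1-lipschitz_on UNIV G"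
  proof (rule lipschitz_onI)
    fix x y :: real
    show "dist (G x) (G y) \<le> 1 * dist x y"
      using F1[of "G x" "G y"] F1[of "G y" "G x"] FG by (auto simp: dist_real_def abs_if)
  qed simp
  then have Gm [measurable]: "G \<in> borel_measurable borel"
    by (intro borel_measurable_continuous_onI lipschitz_on_continuous_on)
  have img: "G -` A = F ` A" for A using FG GF by (metis (no_types) bij_betw_byWitness bij_def bij_image_Collect_eq bij_vimage_eq_inv_image inv_unique_comp o_def subset_UNIV G_def ext id_apply)
  \<comment> \<open>Pushing Lebesgue measure forward along the inverse of \<open>F\<close> gives the
    Stieltjes measure of \<open>F\<close>.\<close>
  define \<mu> where "\<mu> = distr lborel borel G"
  have "absolutely_continuous lborel \<mu>"
    unfolding absolutely_continuous_def
  proof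
    fix A :: "real set" assume A: "A \<in> null_sets lborel"
    then have "negligible A" by (simp add: negligible_iff_null_sets null_sets_completionI)
    then have "negligible (F ` A)"
      by (rule negligible_locally_Lipschitz_image[rotated])
        (use lipschitz_onD[OF Flip] in \<open>auto simp: dist_norm intro!: exI[of _ UNIV] exI[of _ "2 * L + 1"]\<close>)
    moreover have "F ` A \<in> sets borel" using A measurable_sets_borel[OF Gm, of A] by (simp add: img[symmetric] null_sets_def)
    ultimately have "emeasure lborel (F ` A) = 0"
      by (simp add: negligible_iff_emeasure0)
    then show "A \<in> null_sets \<mu>" using A
      by (auto simp: \<mu>_def null_sets_def emeasure_distr img)
  qed
  then obtain g where g [measurable]: "g \<in> borel_measurable borel" and dens: "density lborel g = \<mu>"
    using sigma_finite_measure.Radon_Nikodym[of lborel \<mu>] lborel.sigma_finite_measure_axioms by (auto simp: \<mu>_def)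
  have box: "(\<integral>\<^sup>+x. g x * indicator {a..b} x \<partial>lborel) = ennreal (F b - F a)" if "a \<le> b" for a b
  proof -
    have "F ` {a..b} = {F a..F b}"
    proof
      show "F ` {a..b} \<subseteq> {F a..F b}" using F1 by fastforce
      show "{F a..F b} \<subseteq> F ` {a..b}"
        using FG Fmono by (metis atLeastAtMost_iff image_eqI not_le subsetI)
    qed
    then have "emeasure \<mu> {a..b} = emeasure lborel {F a..F b}"
      by (simp add: \<mu>_def emeasure_distr img)
    also have "\<dots> = ennreal (F b - F a)" using F1[OF that] that by simp
    finally show ?thesis by (simp add: emeasure_density flip: dens)
  qed
  define g' where "g' x = enn2real (g x)" for x
  have [measurable]: "g' \<in> borel_measurable borel" unfolding g'_def by measurable
  \<comment> \<open>The density has finite integral over every bounded interval, so it is finite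
    almost everywhere and may be replaced by the real-valued \<open>g'\<close>.\<close>
  have "AE x in lborel. g x * indicator {- real n..real n} x \<noteq> \<infinity>" for n
    using box[of "- real n" "real n"] by (intro nn_integral_PInf_AE) auto
  then have "AE x in lborel. \<forall>n. g x * indicator {- real n..real n} x \<noteq> \<infinity>" by (simp add: AE_all_countable)
  then have fin: "AE x in lborel. g x \<noteq> \<infinity>"
  proof eventually_elim
    case (elim x)
    obtain n where "\<bar>x\<bar> \<le> real n" using real_arch_simple by blast
    then show ?case using elim[rule_format, of n] by (auto simp: indicator_def abs_le_iff split: if_splits)
  qed
  have int: "(g' has_integral (F b - F a)) {a..b}" if "a \<le> b" for a b
  proof -
    have "(\<integral>\<^sup>+x. ennreal (g' x * indicator {a..b} x) \<partial>lborel) = (\<integral>\<^sup>+x. g x * indicator {a..b} x \<partial>lborel)"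
      using fin by (intro nn_integral_cong_AE)
        (auto simp: g'_def indicator_def top.not_eq_extremum elim!: eventually_mono)
    then have "(\<integral>\<^sup>+x. ennreal (g' x * indicator {a..b} x) \<partial>lborel) = ennreal (F b - F a)"
      using box[OF that] by simp
    then have "((\<lambda>x. g' x * indicator {a..b} x) has_integral (F b - F a)) UNIV"
      using F1[OF that] that by (intro nn_integral_has_integral) (auto simp: g'_def)
    moreover have "(\<lambda>x. g' x * indicator {a..b} x) = (\<lambda>x. if x \<in> {a..b} then g' x else 0)"
      by (auto simp: indicator_def)
    ultimately show ?thesis using has_integral_restrict_UNIV by metis
  qed
  have "g' integrable_on cbox a b" for a b
    using int[of a b] by (cases "a \<le> b") (auto simp: integrable_on_def)
  then obtain N where N: "negligible N" "\<And>x e. \<lbrakk>x \<notin> N; 0 < e\<rbrakk> \<Longrightarrow>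
     \<exists>d>0. \<forall>s. 0 < s \<and> s < d \<longrightarrow> norm (integral (cbox x (x + s *\<^sub>R One)) g' /\<^sub>R s ^ DIM(real) - g' x) < e"
    using integrable_ccontinuous_explicit[of g'] by blast
  have lim: "((\<lambda>s. (h (t + s) - h t) / s) \<longlongrightarrow> g' t - (L + 1)) (at_right 0)" if tN: "t \<notin> N" for t
  proof (rule tendstoI)
    fix e :: real assume "e > 0"
    then obtain d where d: "d > 0" "\<And>s. 0 < s \<Longrightarrow> s < d \<Longrightarrow> \<bar>integral {t..t + s} g' / s - g' t\<bar> < e"
      using N(2)[OF tN \<open>e > 0\<close>] by (auto simp: divide_inverse_commute)
    have "dist ((h (t + s) - h t) / s) (g' t - (L + 1)) < e" if "0 < s" "s < d" for s
    proof -
      have "integral {t..t + s} g' = F (t + s) - F t" using int[of t "t + s"] that by auto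
      then show ?thesis using d(2)[OF that] that by (simp add: dist_real_def F_def field_simps)
    qed
    then show "eventually (\<lambda>s. dist ((h (t + s) - h t) / s) (g' t - (L + 1)) < e) (at_right 0)"
      using d(1) by (auto simp: eventually_at_right_field)
  qed
  have "AE t in lebesgue. t \<notin> N"
    using N(1) by (simp add: negligible_iff_null_sets AE_not_in)
  then have "AE t in lebesgue. \<exists>l. ((\<lambda>s. (h (t + s) - h t) / s) \<longlongrightarrow> l) (at_right 0)"
    using lim by (auto elim!: eventually_mono)
  then show ?thesis by (simp add: AE_completion_iff)
qed

section \<open>Explicit bump kernels\<close>

text \<open>Squaring the positive part makes the bump continuously differentiable with an explicit
  gradient, while its height and Lipschitz constant stay elementary powers of
  \<open>r\<close>.\<close>

definition bump :: "'a::euclidean_space \<Rightarrow> real \<Rightarrow> 'a \<Rightarrow> real" where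
  "bump c r y = (max 0 (r\<^sup>2 - (norm (y - c))\<^sup>2))\<^sup>2"

lemma max_0_square_has_real_derivative:
  "((\<lambda>s::real. (max 0 s)\<^sup>2) has_real_derivative 2 * max 0 s) (at s)"
proof -
  consider "s < 0" | "s = 0" | "0 < s" by linarith
  then show ?thesis
  proof cases
    case 1
    have "((\<lambda>s::real. 0) has_real_derivative 2 * max 0 s) (at s)" using 1 by simp
    then show ?thesis
      by (rule DERIV_cong_ev[THEN iffD1, rotated -1])
        (use eventually_nhds_in_open[of "{..<0}" s] 1 in \<open>auto elim!: eventually_mono\<close>)
  next
    case 3
    have "((\<lambda>s::real. s\<^sup>2) has_real_derivative 2 * max 0 s) (at s)"
      using 3 by (auto intro!: derivative_eq_intros)
    then show ?thesis
      by (rule DERIV_cong_ev[THEN iffD1, rotated -1])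
        (use eventually_nhds_in_open[of "{0<..}" s] 3 in \<open>auto elim!: eventually_mono\<close>)
  next
    case 2
    have "((\<lambda>h. (max 0 h)\<^sup>2 / h) \<longlongrightarrow> 0) (at (0::real))"
    proof (rule Lim_null_comparison)
      show "eventually (\<lambda>h. norm ((max 0 h)\<^sup>2 / h) \<le> \<bar>h\<bar>) (at (0::real))"
        by (rule eventuallyI) (auto simp: max_def power2_eq_square)
      show "((\<lambda>h. \<bar>h\<bar>) \<longlongrightarrow> 0) (at (0::real))" by (rule tendsto_rabs_zero) simp
    qed
    then show ?thesis using 2 by (simp add: DERIV_def)
  qed
qed

lemma bump_has_derivative:
  "(bump c r has_derivative (\<lambda>h. - 4 * max 0 (r\<^sup>2 - (norm (y - c))\<^sup>2) * ((y - c) \<bullet> h))) (at y)"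
proof -
  have "((\<lambda>y. r\<^sup>2 - (y - c) \<bullet> (y - c)) has_derivative (\<lambda>h. - 2 * ((y - c) \<bullet> h))) (at y)"
    by (auto intro!: derivative_eq_intros simp: inner_commute)
  from has_derivative_compose[OF this has_field_derivative_imp_has_derivative[OF max_0_square_has_real_derivative]]
  show ?thesis
    unfolding bump_def[abs_def] power2_norm_eq_inner
    by (rule has_derivative_eq_rhs) (simp add: fun_eq_iff)
qed

lemma bump_nonneg: "0 \<le> bump c r y"
  by (simp add: bump_def)

lemma bump_support: "0 < r \<Longrightarrow> bump c r y \<noteq> 0 \<Longrightarrow> norm (y - c) < r"
  by (auto simp: bump_def max_def power_less_imp_less_base split: if_splits)

lemma bump_le: "bump c r y \<le> r ^ 4"
proof -
  have "(max 0 (r\<^sup>2 - (norm (y - c))\<^sup>2))\<^sup>2 \<le> (r\<^sup>2)\<^sup>2" by (intro power_mono) auto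
  then show ?thesis by (simp add: bump_def)
qed

lemma bump_lipschitz:
  assumes "0 < r"
  shows "(4 * r ^ 3)-lipschitz_on UNIV (bump c r)"
proof (rule bounded_derivative_imp_lipschitz)
  show "(bump c r has_derivative (\<lambda>h. - 4 * max 0 (r\<^sup>2 - (norm (y - c))\<^sup>2) * ((y - c) \<bullet> h))) (at y within UNIV)" for y
    by (rule bump_has_derivative)
  show "onorm (\<lambda>h. - 4 * max 0 (r\<^sup>2 - (norm (y - c))\<^sup>2) * ((y - c) \<bullet> h)) \<le> 4 * r ^ 3" for y
  proof (rule onorm_le)
    fix h
    show "norm (- 4 * max 0 (r\<^sup>2 - (norm (y - c))\<^sup>2) * ((y - c) \<bullet> h)) \<le> 4 * r ^ 3 * norm h"
    proof (cases "norm (y - c) < r")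
      case True
      have "norm (- 4 * max 0 (r\<^sup>2 - (norm (y - c))\<^sup>2) * ((y - c) \<bullet> h)) =
          4 * max 0 (r\<^sup>2 - (norm (y - c))\<^sup>2) * \<bar>(y - c) \<bullet> h\<bar>" by (simp add: abs_mult)
      also have "\<dots> \<le> 4 * r\<^sup>2 * (norm (y - c) * norm h)"
        by (intro mult_mono Cauchy_Schwarz_ineq2) auto
      also have "\<dots> \<le> 4 * r\<^sup>2 * (r * norm h)" using True by (intro mult_left_mono mult_right_mono) auto
      finally show ?thesis by (simp add: power2_eq_square power3_eq_cube)
    next
      case False
      then have "r\<^sup>2 \<le> (norm (y - c))\<^sup>2" using assms by (intro power_mono) auto
      then show ?thesis using assms by simp
    qed
  qed
qed (use assms in auto)

text \<open>A mollifier supported in the positive orthant, so that averages are taken over cubes with \<open>x\<close> as a corner.\<close>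

definition moll_bump :: "nat \<Rightarrow> 'a::euclidean_space \<Rightarrow> real" where
  "moll_bump k = bump (One /\<^sub>R (2 * real (Suc k))) (1 / (2 * real (Suc k)))"

definition moll :: "nat \<Rightarrow> 'a::euclidean_space \<Rightarrow> real" where
  "moll k y = moll_bump k y / (LINT y|lborel. moll_bump k (y::'a))"

lemma moll_bump_support:
  fixes y :: "'a::euclidean_space"
  assumes "moll_bump k y \<noteq> 0"
  shows "y \<in> cbox 0 (One /\<^sub>R real (Suc k))"
proof -
  let ?m = "real (Suc k)"
  have n: "norm (y - One /\<^sub>R (2 * ?m)) < 1 / (2 * ?m)"
    using assms unfolding moll_bump_def by (intro bump_support) auto
  have "0 \<le> y \<bullet> i \<and> y \<bullet> i \<le> 1 / ?m" if "i \<in> Basis" for i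
  proof -
    have "\<bar>y \<bullet> i - 1 / (2 * ?m)\<bar> = \<bar>(y - One /\<^sub>R (2 * ?m)) \<bullet> i\<bar>"
      using that by (simp add: inner_diff_left inverse_eq_divide)
    also have "\<dots> \<le> norm (y - One /\<^sub>R (2 * ?m))" by (rule Basis_le_norm[OF that])
    also have "\<dots> < 1 / (2 * ?m)" by (rule n)
    finally have "0 \<le> y \<bullet> i" "y \<bullet> i \<le> 1 / (2 * ?m) + 1 / (2 * ?m)" by linarith+
    moreover have "1 / (2 * ?m) + 1 / (2 * ?m) = 1 / ?m" by (simp add: field_simps)
    ultimately show ?thesis by simp
  qed
  then show ?thesis by (auto simp: mem_box inverse_eq_divide)
qed

lemma moll_bump_continuous: "continuous_on S (moll_bump k :: 'a::euclidean_space \<Rightarrow> real)"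
  unfolding moll_bump_def
  by (intro lipschitz_on_continuous_on[OF lipschitz_on_subset[OF bump_lipschitz]]) auto

lemma moll_bump_measurable [measurable]: "moll_bump k \<in> borel_measurable borel"
  by (intro borel_measurable_continuous_onI moll_bump_continuous)

lemma moll_bump_integrable: "integrable lborel (moll_bump k :: 'a::euclidean_space \<Rightarrow> real)"
proof -
  have "integrable lborel (\<lambda>x::'a. indicator (cbox 0 (One /\<^sub>R real (Suc k))) x *\<^sub>R moll_bump k x)"
    by (intro borel_integrable_compact moll_bump_continuous) simp
  moreover have "(\<lambda>x::'a. indicator (cbox 0 (One /\<^sub>R real (Suc k))) x *\<^sub>R moll_bump k x) = moll_bump k"
    using moll_bump_support by (force simp: indicator_def)
  ultimately show ?thesis by metis
qed

text \<open>On a cube of half-side \<open>1 / (4 * DIM('a) * m)\<close> around the centre, the sum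
  norm bounds the distance to the centre by \<open>1 / (4 * m)\<close>, so the bump is at least the
  square of \<open>(1 / 4 - 1 / 16) / m\<^sup>2\<close>. The bound controls the normalising factor
  of \<open>moll\<close> with the correct power of \<open>m\<close>.\<close>

lemma moll_bump_integral_ge:
  fixes k :: nat
  defines "m \<equiv> real (Suc k)"
  shows "(3 / 16)\<^sup>2 / m ^ 4 * (1 / (2 * real DIM('a) * m)) ^ DIM('a) \<le> (LINT y|lborel. moll_bump k (y::'a::euclidean_space))"
proof -
  have m: "0 < m" by (simp add: m_def)
  let ?D = "real DIM('a)"
  let ?c = "One /\<^sub>R (2 * m) :: 'a" and ?d = "One /\<^sub>R (4 * ?D * m) :: 'a"
  let ?Q = "cbox (?c - ?d) (?c + ?d)"
  have D: "0 < ?D" by simp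
  have low: "(3 / 16)\<^sup>2 / m ^ 4 * indicator ?Q y \<le> moll_bump k y" for y
  proof (cases "y \<in> ?Q")
    case True
    have "norm (y - ?c) \<le> (\<Sum>i\<in>Basis. \<bar>(y - ?c) \<bullet> i\<bar>)" by (rule norm_le_l1)
    also have "\<dots> \<le> (\<Sum>i\<in>(Basis::'a set). 1 / (4 * ?D * m))"
      using True by (intro sum_mono) (auto simp: mem_box inner_diff_left inner_add_left inverse_eq_divide abs_le_iff)
    also have "\<dots> = 1 / (4 * m)" using D by simp
    finally have "(norm (y - ?c))\<^sup>2 \<le> (1 / (4 * m))\<^sup>2" by (intro power_mono) auto
    then have "3 / 16 / m\<^sup>2 \<le> (1 / (2 * m))\<^sup>2 - (norm (y - ?c))\<^sup>2"
      using m by (simp add: power_divide power_mult_distrib field_simps)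
    then have "(3 / 16 / m\<^sup>2)\<^sup>2 \<le> moll_bump k y"
      unfolding moll_bump_def bump_def m_def[symmetric] by (intro power_mono) auto
    then show ?thesis using True by (simp add: power_divide)
  qed (simp add: moll_bump_def bump_nonneg)
  have "measure lborel ?Q = (\<Prod>i\<in>(Basis::'a set). 1 / (2 * ?D * m))"
    using m by (subst measure_lborel_cbox)
      (auto simp: inner_diff_left inner_add_left inverse_eq_divide mult_ac intro!: prod.cong)
  then have "(3 / 16)\<^sup>2 / m ^ 4 * (1 / (2 * ?D * m)) ^ DIM('a) = (LINT y|lborel. (3 / 16)\<^sup>2 / m ^ 4 * indicator ?Q (y::'a))"
    by simp
  also have "\<dots> \<le> (LINT y|lborel. moll_bump k (y::'a))"
  proof (intro integral_mono moll_bump_integrable integrable_mult_right integrable_real_indicator low)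
    show "emeasure lborel ?Q < \<infinity>" by (rule emeasure_bounded_finite[OF bounded_cbox])
  qed simp
  finally show ?thesis .
qed

lemma moll_bump_nonneg: "0 \<le> moll_bump k y"
  by (simp add: moll_bump_def bump_nonneg)

lemma moll_bump_integral_pos: "0 < (LINT y|lborel. moll_bump k (y::'a::euclidean_space))"
  by (rule less_le_trans[OF _ moll_bump_integral_ge]) simp

lemma moll_nonneg: "0 \<le> moll k (y::'a::euclidean_space)"
  using moll_bump_integral_pos[where 'a = 'a, of k]
  by (simp add: moll_def moll_bump_nonneg)

lemma moll_support: "moll k (y::'a::euclidean_space) \<noteq> 0 \<Longrightarrow> y \<in> cbox 0 (One /\<^sub>R real (Suc k))"
  using moll_bump_support[of k y] by (auto simp: moll_def)

lemma moll_measurable [measurable]: "moll k \<in> borel_measurable borel"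
  unfolding moll_def[abs_def] by measurable

lemma moll_integrable: "integrable lborel (moll k :: 'a::euclidean_space \<Rightarrow> real)"
  unfolding moll_def[abs_def] by (intro integrable_divide moll_bump_integrable)

lemma moll_integral: "(LINT y|lborel. moll k (y::'a::euclidean_space)) = 1"
  using moll_bump_integral_pos[where 'a = 'a, of k] unfolding moll_def
  by (subst integral_divide_zero) (metis div_self less_irrefl)

lemma moll_differentiable: "moll k differentiable at (y::'a::euclidean_space)"
proof -
  have "moll_bump k differentiable at y"
    unfolding moll_bump_def differentiable_def using bump_has_derivative by blast
  then show ?thesis
    unfolding moll_def[abs_def] divide_inverse by (intro differentiable_mult) auto
qed

text \<open>The reciprocal of the lower bound in \<open>moll_bump_integral_ge\<close> with its power
  of \<open>k + 1\<close> removed, hence a constant of the dimension alone.\<close>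

definition moll_const :: "'a::euclidean_space itself \<Rightarrow> real" where
  "moll_const _ = (16 / 3)\<^sup>2 * (2 * real DIM('a)) ^ DIM('a)"

lemma moll_const_pos: "0 < moll_const TYPE('a::euclidean_space)"
  by (simp add: moll_const_def)

lemma inverse_moll_bump_integral_le:
  "1 / (LINT y|lborel. moll_bump k (y::'a::euclidean_space)) \<le> moll_const TYPE('a) * real (Suc k) ^ (DIM('a) + 4)"
proof -
  let ?l = "(3 / 16)\<^sup>2 / real (Suc k) ^ 4 * (1 / (2 * real DIM('a) * real (Suc k))) ^ DIM('a)"
  have eq: "1 / ((3 / 16)\<^sup>2 / m ^ 4 * (1 / (2 * d * m)) ^ n) = (16 / 3)\<^sup>2 * (2 * d) ^ n * m ^ (n + 4)"
    if "0 < m" "0 < d" for m d :: real and n :: nat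
    using that by (simp add: power_divide power_mult_distrib power_add field_simps)
  have "0 < ?l" by simp
  then have "1 / (LINT y|lborel. moll_bump k (y::'a)) \<le> 1 / ?l"
    by (intro divide_left_mono moll_bump_integral_ge mult_pos_pos moll_bump_integral_pos) auto
  also have "1 / ?l = moll_const TYPE('a) * real (Suc k) ^ (DIM('a) + 4)"
    unfolding moll_const_def by (rule eq) auto
  finally show ?thesis .
qed

text \<open>The height \<open>r ^ 4\<close> of the bump with \<open>r = 1 / (2 * (k + 1))\<close>
  cancels four powers in the normalising factor, which leaves the reciprocal volume of the
  supporting cube up to a constant.\<close>

lemma moll_le: "moll k (y::'a::euclidean_space) \<le> moll_const TYPE('a) * real (Suc k) ^ DIM('a)"
proof -
  have "moll k y \<le> (1 / (2 * real (Suc k))) ^ 4 * (1 / (LINT y|lborel. moll_bump k (y::'a)))"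
    unfolding moll_def moll_bump_def[of k] divide_inverse mult_1
    using moll_bump_integral_pos[where 'a = 'a, of k] bump_le[of _ "inverse (2 * real (Suc k))"]
    by (intro mult_right_mono) (auto simp: moll_bump_def divide_inverse)
  also have "\<dots> \<le> (1 / real (Suc k)) ^ 4 * (moll_const TYPE('a) * real (Suc k) ^ (DIM('a) + 4))"
    using moll_bump_integral_pos[where 'a = 'a, of k]
    by (intro mult_mono inverse_moll_bump_integral_le power_mono) (auto simp: field_simps)
  also have "\<dots> = moll_const TYPE('a) * real (Suc k) ^ DIM('a)"
    by (simp add: power_add field_simps)
  finally show ?thesis .
qed

lemma moll_lipschitz:
  "(moll_const TYPE('a) * real (Suc k) ^ (DIM('a) + 1))-lipschitz_on UNIV (moll k :: 'a::euclidean_space \<Rightarrow> real)"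
proof (rule lipschitz_onI)
  fix x y :: 'a
  let ?I = "LINT y|lborel. moll_bump k (y::'a)"
  let ?m = "real (Suc k)"
  have eq: "(4 * (1 / (2 * m)) ^ 3 * d) * (c * m ^ (n + 4)) = (1 / 2) * (c * m ^ (n + 1) * d)"
    if "0 < m" for m c d :: real and n :: nat
    using that by (simp add: power_add power_divide power_mult_distrib field_simps power3_eq_cube power4_eq_xxxx)
  have "dist (moll k x) (moll k y) = dist (moll_bump k x) (moll_bump k y) * (1 / ?I)"
    using moll_bump_integral_pos[where 'a = 'a, of k]
    by (simp add: moll_def dist_real_def diff_divide_distrib[symmetric] abs_divide)
  also have "\<dots> \<le> (4 * (1 / (2 * ?m)) ^ 3 * dist x y) * (moll_const TYPE('a) * ?m ^ (DIM('a) + 4))"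
    unfolding moll_bump_def[of k]
    using moll_bump_integral_pos[where 'a = 'a, of k]
    by (intro mult_mono lipschitz_onD[OF bump_lipschitz] inverse_moll_bump_integral_le[unfolded moll_bump_def])
      (auto simp: moll_bump_def)
  also have "\<dots> = (1 / 2) * (moll_const TYPE('a) * ?m ^ (DIM('a) + 1) * dist x y)"
    by (rule eq) simp
  also have "\<dots> \<le> moll_const TYPE('a) * ?m ^ (DIM('a) + 1) * dist x y"
    using moll_const_pos[where 'a = 'a] by simp
  finally show "dist (moll k x) (moll k y) \<le> moll_const TYPE('a) * ?m ^ (DIM('a) + 1) * dist x y" .
qed (use moll_const_pos[where 'a = 'a] in simp)

lemma integral_translation:
  fixes f :: "'a::euclidean_space \<Rightarrow> real"
  assumes [measurable]: "f \<in> borel_measurable borel"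
  shows "(LINT x|lborel. f (x + h)) = (LINT x|lborel. f x)"
    and "integrable lborel (\<lambda>x. f (x + h)) \<longleftrightarrow> integrable lborel f"
proof -
  have "(LINT x|lborel. f x) = (LINT x|distr lborel borel ((+) h). f x)"
    by (simp add: lborel_distr_plus)
  also have "\<dots> = (LINT x|lborel. f (x + h))"
    by (subst integral_distr) (auto simp: add.commute)
  finally show "(LINT x|lborel. f (x + h)) = (LINT x|lborel. f x)" ..
  have "integrable lborel f \<longleftrightarrow> integrable (distr lborel borel ((+) h)) f"
    by (simp add: lborel_distr_plus)
  also have "\<dots> \<longleftrightarrow> integrable lborel (\<lambda>x. f (x + h))"
    by (subst integrable_distr_eq) (auto simp: add.commute)
  finally show "integrable lborel (\<lambda>x. f (x + h)) \<longleftrightarrow> integrable lborel f" ..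
qed

lemma integrable_moll_mult:
  fixes f :: "'a::euclidean_space \<Rightarrow> real"
  assumes f: "integrable lborel f"
  shows "integrable lborel (\<lambda>y. moll k (y - x) * f y)"
proof (rule Bochner_Integration.integrable_bound[OF integrable_mult_right[OF f]])
  have [measurable]: "f \<in> borel_measurable borel" using f by (auto dest: borel_measurable_integrable)
  show "(\<lambda>y. moll k (y - x) * f y) \<in> borel_measurable lborel" by measurable
  show "AE y in lborel. norm (moll k (y - x) * f y) \<le> norm (moll_const TYPE('a) * real (Suc k) ^ DIM('a) * f y)"
  proof (rule AE_I2)
    fix y
    have "\<bar>moll k (y - x)\<bar> \<le> \<bar>moll_const TYPE('a) * real (Suc k) ^ DIM('a)\<bar>"
      using moll_le[of k "y - x"] moll_nonneg[of k "y - x"] by linarith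
    then show "norm (moll k (y - x) * f y) \<le> norm (moll_const TYPE('a) * real (Suc k) ^ DIM('a) * f y)"
      unfolding real_norm_def abs_mult[of _ "f y"] by (rule mult_right_mono) simp
  qed
qed

text \<open>A kernel on a cube bounded by \<open>C\<close> times the reciprocal volume costs
  \<open>C\<close> times the mean oscillation. \<open>K\<close> may change sign and have any mass,
  which lets one estimate serve both the mollifier and the divergence of the commutator
  field.\<close>

lemma kernel_avg_osc:
  fixes f :: "'a::euclidean_space \<Rightarrow> real"
  assumes f: "integrable lborel f" and K: "K \<in> borel_measurable borel"
    and supp: "\<And>y. K y \<noteq> 0 \<Longrightarrow> y \<in> cbox x (x + One /\<^sub>R real (Suc k))"
    and bound: "\<And>y. \<bar>K y\<bar> \<le> C * real (Suc k) ^ DIM('a)" and C: "0 \<le> C"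
  shows "ennreal \<bar>LINT y|lborel. K y * (f y - f x)\<bar> \<le> ennreal C * avg_osc f k x"
proof -
  note [measurable] = K
  have [measurable]: "f \<in> borel_measurable borel" using f by (auto dest: borel_measurable_integrable)
  let ?n = "real (Suc k) ^ DIM('a)" and ?Q = "cbox 0 (One /\<^sub>R real (Suc k)) :: 'a set"
  \<comment> \<open>If the integrand is not integrable, the Bochner integral is \<open>0\<close> and
    the bound is trivial.\<close>
  have "ennreal \<bar>LINT y|lborel. K y * (f y - f x)\<bar> \<le> (\<integral>\<^sup>+y. ennreal \<bar>K y * (f y - f x)\<bar> \<partial>lborel)"
    using integral_norm_bound_ennreal[of lborel "\<lambda>y. K y * (f y - f x)"]
    by (cases "integrable lborel (\<lambda>y. K y * (f y - f x))") (auto simp: not_integrable_integral_eq)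
  also have "\<dots> = (\<integral>\<^sup>+h. ennreal \<bar>K (h + x) * (f (h + x) - f x)\<bar> \<partial>lborel)"
    by (rule nn_integral_translation[symmetric]) measurable
  also have "\<dots> \<le> (\<integral>\<^sup>+h. ennreal (C * ?n) * (indicator ?Q h * ennreal \<bar>f (x + h) - f x\<bar>) \<partial>lborel)"
  proof (intro nn_integral_mono)
    fix h :: 'a
    show "ennreal \<bar>K (h + x) * (f (h + x) - f x)\<bar> \<le> ennreal (C * ?n) * (indicator ?Q h * ennreal \<bar>f (x + h) - f x\<bar>)"
    proof (cases "K (h + x) = 0")
      case False
      then have "h \<in> ?Q" using supp[OF False] by (auto simp: mem_box inner_add_left)
      moreover have "ennreal \<bar>K (h + x) * (f (h + x) - f x)\<bar> \<le> ennreal (C * ?n * \<bar>f (x + h) - f x\<bar>)"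
        using bound[of "h + x"] by (intro ennreal_leI) (auto simp: abs_mult add.commute intro!: mult_right_mono)
      ultimately show ?thesis using C by (simp add: ennreal_mult)
    qed simp
  qed
  also have "\<dots> = ennreal C * avg_osc f k x"
    unfolding avg_osc_def using C by (subst nn_integral_cmult) (auto simp: ennreal_mult mult.assoc)
  finally show ?thesis .
qed

lemma moll_shift_support:
  fixes x y :: "'a::euclidean_space"
  assumes "moll k (y - x) \<noteq> 0"
  shows "y \<in> cbox x (x + One /\<^sub>R real (Suc k))"
  using moll_support[OF assms] by (auto simp: mem_box inner_diff_left inner_add_left algebra_simps)

lemma moll_average:
  fixes f :: "'a::euclidean_space \<Rightarrow> real"
  assumes f: "integrable lborel f"
  shows "ennreal \<bar>(LINT y|lborel. moll k (y - x) * f y) - f x\<bar> \<le> ennreal (moll_const TYPE('a)) * avg_osc f k x"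
proof -
  have i: "integrable lborel (\<lambda>y. moll k (y - x))" "(LINT y|lborel. moll k (y - x)) = 1"
    using integral_translation[of "moll k" "- x"] moll_integrable moll_integral by auto
  have "(LINT y|lborel. moll k (y - x) * f y) - f x = (LINT y|lborel. moll k (y - x) * f y) - (LINT y|lborel. moll k (y - x) * f x)"
    using i by simp
  also have "\<dots> = (LINT y|lborel. moll k (y - x) * (f y - f x))"
    using i integrable_moll_mult[OF f] by (subst Bochner_Integration.integral_diff[symmetric]) (auto simp: algebra_simps)
  finally have *: "(LINT y|lborel. moll k (y - x) * f y) - f x = (LINT y|lborel. moll k (y - x) * (f y - f x))" .
  show ?thesis unfolding *
  proof (intro kernel_avg_osc f)
    show "\<bar>moll k (y - x)\<bar> \<le> moll_const TYPE('a) * real (Suc k) ^ DIM('a)" for y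
      using moll_le[of k "y - x"] moll_nonneg[of k "y - x"] by simp
    show "0 \<le> moll_const TYPE('a)" using moll_const_pos[where 'a = 'a] by simp
  qed (use moll_shift_support in auto)
qed

text \<open>Where all averages vanish, \<open>\<bar>f x\<bar>\<close> is itself an averaging error,
  and these errors tend to zero in L1.\<close>

lemma fundamental_lemma_moll:
  fixes f :: "'a::euclidean_space \<Rightarrow> real"
  assumes f: "integrable lborel f" and S: "S \<in> sets borel"
    and z: "\<And>k x. k \<ge> k0 \<Longrightarrow> x \<in> S \<Longrightarrow> (LINT y|lborel. moll k (y - x) * f y) = 0"
  shows "AE x in lborel. x \<in> S \<longrightarrow> f x = 0"
proof -
  have [measurable]: "f \<in> borel_measurable borel" using f by (auto dest: borel_measurable_integrable)
  note [measurable] = S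
  let ?c = "ennreal (moll_const TYPE('a))"
  have "(\<integral>\<^sup>+x. indicator S x * ennreal \<bar>f x\<bar> \<partial>lborel) \<le> ?c * (\<integral>\<^sup>+x. avg_osc f k x \<partial>lborel)" if "k \<ge> k0" for k
  proof -
    have "(\<integral>\<^sup>+x. indicator S x * ennreal \<bar>f x\<bar> \<partial>lborel) \<le> (\<integral>\<^sup>+x. ?c * avg_osc f k x \<partial>lborel)"
    proof (intro nn_integral_mono)
      fix x
      show "indicator S x * ennreal \<bar>f x\<bar> \<le> ?c * avg_osc f k x"
        using moll_average[OF f, of k x] z[OF that, of x] by (cases "x \<in> S") auto
    qed
    then show ?thesis by (simp add: nn_integral_cmult)
  qed
  moreover have "(\<lambda>k. ?c * (\<integral>\<^sup>+x. avg_osc f k x \<partial>lborel)) \<longlonglongrightarrow> ?c * 0"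
    by (intro ennreal_tendsto_cmult avg_osc_tendsto_0 f) simp
  ultimately have "(\<integral>\<^sup>+x. indicator S x * ennreal \<bar>f x\<bar> \<partial>lborel) \<le> ?c * 0"
    by (intro LIMSEQ_le_const) auto
  then have "AE x in lborel. indicator S x * ennreal \<bar>f x\<bar> = 0"
    by (subst nn_integral_0_iff_AE[symmetric]) auto
  then show ?thesis by eventually_elim (auto simp: indicator_def)
qed

subsection \<open>Rademacher's theorem\<close>

lemma has_derivative_directional:
  fixes f :: "'a::real_normed_vector \<Rightarrow> real"
  assumes "(f has_derivative D) (at x)"
  shows "((\<lambda>t. (f (x + t *\<^sub>R e) - f x) / t) \<longlongrightarrow> D e) (at 0)"
proof -
  have "((\<lambda>t. f (x + t *\<^sub>R e)) has_derivative (\<lambda>t. D (t *\<^sub>R e))) (at 0)"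
    using assms by (intro has_derivative_compose[of "\<lambda>t. x + t *\<^sub>R e" "\<lambda>t. t *\<^sub>R e" _ _ f])
      (auto intro!: derivative_eq_intros)
  moreover have "(\<lambda>t. D (t *\<^sub>R e)) = (*) (D e)"
    using has_derivative_linear[OF assms] by (auto simp: linear_cmul)
  ultimately have "((\<lambda>t. f (x + t *\<^sub>R e)) has_real_derivative D e) (at 0)"
    by (simp add: has_field_derivative_def)
  then show ?thesis by (simp add: DERIV_def)
qed

lemma tendsto_at_right_seq:
  assumes "(g \<longlongrightarrow> l) (at_right (0::real))"
  shows "(\<lambda>n. g (inverse (real (Suc n)))) \<longlonglongrightarrow> l"
proof (rule filterlim_compose[OF assms])
  show "filterlim (\<lambda>n. inverse (real (Suc n))) (at_right 0) sequentially"
    using LIMSEQ_inverse_real_of_nat by (auto simp: filterlim_at intro!: always_eventually)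
qed

lemma has_derivative_directional_seq:
  fixes f :: "'a::real_normed_vector \<Rightarrow> real"
  assumes "(f has_derivative D) (at x)"
  shows "(\<lambda>n. (f (x + e /\<^sub>R real (Suc n)) - f x) * real (Suc n)) \<longlonglongrightarrow> D e"
proof -
  have "((\<lambda>t. (f (x + t *\<^sub>R e) - f x) / t) \<longlongrightarrow> D e) (at_right 0)"
    using has_derivative_directional[OF assms] by (rule tendsto_mono[rotated]) (simp add: at_within_le_at)
  from tendsto_at_right_seq[OF this] show ?thesis by (simp add: divide_inverse)
qed

text \<open>Countable quantifiers over \<open>k\<close> and \<open>j\<close> exhibit the set of
  points with a one-sided derivative as a Borel set. The radii remain uncountably quantified, but
  for continuous functions each of their conditions is closed.\<close>

lemma at_right_limit_iff_Cauchy: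
  fixes g :: "real \<Rightarrow> real"
  shows "(\<exists>l. (g \<longlongrightarrow> l) (at_right 0)) \<longleftrightarrow>
    (\<forall>k::nat. \<exists>j::nat. \<forall>r s. 0 < r \<longrightarrow> r < inverse (real (Suc j)) \<longrightarrow> 0 < s \<longrightarrow> s < inverse (real (Suc j)) \<longrightarrow>
      \<bar>g r - g s\<bar> \<le> inverse (real (Suc k)))" (is "?L \<longleftrightarrow> ?R")
proof
  assume ?L
  then obtain l where l: "(g \<longlongrightarrow> l) (at_right 0)" ..
  show ?R
  proof
    fix k :: nat
    have "inverse (real (Suc k)) / 2 > 0" by simp
    from tendstoD[OF l this] obtain d where d: "d > 0"
      "\<And>r. 0 < r \<Longrightarrow> r < d \<Longrightarrow> dist (g r) l < inverse (real (Suc k)) / 2"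
      by (auto simp: eventually_at_right_field)
    obtain j where j: "inverse (real (Suc j)) < d" using reals_Archimedean[OF d(1)] by blast
    show "\<exists>j::nat. \<forall>r s. 0 < r \<longrightarrow> r < inverse (real (Suc j)) \<longrightarrow> 0 < s \<longrightarrow> s < inverse (real (Suc j)) \<longrightarrow>
      \<bar>g r - g s\<bar> \<le> inverse (real (Suc k))"
    proof (intro exI[of _ j] allI impI)
      fix r s assume "0 < r" "r < inverse (real (Suc j))" "0 < s" "s < inverse (real (Suc j))"
      then have "dist (g r) l < inverse (real (Suc k)) / 2" "dist (g s) l < inverse (real (Suc k)) / 2"
        using d(2) j by auto
      then show "\<bar>g r - g s\<bar> \<le> inverse (real (Suc k))" unfolding dist_real_def by linarith
    qed
  qed
next
  assume R: ?R
  define a where "a n = g (inverse (real (Suc n)))" for n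
  have "Cauchy a"
  proof (rule metric_CauchyI)
    fix e :: real assume "e > 0"
    then obtain k where k: "inverse (real (Suc k)) < e" using reals_Archimedean by blast
    from R obtain j where j: "\<And>r s. 0 < r \<Longrightarrow> r < inverse (real (Suc j)) \<Longrightarrow> 0 < s \<Longrightarrow> s < inverse (real (Suc j)) \<Longrightarrow>
      \<bar>g r - g s\<bar> \<le> inverse (real (Suc k))" by meson
    have "dist (a m) (a n) < e" if "m > j" "n > j" for m n
      using j[of "inverse (real (Suc m))" "inverse (real (Suc n))"] that k by (auto simp: a_def dist_real_def)
    then show "\<exists>M. \<forall>m\<ge>M. \<forall>n\<ge>M. dist (a m) (a n) < e"
      by (intro exI[of _ "Suc j"]) auto
  qed
  then obtain l where l: "a \<longlonglongrightarrow> l" by (auto simp: Cauchy_convergent_iff convergent_def)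
  have "(g \<longlongrightarrow> l) (at_right 0)"
  proof (rule tendstoI)
    fix e :: real assume "e > 0"
    then obtain k where k: "inverse (real (Suc k)) < e" using reals_Archimedean by blast
    from R obtain j where j: "\<And>r s. 0 < r \<Longrightarrow> r < inverse (real (Suc j)) \<Longrightarrow> 0 < s \<Longrightarrow> s < inverse (real (Suc j)) \<Longrightarrow>
      \<bar>g r - g s\<bar> \<le> inverse (real (Suc k))" by meson
    have "dist (g r) l < e" if "0 < r" "r < inverse (real (Suc j))" for r
    proof -
      have "(\<lambda>n. \<bar>g r - a n\<bar>) \<longlonglongrightarrow> \<bar>g r - l\<bar>" by (intro tendsto_intros l)
      moreover have "\<bar>g r - a n\<bar> \<le> inverse (real (Suc k))" if "n \<ge> Suc j" for n
        using j[OF \<open>0 < r\<close> \<open>r < inverse (real (Suc j))\<close>, of "inverse (real (Suc n))"] that by (simp add: a_def)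
      ultimately have "\<bar>g r - l\<bar> \<le> inverse (real (Suc k))" by (intro LIMSEQ_le_const2) auto
      then show ?thesis using k by (simp add: dist_real_def)
    qed
    then show "eventually (\<lambda>r. dist (g r) l < e) (at_right 0)"
      unfolding eventually_at_right_field by (intro exI[of _ "inverse (real (Suc j))"]) auto
  qed
  then show ?L ..
qed

text \<open>A limit along the sequence \<open>1 / (n + 1)\<close> is Borel measurable in
  \<open>x\<close> for continuous \<open>f\<close> whether or not it exists; where it does not, the
  value is whatever \<open>lim\<close> yields.\<close>

definition dirD :: "('a::euclidean_space \<Rightarrow> real) \<Rightarrow> 'a \<Rightarrow> 'a \<Rightarrow> real" where
  "dirD f e x = lim (\<lambda>n. (f (x + e /\<^sub>R real (Suc n)) - f x) * real (Suc n))"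

lemma dirD_measurable:
  assumes "continuous_on UNIV f"
  shows "dirD f e \<in> borel_measurable borel"
proof -
  have [measurable]: "f \<in> borel_measurable borel" using assms by (rule borel_measurable_continuous_onI)
  show ?thesis unfolding dirD_def[abs_def] by measurable
qed

text \<open>On each line in direction \<open>e\<close> the right limit exists at almost every
  parameter, so the exceptional set, once known to be Borel, is null.\<close>

lemma Lipschitz_directional_AE:
  fixes f :: "'a::euclidean_space \<Rightarrow> real"
  assumes lip: "L-lipschitz_on UNIV f"
  shows "AE x in lborel. ((\<lambda>t. (f (x + t *\<^sub>R e) - f x) / t) \<longlongrightarrow> dirD f e x) (at_right 0)"
proof -
  define q where "q r x = (f (x + r *\<^sub>R e) - f x) / r" for r x
  have cont: "continuous_on UNIV f" using lip by (rule lipschitz_on_continuous_on)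
  have qc: "continuous_on UNIV (q r)" for r
  proof -
    have "continuous_on UNIV (\<lambda>x. f (x + r *\<^sub>R e))"
      by (rule continuous_on_compose2[OF cont]) (auto intro!: continuous_intros)
    then show ?thesis unfolding q_def using cont by (cases "r = 0") (auto intro!: continuous_intros)
  qed
  \<comment> \<open>For fixed \<open>r\<close> and \<open>s\<close> the condition is closed in
    \<open>x\<close>, hence so is the intersection over all of them; there is no need to pass to
    rational radii.\<close>
  define C where "C k j = {x. \<forall>r s. 0 < r \<longrightarrow> r < inverse (real (Suc j)) \<longrightarrow> 0 < s \<longrightarrow> s < inverse (real (Suc j)) \<longrightarrow>
      \<bar>q r x - q s x\<bar> \<le> inverse (real (Suc k))}" for k j :: nat
  have "closed (C k j)" for k j
  proof -
    have "C k j = (\<Inter>r\<in>{0<..<inverse (real (Suc j))}. \<Inter>s\<in>{0<..<inverse (real (Suc j))}. {x. \<bar>q r x - q s x\<bar> \<le> inverse (real (Suc k))})"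
      by (auto simp: C_def)
    also have "closed \<dots>"
      by (intro closed_INT ballI closed_Collect_le continuous_intros qc)
    finally show ?thesis .
  qed
  then have Cm: "C k j \<in> sets borel" for k j by simp
  define E where "E = {x. \<exists>l. ((\<lambda>r. q r x) \<longlongrightarrow> l) (at_right 0)}"
  have "E = (\<Inter>k. \<Union>j. C k j)"
    unfolding E_def at_right_limit_iff_Cauchy C_def by blast
  then have Em [measurable]: "E \<in> sets borel" using Cm by auto
  have line: "AE t in lborel. x + t *\<^sub>R e \<in> E" for x
  proof -
    have "(L * norm e)-lipschitz_on UNIV (\<lambda>t. f (x + t *\<^sub>R e))"
    proof (rule lipschitz_onI)
      fix s t :: real
      have "dist (f (x + s *\<^sub>R e)) (f (x + t *\<^sub>R e)) \<le> L * dist (x + s *\<^sub>R e) (x + t *\<^sub>R e)"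
        using lipschitz_onD[OF lip] by blast
      also have "dist (x + s *\<^sub>R e) (x + t *\<^sub>R e) = norm e * dist s t"
        by (simp add: dist_norm flip: scaleR_diff_left)
      finally show "dist (f (x + s *\<^sub>R e)) (f (x + t *\<^sub>R e)) \<le> L * norm e * dist s t"
        by (simp only: mult.assoc)
    qed (use lipschitz_on_nonneg[OF lip] in simp)
    from Lipschitz_right_differentiable_real[OF this] show ?thesis
      by (simp add: E_def q_def algebra_simps)
  qed
  text \<open>Averaging over translations in direction \<open>e\<close> replaces a Fubini argument in rotated coordinates.\<close>
  have "emeasure lborel (- E) = (\<integral>\<^sup>+t. indicator {0..1::real} t * emeasure lborel (- E) \<partial>lborel)"
    by (simp add: nn_integral_multc)
  also have "\<dots> = (\<integral>\<^sup>+t. indicator {0..1} t * (\<integral>\<^sup>+x. indicator (- E) (x + t *\<^sub>R e) \<partial>lborel) \<partial>lborel)"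
  proof (intro nn_integral_cong)
    fix t :: real
    have "(\<integral>\<^sup>+x. indicator (- E) (x + t *\<^sub>R e) \<partial>lborel) = emeasure lborel (- E)"
      by (subst nn_integral_translation) auto
    then show "indicator {0..1} t * emeasure lborel (- E) =
        indicator {0..1} t * (\<integral>\<^sup>+x. indicator (- E) (x + t *\<^sub>R e) \<partial>lborel)" by simp
  qed
  also have "\<dots> = (\<integral>\<^sup>+t. \<integral>\<^sup>+x. indicator {0..1} t * indicator (- E) (x + t *\<^sub>R e) \<partial>lborel \<partial>lborel)"
    by (intro nn_integral_cong nn_integral_cmult[symmetric]) measurable
  also have "\<dots> = (\<integral>\<^sup>+x. \<integral>\<^sup>+t. indicator {0..1} t * indicator (- E) (x + t *\<^sub>R e) \<partial>lborel \<partial>lborel)"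
    by (rule lborel_pair.Fubini') measurable
  also have "\<dots> = (\<integral>\<^sup>+x. 0 \<partial>(lborel::'a measure))"
  proof (intro nn_integral_cong)
    fix x :: 'a
    have "(\<integral>\<^sup>+t. indicator {0..1} t * indicator (- E) (x + t *\<^sub>R e) \<partial>lborel) = (\<integral>\<^sup>+t. 0 \<partial>(lborel::real measure))"
      using line[of x] by (intro nn_integral_cong_AE) (auto elim!: eventually_mono)
    then show "(\<integral>\<^sup>+t. indicator {0..1} t * indicator (- E) (x + t *\<^sub>R e) \<partial>(lborel::real measure)) = 0" by simp
  qed
  finally have "emeasure lborel (- E) = 0" by simp
  then have "- E \<in> null_sets lborel" using Em by auto
  then have "AE x in lborel. x \<in> E" using AE_not_in by force
  then show ?thesis
  proof eventually_elim
    case (elim x)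
    then obtain l where l: "((\<lambda>r. q r x) \<longlongrightarrow> l) (at_right 0)" by (auto simp: E_def)
    from tendsto_at_right_seq[OF l] have "dirD f e x = l"
      by (auto simp: q_def dirD_def divide_inverse limI)
    then show ?case using l by (simp add: q_def)
  qed
qed

lemma dirD_seq_AE:
  fixes f :: "'a::euclidean_space \<Rightarrow> real"
  assumes lip: "L-lipschitz_on UNIV f"
  shows "AE x in lborel. (\<lambda>n. (f (x + e /\<^sub>R real (Suc n)) - f x) * real (Suc n)) \<longlonglongrightarrow> dirD f e x"
  using Lipschitz_directional_AE[OF lip, of e]
proof eventually_elim
  case (elim x)
  from tendsto_at_right_seq[OF this] show ?case by (simp add: divide_inverse)
qed

lemma difference_quotient_le:
  fixes f :: "'a::real_normed_vector \<Rightarrow> real"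
  assumes lip: "L-lipschitz_on UNIV f"
  shows "\<bar>(f (x + e /\<^sub>R real (Suc n)) - f x) * real (Suc n)\<bar> \<le> L * norm e"
proof -
  have "\<bar>f (x + e /\<^sub>R real (Suc n)) - f x\<bar> \<le> L * (norm e / real (Suc n))"
    using lipschitz_onD[OF lip, of "x + e /\<^sub>R real (Suc n)" x]
    by (simp add: dist_norm divide_inverse_commute)
  then have "\<bar>f (x + e /\<^sub>R real (Suc n)) - f x\<bar> * real (Suc n) \<le> L * (norm e / real (Suc n)) * real (Suc n)"
    by (rule mult_right_mono) simp
  then show ?thesis by (simp add: abs_mult)
qed

lemma dirD_bound_AE:
  fixes f :: "'a::euclidean_space \<Rightarrow> real"
  assumes lip: "L-lipschitz_on UNIV f"
  shows "AE x in lborel. \<bar>dirD f e x\<bar> \<le> L * norm e"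
  using dirD_seq_AE[OF lip, of e]
proof eventually_elim
  case (elim x)
  then show ?case using difference_quotient_le[OF lip, of x _ e]
    by (intro LIMSEQ_le_const2[OF tendsto_rabs]) auto
qed

text \<open>Translation invariance gives the identity for difference quotients; dominated convergence gives the limit.\<close>

lemma dirD_by_parts_bump:
  fixes f :: "'a::euclidean_space \<Rightarrow> real"
  assumes lip: "L-lipschitz_on UNIV f" and r: "0 < r"
  shows "integrable lborel (\<lambda>y. dirD f e y * bump c r y)" (is ?int)
    and "integrable lborel (\<lambda>y. f y * (4 * max 0 (r\<^sup>2 - (norm (y - c))\<^sup>2) * ((y - c) \<bullet> e)))" (is ?int2)
    and "(LINT y|lborel. dirD f e y * bump c r y) =
      (LINT y|lborel. f y * (4 * max 0 (r\<^sup>2 - (norm (y - c))\<^sup>2) * ((y - c) \<bullet> e)))" (is ?eq)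
proof -
  let ?\<phi> = "bump c r" and ?d = "\<lambda>y. 4 * max 0 (r\<^sup>2 - (norm (y - c))\<^sup>2) * ((y - c) \<bullet> e)"
  have cf: "continuous_on S f" for S using lip by (metis lipschitz_on_continuous_on continuous_on_subset subset_UNIV)
  have c\<phi>: "continuous_on S ?\<phi>" for S
    using bump_lipschitz[OF r] by (metis lipschitz_on_continuous_on continuous_on_subset subset_UNIV)
  have [measurable]: "f \<in> borel_measurable borel" "?\<phi> \<in> borel_measurable borel" "dirD f e \<in> borel_measurable borel"
    using cf c\<phi> by (auto intro: borel_measurable_continuous_onI dirD_measurable)
  \<comment> \<open>Large enough for the supports of all shifted bumps, as no shift is longer than
    \<open>norm e\<close>.\<close>
  define Q where "Q = cball c (r + norm e)"
  have \<phi>Q: "indicator Q y * ?\<phi> y = ?\<phi> y" for y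
  proof (cases "?\<phi> y = 0")
    case False
    from bump_support[OF r this] have "norm (y - c) \<le> r + norm e"
      using norm_ge_zero[of e] by linarith
    then show ?thesis by (simp add: indicator_def Q_def dist_norm norm_minus_commute)
  qed simp
  have int_comp: "integrable lborel (\<lambda>y. indicator Q y * g y)" if "continuous_on Q g" for g :: "'a \<Rightarrow> real"
    using borel_integrable_compact[of Q g] that by (simp add: Q_def)
  have i\<phi>: "integrable lborel ?\<phi>" using int_comp[OF c\<phi>] by (simp add: \<phi>Q)
  have int_\<phi>: "integrable lborel (\<lambda>y. g y * ?\<phi> y)" if "continuous_on Q g" for g :: "'a \<Rightarrow> real"
  proof -
    have "(\<lambda>y. indicator Q y * (g y * ?\<phi> y)) = (\<lambda>y. g y * (indicator Q y * ?\<phi> y))" by (simp add: mult.left_commute)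
    then show ?thesis using int_comp[OF continuous_on_mult[OF that c\<phi>]] by (simp only: \<phi>Q)
  qed
  have if\<phi>: "integrable lborel (\<lambda>y. f y * ?\<phi> y)"
    by (rule int_\<phi>[OF cf])
  define s where "s n y = (f (y + e /\<^sub>R real (Suc n)) - f y) * real (Suc n)" for n y
  \<comment> \<open>The adjoint of the quotient \<open>s n\<close>: the shift changes sign when it
    moves to the bump.\<close>
  define t where "t n y = (?\<phi> (y - e /\<^sub>R real (Suc n)) - ?\<phi> y) * real (Suc n)" for n y
  have [measurable]: "s n \<in> borel_measurable borel" "t n \<in> borel_measurable borel" for n
    unfolding s_def[abs_def] t_def[abs_def] by measurable
  have sle: "\<bar>s n y\<bar> \<le> L * norm e" for n y unfolding s_def by (rule difference_quotient_le[OF lip])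
  have w: "integrable lborel (\<lambda>y. L * norm e * ?\<phi> y)" using i\<phi> by simp
  have lim1: "AE y in lborel. (\<lambda>n. s n y * ?\<phi> y) \<longlonglongrightarrow> dirD f e y * ?\<phi> y"
    using dirD_seq_AE[OF lip, of e] by eventually_elim (auto simp: s_def intro: tendsto_mult)
  have b1: "AE y in lborel. norm (s n y * ?\<phi> y) \<le> L * norm e * ?\<phi> y" for n
    using sle[of n] by (intro AE_I2) (auto simp: abs_mult bump_nonneg intro!: mult_right_mono)
  note dct1 = integral_dominated_convergence[of "\<lambda>y. dirD f e y * ?\<phi> y" lborel "\<lambda>n y. s n y * ?\<phi> y" "\<lambda>y. L * norm e * ?\<phi> y"]
    integrable_dominated_convergence[of "\<lambda>y. dirD f e y * ?\<phi> y" lborel "\<lambda>n y. s n y * ?\<phi> y" "\<lambda>y. L * norm e * ?\<phi> y"]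
  show ?int using w lim1 b1 by (intro dct1(2)) auto
  have L1: "(\<lambda>n. LINT y|lborel. s n y * ?\<phi> y) \<longlonglongrightarrow> (LINT y|lborel. dirD f e y * ?\<phi> y)"
    using w lim1 b1 by (intro dct1(1)) auto
  define M where "M = 4 * r ^ 3 * norm e"
  have w2: "integrable lborel (\<lambda>y. M * (indicator Q y * \<bar>f y\<bar>))"
    by (intro integrable_mult_right int_comp continuous_intros cf)
  have lim2: "(\<lambda>n. f y * t n y) \<longlonglongrightarrow> f y * ?d y" for y
    using has_derivative_directional_seq[OF bump_has_derivative[of c r y], of "- e"]
    by (intro tendsto_mult tendsto_const) (simp add: t_def)
  have tb: "\<bar>t n y\<bar> \<le> M * indicator Q y" for n y
  proof (cases "y \<in> Q")
    case True
    then show ?thesis using difference_quotient_le[OF bump_lipschitz[OF r, of c], of y n "- e"]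
      by (simp add: t_def M_def)
  next
    case False
    let ?h = "e /\<^sub>R real (Suc n)"
    have h: "norm ?h \<le> norm e" by (simp add: field_simps mult_left_le_one_le)
    have "norm (y - c) > r + norm e" using False by (simp add: Q_def dist_norm norm_minus_commute)
    also have "norm (y - c) \<le> norm (y - ?h - c) + norm ?h"
      using norm_triangle_ineq[of "y - ?h - c" "?h"] by (simp add: algebra_simps)
    also have "\<dots> \<le> norm (y - ?h - c) + norm e" using h by (rule add_left_mono)
    finally have "\<not> norm (y - ?h - c) < r" by (simp only: add_less_cancel_right not_less less_imp_le)
    moreover have "\<not> norm (y - c) < r" using \<open>r + norm e < norm (y - c)\<close> norm_ge_zero[of e] by linarith
    ultimately have "?\<phi> (y - e /\<^sub>R real (Suc n)) = 0" "?\<phi> y = 0" using bump_support[OF r] by blast+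
    then show ?thesis using False by (simp add: t_def)
  qed
  have b2: "norm (f y * t n y) \<le> M * (indicator Q y * \<bar>f y\<bar>)" for n y
    using mult_left_mono[OF tb[of n y], of "\<bar>f y\<bar>"] by (simp add: abs_mult mult_ac)
  have [measurable]: "?d \<in> borel_measurable borel"
    by measurable
  note dct2 = integral_dominated_convergence[of "\<lambda>y. f y * ?d y" lborel "\<lambda>n y. f y * t n y" "\<lambda>y. M * (indicator Q y * \<bar>f y\<bar>)"]
    integrable_dominated_convergence[of "\<lambda>y. f y * ?d y" lborel "\<lambda>n y. f y * t n y" "\<lambda>y. M * (indicator Q y * \<bar>f y\<bar>)"]
  show ?int2 using w2 lim2 b2 by (intro dct2(2)) auto
  have L2: "(\<lambda>n. LINT y|lborel. f y * t n y) \<longlonglongrightarrow> (LINT y|lborel. f y * ?d y)"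
    using w2 lim2 b2 by (intro dct2(1)) auto
  have "(LINT y|lborel. s n y * ?\<phi> y) = (LINT y|lborel. f y * t n y)" for n
  proof -
    let ?h = "e /\<^sub>R real (Suc n)"
    have m1: "(\<lambda>y. f y * ?\<phi> (y - ?h)) \<in> borel_measurable borel" by measurable
    have if1: "integrable lborel (\<lambda>y. f (y + ?h) * ?\<phi> y)"
    proof (rule int_\<phi>)
      have "continuous_on Q (\<lambda>y. y + ?h)" by (intro continuous_intros)
      from continuous_on_compose2[OF cf[of UNIV] this] show "continuous_on Q (\<lambda>y. f (y + ?h))" by simp
    qed
    then have if2: "integrable lborel (\<lambda>y. f y * ?\<phi> (y - ?h))"
      using integral_translation(2)[OF m1, of ?h] by simp
    have "(LINT y|lborel. s n y * ?\<phi> y) = (LINT y|lborel. (f (y + ?h) * ?\<phi> y - f y * ?\<phi> y) * real (Suc n))"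
      by (simp add: s_def algebra_simps)
    also have "\<dots> = ((LINT y|lborel. f (y + ?h) * ?\<phi> y) - (LINT y|lborel. f y * ?\<phi> y)) * real (Suc n)"
      using if1 if\<phi> by (simp only: integral_mult_left_zero Bochner_Integration.integral_diff)
    also have "(LINT y|lborel. f (y + ?h) * ?\<phi> y) = (LINT y|lborel. f y * ?\<phi> (y - ?h))"
      using integral_translation(1)[OF m1, of ?h] by simp
    also have "((LINT y|lborel. f y * ?\<phi> (y - ?h)) - (LINT y|lborel. f y * ?\<phi> y)) * real (Suc n) =
        (LINT y|lborel. (f y * ?\<phi> (y - ?h) - f y * ?\<phi> y) * real (Suc n))"
      using if2 if\<phi> by (simp only: integral_mult_left_zero Bochner_Integration.integral_diff)
    also have "\<dots> = (LINT y|lborel. f y * t n y)" by (simp add: t_def algebra_simps)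
    finally show ?thesis .
  qed
  then show ?eq using LIMSEQ_unique[OF L1] L2 by simp
qed

text \<open>Tested against a bump, the derivative moves onto the bump, where linearity in the
  direction is classical. The defect of linearity therefore has vanishing averages and is zero
  almost everywhere.\<close>

lemma dirD_linear_AE:
  fixes f :: "'a::euclidean_space \<Rightarrow> real"
  assumes lip: "L-lipschitz_on UNIV f"
  shows "AE x in lborel. dirD f e x = (\<Sum>b\<in>Basis. (e \<bullet> b) * dirD f b x)"
proof -
  define F where "F x = dirD f e x - (\<Sum>b\<in>Basis. (e \<bullet> b) * dirD f b x)" for x
  have [measurable]: "dirD f v \<in> borel_measurable borel" for v
    using lip by (intro dirD_measurable lipschitz_on_continuous_on)
  have [measurable]: "F \<in> borel_measurable borel" unfolding F_def[abs_def] by measurable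
  have int0: "(LINT y|lborel. bump c r y * F y) = 0" if r: "0 < r" for c r
  proof -
    note ibp = dirD_by_parts_bump[OF lip r]
    let ?d = "\<lambda>e y. 4 * max 0 (r\<^sup>2 - (norm (y - c))\<^sup>2) * ((y - c) \<bullet> e)"
    have "(LINT y|lborel. bump c r y * F y) =
      (LINT y|lborel. dirD f e y * bump c r y - (\<Sum>b\<in>Basis. (e \<bullet> b) * (dirD f b y * bump c r y)))"
      by (simp add: F_def algebra_simps sum_distrib_left)
    also have "\<dots> = (LINT y|lborel. dirD f e y * bump c r y) - (\<Sum>b\<in>Basis. (e \<bullet> b) * (LINT y|lborel. dirD f b y * bump c r y))"
      using ibp(1) by (subst Bochner_Integration.integral_diff) (auto intro!: Bochner_Integration.integrable_sum)
    also have "\<dots> = (LINT y|lborel. f y * ?d e y) - (\<Sum>b\<in>Basis. (e \<bullet> b) * (LINT y|lborel. f y * ?d b y))"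
      by (simp add: ibp(3))
    also have "\<dots> = (LINT y|lborel. f y * ?d e y - (\<Sum>b\<in>Basis. (e \<bullet> b) * (f y * ?d b y)))"
      using ibp(2) by (subst Bochner_Integration.integral_diff) (auto intro!: Bochner_Integration.integrable_sum)
    also have "\<dots> = (LINT y|(lborel::'a measure). 0)"
    proof (intro Bochner_Integration.integral_cong refl)
      fix y :: 'a
      have "(y - c) \<bullet> e = (\<Sum>b\<in>Basis. (e \<bullet> b) * ((y - c) \<bullet> b))"
        by (subst euclidean_inner) (simp add: mult.commute)
      moreover have "(\<Sum>b\<in>Basis. (e \<bullet> b) * (f y * ?d b y)) =
          f y * (4 * max 0 (r\<^sup>2 - (norm (y - c))\<^sup>2)) * (\<Sum>b\<in>Basis. (e \<bullet> b) * ((y - c) \<bullet> b))"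
        unfolding sum_distrib_left by (intro sum.cong refl) (simp only: mult_ac)
      ultimately show "f y * ?d e y - (\<Sum>b\<in>Basis. (e \<bullet> b) * (f y * ?d b y)) = 0"
        by (simp only: mult.assoc diff_self)
    qed
    finally show ?thesis by simp
  qed
  have AEF: "AE x in lborel. \<bar>F x\<bar> \<le> L * norm e + (\<Sum>b\<in>(Basis::'a set). \<bar>e \<bullet> b\<bar> * L)"
  proof -
    have "AE x in lborel. \<forall>b\<in>(Basis::'a set). \<bar>dirD f b x\<bar> \<le> L"
    proof (subst AE_finite_all[OF finite_Basis], intro ballI)
      fix b :: 'a assume "b \<in> Basis"
      then show "AE x in lborel. \<bar>dirD f b x\<bar> \<le> L" using dirD_bound_AE[OF lip, of b] by simp
    qed
    with dirD_bound_AE[OF lip, of e] show ?thesis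
    proof eventually_elim
      case (elim x)
      have "\<bar>F x\<bar> \<le> \<bar>dirD f e x\<bar> + \<bar>\<Sum>b\<in>Basis. (e \<bullet> b) * dirD f b x\<bar>" unfolding F_def by (rule abs_triangle_ineq4)
      also have "\<bar>\<Sum>b\<in>Basis. (e \<bullet> b) * dirD f b x\<bar> \<le> (\<Sum>b\<in>(Basis::'a set). \<bar>e \<bullet> b\<bar> * L)"
        using elim(2) by (intro order_trans[OF sum_abs] sum_mono) (auto simp: abs_mult intro!: mult_left_mono)
      finally show ?case using elim(1) by simp
    qed
  qed
  have "AE x in lborel. \<forall>R::nat. x \<in> ball 0 (real R) \<longrightarrow> F x = 0"
    unfolding AE_all_countable
  proof
    fix R :: nat
    \<comment> \<open>The defect is bounded, but only its cut-offs are sure to be integrable; the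
      radius enlarged by \<open>norm One\<close> leaves the averages at points of the smaller ball
      unchanged.\<close>
    let ?B = "ball 0 (real R + norm (One::'a)) :: 'a set"
    have iF: "integrable lborel (\<lambda>y. F y * indicator ?B y)"
    proof (rule Bochner_Integration.integrable_bound)
      show "integrable lborel (\<lambda>y. (L * norm e + (\<Sum>b\<in>(Basis::'a set). \<bar>e \<bullet> b\<bar> * L)) * indicator ?B y)"
        by (intro integrable_mult_right integrable_real_indicator emeasure_bounded_finite) auto
    qed (use AEF in \<open>auto simp: indicator_def elim!: eventually_mono\<close>)
    have "AE x in lborel. x \<in> ball 0 (real R) \<longrightarrow> F x * indicator ?B x = 0"
    proof (rule fundamental_lemma_moll[OF iF, of _ 0])
      fix k and x :: 'a assume x: "x \<in> ball 0 (real R)"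
      let ?m = "2 * real (Suc k)"
      have mb: "moll k (y - x) = bump (x + One /\<^sub>R ?m) (1 / ?m) y / (LINT y|lborel. moll_bump k (y::'a))" for y
        by (simp add: moll_def moll_bump_def bump_def algebra_simps)
      have supp: "moll k (y - x) * (F y * indicator ?B y) = moll k (y - x) * F y" for y
      proof (cases "moll k (y - x) = 0")
        case False
        have "norm (y - x) \<le> norm (One /\<^sub>R real (Suc k) :: 'a)"
          using moll_support[OF False] by (intro norm_le_componentwise) (auto simp: mem_box)
        also have "\<dots> \<le> norm (One::'a)" by (simp add: field_simps mult_left_le_one_le)
        finally have "norm y < real R + norm (One::'a)"
          using x norm_triangle_ineq[of x "y - x"] by simp
        then show ?thesis by (simp add: indicator_def)
      qed simp
      have "(LINT y|lborel. moll k (y - x) * (F y * indicator ?B y)) =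
        (LINT y|lborel. (bump (x + One /\<^sub>R ?m) (1 / ?m) y * F y) / (LINT y|lborel. moll_bump k (y::'a)))"
        unfolding supp by (simp add: mb)
      also have "\<dots> = 0" by (subst integral_divide_zero, subst int0) auto
      finally show "(LINT y|lborel. moll k (y - x) * (F y * indicator ?B y)) = 0" .
    qed simp
    then show "AE x in lborel. x \<in> ball 0 (real R) \<longrightarrow> F x = 0"
    proof eventually_elim
      case (elim x)
      show ?case
      proof
        assume x: "x \<in> ball 0 (real R)"
        then have "norm x < real R + norm (One::'a)"
          using norm_ge_zero[of "One::'a"] unfolding mem_ball dist_0_norm by linarith
        then have "x \<in> ?B" by (simp only: mem_ball dist_0_norm)
        then show "F x = 0" using elim x by simp
      qed
    qed
  qed
  then show ?thesis
  proof eventually_elim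
    case (elim x)
    obtain R :: nat where "norm x < real R" using reals_Archimedean2 by blast
    then show ?case using elim by (auto simp: F_def)
  qed
qed

text \<open>Off one null set the one-sided directional limits are linear along a countable dense set
  of directions. Finitely many of these come close to every unit vector, and the Lipschitz bound
  makes the limit uniform in the direction. One-sided limits suffice, as every nonzero increment is
  a positive multiple of a unit vector.\<close>

theorem Rademacher:
  fixes f :: "'a::euclidean_space \<Rightarrow> real"
  assumes lip: "L-lipschitz_on UNIV f"
  shows "AE x in lborel. f differentiable at x"
proof -
  have L0: "0 \<le> L" using lip by (rule lipschitz_on_nonneg)
  obtain D :: "'a set" where D: "countable D" "\<And>X. open X \<Longrightarrow> X \<noteq> {} \<Longrightarrow> \<exists>d\<in>D. d \<in> X"
    using countable_dense_setE by blast
  have "AE x in lborel. \<forall>e\<in>D. ((\<lambda>t. (f (x + t *\<^sub>R e) - f x) / t) \<longlongrightarrow> (\<Sum>b\<in>Basis. (e \<bullet> b) * dirD f b x)) (at_right 0)"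
    unfolding AE_ball_countable[OF D(1)]
  proof
    fix e assume "e \<in> D"
    from Lipschitz_directional_AE[OF lip, of e] dirD_linear_AE[OF lip, of e]
    show "AE x in lborel. ((\<lambda>t. (f (x + t *\<^sub>R e) - f x) / t) \<longlongrightarrow> (\<Sum>b\<in>Basis. (e \<bullet> b) * dirD f b x)) (at_right 0)"
      by eventually_elim simp
  qed
  then show ?thesis
  proof eventually_elim
    case (elim x)
    define g where "g = (\<Sum>b\<in>Basis. dirD f b x *\<^sub>R b)"
    have lin: "(\<Sum>b\<in>Basis. (e \<bullet> b) * dirD f b x) = g \<bullet> e" for e
      unfolding g_def inner_sum_left by (intro sum.cong) (auto simp: inner_commute)
    have "(f has_derivative (\<lambda>h. g \<bullet> h)) (at x)"
      unfolding has_derivative_within'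
    proof (intro conjI allI impI bounded_linear_inner_right)
      fix \<epsilon> :: real assume \<epsilon>: "0 < \<epsilon>"
      \<comment> \<open>Three errors, \<open>L\<close>, \<open>1\<close> and \<open>norm g\<close>
        times \<open>t * \<eta>\<close>, then add up to \<open>t * \<epsilon> / 2\<close>.\<close>
      define \<eta> where "\<eta> = \<epsilon> / (2 * (L + 1 + norm g))"
      have den: "0 < L + 1 + norm g" using L0 by (simp add: add_nonneg_pos add_pos_nonneg)
      have \<eta>: "0 < \<eta>" using den \<epsilon> by (simp add: \<eta>_def)
      have "sphere 0 1 \<subseteq> (\<Union>e\<in>D. ball e \<eta>)"
      proof
        fix w :: 'a
        obtain d where "d \<in> D" "d \<in> ball w \<eta>" using D(2)[of "ball w \<eta>"] \<eta> by auto
        then show "w \<in> (\<Union>e\<in>D. ball e \<eta>)" by (auto simp: dist_commute)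
      qed
      then obtain D' where D': "D' \<subseteq> D" "finite D'" "sphere 0 1 \<subseteq> (\<Union>e\<in>D'. ball e \<eta>)"
        using compactE_image[of "sphere (0::'a) 1" D "\<lambda>e. ball e \<eta>"] by auto
      have "eventually (\<lambda>t. \<forall>e\<in>D'. \<bar>(f (x + t *\<^sub>R e) - f x) / t - g \<bullet> e\<bar> < \<eta>) (at_right 0)"
        unfolding eventually_ball_finite_distrib[OF D'(2)]
      proof
        fix e assume "e \<in> D'"
        then have "((\<lambda>t. (f (x + t *\<^sub>R e) - f x) / t) \<longlongrightarrow> g \<bullet> e) (at_right 0)"
          using elim D'(1) by (auto simp: lin)
        from tendstoD[OF this \<eta>] show "eventually (\<lambda>t. \<bar>(f (x + t *\<^sub>R e) - f x) / t - g \<bullet> e\<bar> < \<eta>) (at_right 0)"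
          by (simp add: dist_real_def)
      qed
      then obtain d where d: "0 < d" "\<And>t e. 0 < t \<Longrightarrow> t < d \<Longrightarrow> e \<in> D' \<Longrightarrow> \<bar>(f (x + t *\<^sub>R e) - f x) / t - g \<bullet> e\<bar> < \<eta>"
        by (auto simp: eventually_at_right_field)
      show "\<exists>d>0. \<forall>x'\<in>UNIV. 0 < norm (x' - x) \<and> norm (x' - x) < d \<longrightarrow>
        norm (f x' - f x - g \<bullet> (x' - x)) / norm (x' - x) < \<epsilon>"
      proof (intro exI[of _ d] conjI ballI impI d(1))
        fix x' assume x': "0 < norm (x' - x) \<and> norm (x' - x) < d"
        define t where "t = norm (x' - x)"
        define w where "w = (x' - x) /\<^sub>R t"
        have t: "0 < t" "t < d" using x' by (auto simp: t_def)
        have xw: "x' = x + t *\<^sub>R w" using t by (simp add: w_def)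
        have "w \<in> sphere 0 1" using t by (simp add: w_def t_def)
        then obtain e where "e \<in> D'" "w \<in> ball e \<eta>"
          using D'(3) by blast
        then have e: "e \<in> D'" "norm (w - e) < \<eta>" by (auto simp: dist_norm norm_minus_commute)
        have 1: "\<bar>f (x + t *\<^sub>R w) - f (x + t *\<^sub>R e)\<bar> \<le> L * (t * \<eta>)"
        proof -
          have "\<bar>f (x + t *\<^sub>R w) - f (x + t *\<^sub>R e)\<bar> \<le> L * norm (t *\<^sub>R (w - e))"
            using lipschitz_onD[OF lip, of "x + t *\<^sub>R w" "x + t *\<^sub>R e"]
            by (simp add: dist_norm scaleR_diff_right)
          also have "\<dots> \<le> L * (t * \<eta>)" using t e L0 by (intro mult_left_mono) auto
          finally show ?thesis .
        qed
        have 2: "\<bar>f (x + t *\<^sub>R e) - f x - t * (g \<bullet> e)\<bar> \<le> t * \<eta>"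
        proof -
          have "\<bar>f (x + t *\<^sub>R e) - f x - t * (g \<bullet> e)\<bar> = t * \<bar>(f (x + t *\<^sub>R e) - f x) / t - g \<bullet> e\<bar>"
          proof -
            have "f (x + t *\<^sub>R e) - f x - t * (g \<bullet> e) = t * ((f (x + t *\<^sub>R e) - f x) / t - g \<bullet> e)"
              using t by (simp add: field_simps)
            then show ?thesis using t by (simp only: abs_mult abs_of_pos)
          qed
          also have "\<dots> \<le> t * \<eta>" using d(2)[OF t e(1)] t by (intro mult_left_mono) auto
          finally show ?thesis .
        qed
        have 3: "\<bar>t * (g \<bullet> e) - t * (g \<bullet> w)\<bar> \<le> norm g * (t * \<eta>)"
        proof -
          have "\<bar>t * (g \<bullet> e) - t * (g \<bullet> w)\<bar> = t * \<bar>g \<bullet> (w - e)\<bar>"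
            using t by (simp add: inner_diff_right abs_mult flip: right_diff_distrib)
          also have "\<dots> \<le> t * (norm g * \<eta>)"
            using t e Cauchy_Schwarz_ineq2[of g "w - e"] by (intro mult_left_mono order_trans[OF Cauchy_Schwarz_ineq2] ) auto
          finally show ?thesis by (simp add: mult_ac)
        qed
        have "norm (f x' - f x - g \<bullet> (x' - x)) \<le> (L + 1 + norm g) * (t * \<eta>)"
        proof -
          have "f x' - f x - g \<bullet> (x' - x) = (f (x + t *\<^sub>R w) - f (x + t *\<^sub>R e)) +
            (f (x + t *\<^sub>R e) - f x - t * (g \<bullet> e)) + (t * (g \<bullet> e) - t * (g \<bullet> w))"
            by (simp add: xw)
          then show ?thesis using 1 2 3 by (simp add: algebra_simps)
        qed
        also have "\<dots> = t * (\<epsilon> / 2)" using den by (simp add: \<eta>_def field_simps)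
        finally have "norm (f x' - f x - g \<bullet> (x' - x)) / t \<le> \<epsilon> / 2" using t by (simp add: pos_divide_le_eq mult.commute)
        then have "norm (f x' - f x - g \<bullet> (x' - x)) / t < \<epsilon>" using \<epsilon> by linarith
        then show "norm (f x' - f x - g \<bullet> (x' - x)) / norm (x' - x) < \<epsilon>" by (simp only: t_def)
      qed
    qed
    then show ?case by (auto simp: differentiable_def)
  qed
qed

subsection \<open>Gradient and divergence of Lipschitz functions\<close>

text \<open>Completeness makes every subset of the exceptional null set measurable. This settles the
  measurability of \<open>grad\<close> and \<open>dv\<close>, whose values at points of
  non-differentiability are unspecified.\<close>

lemma (in complete_measure) borel_measurable_AE_eq:
  assumes g: "g \<in> borel_measurable M" and eq: "AE x in M. f x = g x"
  shows "f \<in> borel_measurable M"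
proof (rule measurableI)
  from eq[unfolded eventually_ae_filter] obtain N where N: "N \<in> null_sets M" "{x \<in> space M. f x \<noteq> g x} \<subseteq> N"
    by (elim bexE)
  fix S :: "'b set" assume S: "S \<in> sets borel"
  let ?D = "{x \<in> space M. f x \<noteq> g x}"
  have D: "?D \<in> sets M" "?D \<inter> f -` S \<in> sets M"
    using complete[OF _ N(1), of ?D] complete[OF _ N(1), of "?D \<inter> f -` S"] N(2) by blast+
  have "f -` S \<inter> space M = (g -` S \<inter> space M - ?D) \<union> (?D \<inter> f -` S)" by auto
  also have "\<dots> \<in> sets M" using D measurable_sets[OF g S] by blast
  finally show "f -` S \<inter> space M \<in> sets M" .
qed auto

lemma complete_measure_lebesgue: "complete_measure lebesgue"
  by (rule completion.complete_measure_axioms)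

lemma complete_measure_lebesgue_on:
  assumes "S \<in> sets lebesgue"
  shows "complete_measure (lebesgue_on S)"
proof
  fix B C assume B: "B \<subseteq> C" "C \<in> null_sets (lebesgue_on S)"
  then have "C \<in> null_sets lebesgue" "C \<subseteq> S"
    using assms by (auto simp: null_sets_restrict_space)
  then have "B \<in> sets lebesgue" "B \<subseteq> S"
    using B(1) completion.complete by blast+
  then show "B \<in> sets (lebesgue_on S)" using assms by (simp add: sets_restrict_space_iff)
qed

lemma AE_lebesgue_on_iff:
  assumes "S \<in> sets lebesgue"
  shows "(AE x in lebesgue_on S. P x) \<longleftrightarrow> (AE x in lebesgue. x \<in> S \<longrightarrow> P x)"
  using assms by (subst AE_restrict_space_iff) auto

lemma AE_lebesgue_onI:
  assumes "S \<in> sets lebesgue" "AE x in lborel. P x"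
  shows "AE x in lebesgue_on S. P x"
  unfolding AE_lebesgue_on_iff[OF assms(1)] using AE_completion[OF assms(2)] by eventually_elim simp

lemma grad_has_derivative:
  assumes "f differentiable (at x)"
  shows "(f has_derivative (\<lambda>h. grad f x \<bullet> h)) (at x)"
proof -
  have d: "(f has_derivative frechet_derivative f (at x)) (at x)"
    using assms frechet_derivative_works by blast
  have lin: "linear (frechet_derivative f (at x))" using assms by (rule linear_frechet_derivative)
  have "frechet_derivative f (at x) h = grad f x \<bullet> h" for h
  proof -
    have "h = (\<Sum>i\<in>UNIV. (h $ i) *\<^sub>R axis i 1)"
      by (simp add: basis_expansion flip: scalar_mult_eq_scaleR)
    then have "frechet_derivative f (at x) h = frechet_derivative f (at x) (\<Sum>i\<in>UNIV. (h $ i) *\<^sub>R axis i 1)" by simp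
    also have "\<dots> = (\<Sum>i\<in>UNIV. (h $ i) * frechet_derivative f (at x) (axis i 1))"
      by (simp add: linear_sum[OF lin] linear_cmul[OF lin])
    also have "\<dots> = grad f x \<bullet> h" by (simp add: grad_def inner_vec_def mult.commute)
    finally show ?thesis .
  qed
  then show ?thesis using d by presburger
qed

lemma grad_eqI:
  assumes "(f has_derivative (\<lambda>h. g \<bullet> h)) (at x)"
  shows "grad f x = g"
proof -
  have "frechet_derivative f (at x) = (\<lambda>h. g \<bullet> h)" using frechet_derivative_at[OF assms] by simp
  then show ?thesis by (simp add: grad_def inner_axis vec_eq_iff)
qed

lemma grad_nth_eq_dirD:
  assumes "f differentiable (at x)"
  shows "grad f x $ i = dirD f (axis i 1) x"
  using has_derivative_directional_seq[OF grad_has_derivative[OF assms], of "axis i 1"]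
  by (simp add: dirD_def limI inner_axis)

text \<open>Difference quotients in the direction of the gradient itself are bounded by
  \<open>L * norm (grad f x)\<close> and tend to the squared norm of the gradient.\<close>

lemma norm_grad_le:
  fixes f :: "real ^ 'n \<Rightarrow> real"
  assumes lip: "L-lipschitz_on UNIV f" and d: "f differentiable (at x)"
  shows "norm (grad f x) \<le> L"
proof -
  let ?g = "grad f x"
  have "(\<lambda>n. \<bar>(f (x + ?g /\<^sub>R real (Suc n)) - f x) * real (Suc n)\<bar>) \<longlonglongrightarrow> \<bar>?g \<bullet> ?g\<bar>"
    using has_derivative_directional_seq[OF grad_has_derivative[OF d], of ?g] by (rule tendsto_rabs)
  then have "\<bar>?g \<bullet> ?g\<bar> \<le> L * norm ?g"
    using difference_quotient_le[OF lip] by (intro LIMSEQ_le_const2) auto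
  then have "norm ?g * norm ?g \<le> L * norm ?g" by (simp add: norm_eq_sqrt_inner)
  then show ?thesis using lipschitz_on_nonneg[OF lip] by (cases "?g = 0") auto
qed

lemma Rademacher_lebesgue:
  fixes f :: "'a::euclidean_space \<Rightarrow> real"
  assumes "L-lipschitz_on UNIV f"
  shows "AE x in lebesgue. f differentiable (at x)"
  using AE_completion[OF Rademacher[OF assms]] .

lemma grad_measurable:
  fixes f :: "real ^ 'n \<Rightarrow> real"
  assumes lip: "L-lipschitz_on UNIV f"
  shows "grad f \<in> borel_measurable lebesgue"
proof (rule complete_measure.borel_measurable_AE_eq[OF complete_measure_lebesgue])
  have [measurable]: "dirD f (axis i 1) \<in> borel_measurable borel" for i
    by (intro dirD_measurable lipschitz_on_continuous_on[OF lip])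
  have "(\<lambda>x. \<chi> i. dirD f (axis i 1) x) \<in> borel_measurable borel"
    by (subst borel_measurable_euclidean_space) (auto simp: Basis_vec_def inner_axis)
  then show "(\<lambda>x. \<chi> i. dirD f (axis i 1) x) \<in> borel_measurable lebesgue"
    by (intro measurable_completion) simp
  show "AE x in lebesgue. grad f x = (\<chi> i. dirD f (axis i 1) x)"
    using Rademacher_lebesgue[OF lip] by eventually_elim (simp add: vec_eq_iff grad_nth_eq_dirD)
qed

text \<open>\<open>div_A A V\<close> is \<open>dv\<close> of the field
  \<open>mat_sqrt (A y) *v V y\<close>; a name for the plain divergence gives one calculus for all
  the fields that occur.\<close>

definition dv :: "(real ^ 'n \<Rightarrow> real ^ 'n) \<Rightarrow> real ^ 'n \<Rightarrow> real" where
  "dv P x = trace (jacobian P (at x))"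

lemma dv_has_derivative:
  assumes "(P has_derivative D) (at x)"
  shows "dv P x = (\<Sum>i\<in>UNIV. D (axis i 1) $ i)"
proof -
  have "frechet_derivative P (at x) = D" using frechet_derivative_at[OF assms] by simp
  then show ?thesis by (simp add: dv_def jacobian_def trace_def matrix_def)
qed

lemma differentiable_vec_nth:
  fixes P :: "'a::real_normed_vector \<Rightarrow> real ^ 'n"
  shows "P differentiable (at x) \<longleftrightarrow> (\<forall>i. (\<lambda>y. P y $ i) differentiable (at x))"
proof -
  have "P differentiable (at x) \<longleftrightarrow> (\<forall>b\<in>Basis. (\<lambda>y. P y \<bullet> b) differentiable (at x))"
    by (rule differentiable_componentwise_within)
  also have "\<dots> \<longleftrightarrow> (\<forall>i. (\<lambda>y. P y $ i) differentiable (at x))"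
    by (auto simp: Basis_vec_def inner_axis)
  finally show ?thesis .
qed

lemma dv_eq:
  assumes "P differentiable (at x)"
  shows "dv P x = (\<Sum>i\<in>UNIV. grad (\<lambda>y. P y $ i) x $ i)"
proof -
  from assms obtain D where D: "(P has_derivative D) (at x)" by (auto simp: differentiable_def)
  have "(\<lambda>y. P y $ i) differentiable (at x)" for i using assms differentiable_vec_nth by blast
  then have 1: "((\<lambda>y. P y $ i) has_derivative (\<lambda>h. grad (\<lambda>y. P y $ i) x \<bullet> h)) (at x)" for i
    by (rule grad_has_derivative)
  have 2: "((\<lambda>y. P y $ i) has_derivative (\<lambda>h. D h $ i)) (at x)" for i
    using bounded_linear.has_derivative[OF bounded_linear_vec_nth D] by blast
  have "D h $ i = grad (\<lambda>y. P y $ i) x \<bullet> h" for h i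
    using has_derivative_unique[OF 1 2] by metis
  then show ?thesis by (simp add: dv_has_derivative[OF D] inner_axis)
qed

lemma dv_diff:
  assumes "P differentiable (at x)" "Q differentiable (at x)"
  shows "dv (\<lambda>y. P y - Q y) x = dv P x - dv Q x"
proof -
  obtain D E where D: "(P has_derivative D) (at x)" "(Q has_derivative E) (at x)"
    using assms by (auto simp: differentiable_def)
  show ?thesis
    unfolding dv_has_derivative[OF D(1)] dv_has_derivative[OF D(2)] dv_has_derivative[OF has_derivative_diff[OF D]]
    by (simp add: sum_subtractf)
qed

lemma dv_scaleR:
  assumes "w differentiable (at x)" "P differentiable (at x)"
  shows "dv (\<lambda>y. w y *\<^sub>R P y) x = w x * dv P x + grad w x \<bullet> P x"
proof -
  obtain D where D: "(P has_derivative D) (at x)" using assms by (auto simp: differentiable_def)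
  have "dv (\<lambda>y. w y *\<^sub>R P y) x = (\<Sum>i\<in>UNIV. (w x *\<^sub>R D (axis i 1) + (grad w x \<bullet> axis i 1) *\<^sub>R P x) $ i)"
    by (rule dv_has_derivative[OF has_derivative_scaleR[OF grad_has_derivative[OF assms(1)] D]])
  also have "\<dots> = w x * dv P x + grad w x \<bullet> P x"
    by (simp add: dv_has_derivative[OF D] sum.distrib sum_distrib_left inner_axis) (simp add: inner_vec_def)
  finally show ?thesis .
qed

lemma dv_outside:
  assumes "closed K" "x \<notin> K" "\<And>y. y \<notin> K \<Longrightarrow> P y = 0"
  shows "dv P x = 0"
proof -
  have "((\<lambda>y. 0) has_derivative (\<lambda>h. 0)) (at x)" by simp
  then have "(P has_derivative (\<lambda>h. 0)) (at x)"
    by (rule has_derivative_transform_within_open[of _ _ _ _ "- K"]) (use assms in auto)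
  from dv_has_derivative[OF this] show ?thesis by simp
qed

lemma lipschitz_vec_nth:
  assumes "L-lipschitz_on UNIV P"
  shows "L-lipschitz_on UNIV (\<lambda>y. P y $ i)"
  using assms by (auto simp: lipschitz_on_def dist_vec_def dest!: spec intro: order_trans[OF dist_vec_nth_le])

lemma lipschitz_differentiable_AE:
  fixes P :: "real ^ 'm \<Rightarrow> real ^ 'n"
  assumes "L-lipschitz_on UNIV P"
  shows "AE x in lebesgue. P differentiable (at x)"
proof -
  have "AE x in lebesgue. \<forall>i. (\<lambda>y. P y $ i) differentiable (at x)"
    using AE_finite_allI[of "UNIV :: 'n set", OF finite Rademacher_lebesgue[OF lipschitz_vec_nth[OF assms]]] by simp
  then show ?thesis by (simp add: differentiable_vec_nth)
qed

lemma abs_dv_le: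
  fixes P :: "real ^ 'n \<Rightarrow> real ^ 'n"
  assumes lip: "L-lipschitz_on UNIV P" and d: "P differentiable (at x)"
  shows "\<bar>dv P x\<bar> \<le> real CARD('n) * L"
proof -
  have "\<bar>dv P x\<bar> \<le> (\<Sum>i\<in>UNIV. \<bar>grad (\<lambda>y. P y $ i) x $ i\<bar>)" unfolding dv_eq[OF d] by (rule sum_abs)
  also have "\<dots> \<le> (\<Sum>i\<in>(UNIV::'n set). L)"
  proof (rule sum_mono)
    fix i
    have "\<bar>grad (\<lambda>y. P y $ i) x $ i\<bar> \<le> norm (grad (\<lambda>y. P y $ i) x)" by (rule component_le_norm_cart)
    also have "\<dots> \<le> L" using d differentiable_vec_nth by (intro norm_grad_le lipschitz_vec_nth[OF lip]) blast
    finally show "\<bar>grad (\<lambda>y. P y $ i) x $ i\<bar> \<le> L" .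
  qed
  finally show ?thesis by simp
qed

lemma dv_measurable:
  fixes P :: "real ^ 'n \<Rightarrow> real ^ 'n"
  assumes lip: "L-lipschitz_on UNIV P"
  shows "dv P \<in> borel_measurable lebesgue"
proof (rule complete_measure.borel_measurable_AE_eq[OF complete_measure_lebesgue])
  have [measurable]: "grad (\<lambda>y. P y $ i) \<in> borel_measurable lebesgue" for i
    by (rule grad_measurable[OF lipschitz_vec_nth[OF lip]])
  have "(\<lambda>x. grad (\<lambda>y. P y $ i) x \<bullet> axis i 1) \<in> borel_measurable lebesgue" for i by measurable
  then show "(\<lambda>x. \<Sum>i\<in>UNIV. grad (\<lambda>y. P y $ i) x $ i) \<in> borel_measurable lebesgue"
    by (intro borel_measurable_sum) (simp add: inner_axis)
  show "AE x in lebesgue. dv P x = (\<Sum>i\<in>UNIV. grad (\<lambda>y. P y $ i) x $ i)"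
    using lipschitz_differentiable_AE[OF lip] by eventually_elim (rule dv_eq)
qed

text \<open>Difference quotients of a compactly supported function integrate to zero by translation
  invariance, and they are dominated by a constant on one enlarged ball.\<close>

lemma integral_dirD:
  fixes f :: "'a::euclidean_space \<Rightarrow> real"
  assumes lip: "L-lipschitz_on UNIV f" and K: "compact K" "\<And>x. x \<notin> K \<Longrightarrow> f x = 0"
  shows "(LINT x|lborel. dirD f e x) = 0" "integrable lborel (dirD f e)"
proof -
  have cf: "continuous_on S f" for S using lip by (metis lipschitz_on_continuous_on continuous_on_subset subset_UNIV)
  have [measurable]: "f \<in> borel_measurable borel" "dirD f e \<in> borel_measurable borel"
    using cf by (auto intro: borel_measurable_continuous_onI dirD_measurable)
  obtain R where R: "0 < R" "\<And>x. x \<in> K \<Longrightarrow> norm x \<le> R"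
    using compact_imp_bounded[OF K(1)] by (auto simp: bounded_pos)
  define Q where "Q = cball (0::'a) (R + norm e)"
  have "(\<lambda>x. indicator K x *\<^sub>R f x) = f" using K(2) by (force simp: indicator_def)
  then have intf: "integrable lborel f" using borel_integrable_compact[OF K(1) cf] by simp
  define s where "s n y = (f (y + e /\<^sub>R real (Suc n)) - f y) * real (Suc n)" for n y
  have [measurable]: "s n \<in> borel_measurable borel" for n unfolding s_def[abs_def] by measurable
  have b: "norm (s n y) \<le> L * norm e * indicator Q y" for n y
  proof (cases "y \<in> Q")
    case True
    then show ?thesis using difference_quotient_le[OF lip, of y n e] by (simp add: s_def)
  next
    case False
    let ?h = "e /\<^sub>R real (Suc n)"
    have h: "norm ?h \<le> norm e" by (simp add: field_simps mult_left_le_one_le)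
    have "norm y > R + norm e" using False by (simp add: Q_def)
    also have "norm y \<le> norm (y + ?h) + norm ?h"
      using norm_triangle_ineq4[of "y + ?h" "?h"] by simp
    also have "\<dots> \<le> norm (y + ?h) + norm e" using h by (rule add_left_mono)
    finally have "\<not> norm (y + ?h) \<le> R" by (simp only: add_less_cancel_right not_le)
    moreover have "\<not> norm y \<le> R" using \<open>R + norm e < norm y\<close> norm_ge_zero[of e] by linarith
    ultimately have "y + ?h \<notin> K" "y \<notin> K" using R(2) by blast+
    then show ?thesis using False K(2) by (simp add: s_def)
  qed
  have w: "integrable lborel (\<lambda>y. L * norm e * indicator Q y)"
    by (intro integrable_mult_right integrable_real_indicator emeasure_bounded_finite) (auto simp: Q_def)
  have lim: "AE y in lborel. (\<lambda>n. s n y) \<longlonglongrightarrow> dirD f e y"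
    using dirD_seq_AE[OF lip, of e] by (simp add: s_def)
  show "integrable lborel (dirD f e)"
    using w lim b by (intro integrable_dominated_convergence[of "dirD f e" lborel s "\<lambda>y. L * norm e * indicator Q y"]) auto
  have "(\<lambda>n. LINT y|lborel. s n y) \<longlonglongrightarrow> (LINT y|lborel. dirD f e y)"
    using w lim b by (intro integral_dominated_convergence[of "dirD f e" lborel s "\<lambda>y. L * norm e * indicator Q y"]) auto
  moreover have "(LINT y|lborel. s n y) = 0" for n
    using integral_translation[of f "e /\<^sub>R real (Suc n)"] intf unfolding s_def
    by (simp add: Bochner_Integration.integral_diff)
  ultimately show "(LINT x|lborel. dirD f e x) = 0" using LIMSEQ_unique[of "\<lambda>n::nat. 0::real" 0] by simp
qed

text \<open>The divergence theorem behind the later integrations by parts, where the field is a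
  product of a Lipschitz function and a Lipschitz field.\<close>

lemma integral_dv:
  fixes P :: "real ^ 'n \<Rightarrow> real ^ 'n"
  assumes lip: "L-lipschitz_on UNIV P" and K: "compact K" "\<And>x. x \<notin> K \<Longrightarrow> P x = 0"
  shows "(LINT x|lebesgue. dv P x) = 0" "integrable lebesgue (dv P)"
proof -
  note l = lipschitz_vec_nth[OF lip]
  have z: "P x $ i = 0" if "x \<notin> K" for x i using K(2)[OF that] by simp
  note d = integral_dirD[OF l K(1) z]
  have [measurable]: "dirD (\<lambda>y. P y $ i) e \<in> borel_measurable borel" for i e
    by (intro dirD_measurable lipschitz_on_continuous_on[OF l])
  define s where "s x = (\<Sum>i\<in>UNIV. dirD (\<lambda>y. P y $ i) (axis i 1) x)" for x
  have sm: "s \<in> borel_measurable lborel" unfolding s_def[abs_def] by measurable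
  have si: "integrable lborel s" unfolding s_def[abs_def] by (intro Bochner_Integration.integrable_sum d)
  have "(LINT x|lborel. s x) = 0" unfolding s_def by (simp add: Bochner_Integration.integral_sum d)
  then have s0: "(LINT x|lebesgue. s x) = 0" "integrable lebesgue s"
    using si sm by (auto simp: integral_completion integrable_completion)
  have ae: "AE x in lebesgue. dv P x = s x"
    using lipschitz_differentiable_AE[OF lip]
  proof eventually_elim
    case (elim x)
    then have "(\<lambda>y. P y $ i) differentiable (at x)" for i using differentiable_vec_nth by blast
    then show ?case by (simp add: dv_eq[OF elim] s_def grad_nth_eq_dirD)
  qed
  have dm: "dv P \<in> borel_measurable lebesgue" by (rule dv_measurable[OF lip])
  show "(LINT x|lebesgue. dv P x) = 0"
    using s0 integral_cong_AE[OF dm _ ae] measurable_completion[OF sm] by simp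
  show "integrable lebesgue (dv P)"
    using s0 integrable_cong_AE[OF dm _ ae] measurable_completion[OF sm] by simp
qed

section \<open>Lipschitz functions and fields with compact support\<close>

lemma Lip_cI:
  assumes "L-lipschitz_on UNIV v" "compact K" "K \<subseteq> \<Omega>" "\<And>x. x \<notin> K \<Longrightarrow> v x = 0"
  shows "v \<in> Lip_c \<Omega>"
proof -
  have "{x. v x \<noteq> 0} \<subseteq> K" using assms(4) by blast
  then have "closure {x. v x \<noteq> 0} \<subseteq> K" using assms(2) by (intro closure_minimal compact_imp_closed)
  moreover from this have "compact (closure {x. v x \<noteq> 0})"
    using assms(2) by (metis closed_closure closed_Int_compact inf.absorb_iff2 inf_commute)
  ultimately show ?thesis using assms(1,3) unfolding Lip_c_def by blast
qed

lemma Lip_cE: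
  assumes "v \<in> Lip_c \<Omega>"
  obtains L K where "L-lipschitz_on UNIV v" "compact K" "K \<subseteq> \<Omega>" "\<And>x. x \<notin> K \<Longrightarrow> v x = 0"
  using assms that[of _ "closure {x. v x \<noteq> 0}"] closure_subset[of "{x. v x \<noteq> 0}"]
  unfolding Lip_c_def by blast

lemma Lip_c_zero: "(\<lambda>x. 0) \<in> Lip_c \<Omega>"
  by (rule Lip_cI[of 0 _ "{}"]) (auto simp: lipschitz_on_def)

lemma lipschitz_bounded_if_compact_support:
  fixes P :: "'a::real_normed_vector \<Rightarrow> 'b::real_normed_vector"
  assumes "L-lipschitz_on UNIV P" "compact K" "\<And>x. x \<notin> K \<Longrightarrow> P x = 0"
  obtains B where "0 \<le> B" "\<And>x. norm (P x) \<le> B"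
proof -
  have "compact (P ` K)"
    using assms by (metis compact_continuous_image continuous_on_subset lipschitz_on_continuous_on subset_UNIV)
  then obtain B where "\<And>x. x \<in> K \<Longrightarrow> norm (P x) \<le> B" using compact_imp_bounded by (force simp: bounded_iff)
  then have "norm (P x) \<le> max B 0" for x using assms(3) by (cases "x \<in> K") fastforce+
  then show ?thesis using that[of "max B 0"] by simp
qed

lemma lipschitz_scaleR:
  fixes P :: "'a::real_normed_vector \<Rightarrow> 'b::real_normed_vector"
  assumes "L-lipschitz_on UNIV w" "M-lipschitz_on UNIV P" "\<And>x. \<bar>w x\<bar> \<le> B" "\<And>x. norm (P x) \<le> C"
  shows "(B * M + L * C)-lipschitz_on UNIV (\<lambda>x. w x *\<^sub>R P x)"
proof (rule lipschitz_onI)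
  have B: "0 \<le> B" "0 \<le> C" using order_trans[OF abs_ge_zero assms(3)[of 0]] order_trans[OF norm_ge_zero assms(4)[of 0]] by auto
  have LM: "0 \<le> L" "0 \<le> M" using assms(1,2) lipschitz_on_nonneg by auto
  show "0 \<le> B * M + L * C" using B LM by simp
  fix x y
  have "w x *\<^sub>R P x - w y *\<^sub>R P y = w x *\<^sub>R (P x - P y) + (w x - w y) *\<^sub>R P y" by (simp add: algebra_simps)
  then have "norm (w x *\<^sub>R P x - w y *\<^sub>R P y) \<le> \<bar>w x\<bar> * norm (P x - P y) + \<bar>w x - w y\<bar> * norm (P y)"
    by (metis norm_scaleR norm_triangle_ineq)
  also have "\<dots> \<le> B * (M * dist x y) + (L * dist x y) * C"
    using lipschitz_onD[OF assms(1), of x y] lipschitz_onD[OF assms(2), of x y] assms(3,4) B LM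
    by (intro add_mono mult_mono) (auto simp: dist_norm)
  finally show "dist (w x *\<^sub>R P x) (w y *\<^sub>R P y) \<le> (B * M + L * C) * dist x y"
    by (simp add: dist_norm algebra_simps)
qed

lemma lipschitz_vecI:
  fixes P :: "'a::metric_space \<Rightarrow> real ^ 'n"
  assumes "\<And>i. (L i)-lipschitz_on UNIV (\<lambda>x. P x $ i)"
  shows "(\<Sum>i\<in>UNIV. L i)-lipschitz_on UNIV P"
proof (rule lipschitz_onI)
  show "0 \<le> (\<Sum>i\<in>UNIV. L i)" using assms lipschitz_on_nonneg by (intro sum_nonneg) blast
  fix x y
  have "dist (P x) (P y) \<le> (\<Sum>i\<in>UNIV. \<bar>(P x - P y) $ i\<bar>)" unfolding dist_norm by (rule norm_le_l1_cart)
  also have "\<dots> \<le> (\<Sum>i\<in>UNIV. L i * dist x y)"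
    using lipschitz_onD[OF assms, of x y] by (intro sum_mono) (simp add: dist_real_def)
  finally show "dist (P x) (P y) \<le> (\<Sum>i\<in>UNIV. L i) * dist x y" by (simp add: sum_distrib_right)
qed

lemma vector_Lip_cE:
  fixes V :: "real ^ 'n \<Rightarrow> real ^ 'n"
  assumes "\<And>i. (\<lambda>x. V x $ i) \<in> Lip_c \<Omega>"
  obtains L K B where "L-lipschitz_on UNIV V" "compact K" "K \<subseteq> \<Omega>" "\<And>x. x \<notin> K \<Longrightarrow> V x = 0" "0 \<le> B" "\<And>x. norm (V x) \<le> B"
proof -
  have "\<exists>L K. L-lipschitz_on UNIV (\<lambda>x. V x $ i) \<and> compact K \<and> K \<subseteq> \<Omega> \<and> (\<forall>x. x \<notin> K \<longrightarrow> V x $ i = 0)" for i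
    using Lip_cE[OF assms[of i]] by metis
  then obtain L K where LK: "\<And>i. (L i)-lipschitz_on UNIV (\<lambda>x. V x $ i)" "\<And>i. compact (K i)" "\<And>i. K i \<subseteq> \<Omega>"
    "\<And>i x. x \<notin> K i \<Longrightarrow> V x $ i = 0" by metis
  have l: "(\<Sum>i\<in>UNIV. L i)-lipschitz_on UNIV V" by (rule lipschitz_vecI[OF LK(1)])
  have K: "compact (\<Union>i. K i)" "(\<Union>i. K i) \<subseteq> \<Omega>" "\<And>x. x \<notin> (\<Union>i. K i) \<Longrightarrow> V x = 0"
    using LK by (auto simp: vec_eq_iff)
  obtain B where "0 \<le> B" "\<And>x. norm (V x) \<le> B"
    using lipschitz_bounded_if_compact_support[OF l K(1,3)] by blast
  then show ?thesis using that[OF l K] by blast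
qed

lemma norm_matrix_vector_le: "norm (M *v v) \<le> real CARD('n) * (norm M * norm v)"
  for M :: "real ^ 'm ^ 'n"
proof -
  have "norm (M *v v) \<le> (\<Sum>i\<in>UNIV. \<bar>(M *v v) $ i\<bar>)" by (rule norm_le_l1_cart)
  also have "\<dots> \<le> (\<Sum>i\<in>(UNIV::'n set). norm M * norm v)"
  proof (rule sum_mono)
    fix i
    have "(M *v v) $ i = M $ i \<bullet> v" by (simp add: matrix_vector_mult_def inner_vec_def)
    then have "\<bar>(M *v v) $ i\<bar> \<le> norm (M $ i) * norm v" by (simp add: Cauchy_Schwarz_ineq2)
    also have "\<dots> \<le> norm M * norm v" by (intro mult_right_mono Finite_Cartesian_Product.norm_nth_le) auto
    finally show "\<bar>(M *v v) $ i\<bar> \<le> norm M * norm v" .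
  qed
  finally show ?thesis by simp
qed

text \<open>\<open>S\<close> is controlled on \<open>\<Omega>\<close> only, while the claim concerns
  the whole space. If one of the two points lies in \<open>U\<close>, the difference is split so
  that at the other point \<open>S\<close> meets only the value of \<open>V\<close> there, which is
  zero off \<open>U\<close>.\<close>

lemma lipschitz_matrix_vector:
  fixes S :: "real ^ 'n \<Rightarrow> real ^ 'n ^ 'n"
  assumes S: "L-lipschitz_on \<Omega> S" "\<And>x. x \<in> U \<Longrightarrow> x \<in> \<Omega> \<Longrightarrow> norm (S x) \<le> B" "0 \<le> B"
    and V: "M-lipschitz_on UNIV V" "\<And>x. norm (V x) \<le> C" "\<And>x. x \<notin> U \<Longrightarrow> V x = 0" and U: "U \<subseteq> \<Omega>"
  shows "(real CARD('n) * (B * M + L * C))-lipschitz_on UNIV (\<lambda>x. S x *v V x)"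
proof (rule lipschitz_onI)
  have nn: "0 \<le> C" "0 \<le> M" "0 \<le> L"
    using order_trans[OF norm_ge_zero V(2)[of 0]] lipschitz_on_nonneg[OF V(1)] lipschitz_on_nonneg[OF S(1)] by auto
  then show "0 \<le> real CARD('n) * (B * M + L * C)" using S by simp
  have main: "norm (S x *v V x - S y *v V y) \<le> real CARD('n) * (B * M + L * C) * dist x y" if x: "x \<in> U" for x y
  proof -
    have 1: "norm (S x *v (V x - V y)) \<le> real CARD('n) * (B * (M * dist x y))"
      using S(2)[OF x] x U lipschitz_onD[OF V(1), of x y] S(3) nn
      by (intro order_trans[OF norm_matrix_vector_le] mult_left_mono mult_mono) (auto simp: dist_norm)
    have 2: "norm ((S x - S y) *v V y) \<le> real CARD('n) * ((L * dist x y) * C)"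
    proof (cases "y \<in> U")
      case True
      then show ?thesis using lipschitz_onD[OF S(1), of x y] x U V(2)[of y] nn
        by (intro order_trans[OF norm_matrix_vector_le] mult_left_mono mult_mono) (auto simp: dist_norm)
    next
      case False
      then show ?thesis using V(3) nn by simp
    qed
    have "S x *v V x - S y *v V y = S x *v (V x - V y) + (S x - S y) *v V y"
      by (simp add: matrix_vector_mult_diff_distrib matrix_vector_mult_diff_rdistrib)
    then have "norm (S x *v V x - S y *v V y) \<le> norm (S x *v (V x - V y)) + norm ((S x - S y) *v V y)"
      by (metis norm_triangle_ineq)
    also have "\<dots> \<le> real CARD('n) * (B * M + L * C) * dist x y" using 1 2 by (simp add: algebra_simps)
    finally show ?thesis .
  qed
  fix x y :: "real ^ 'n"
  consider "x \<in> U" | "y \<in> U" | "x \<notin> U" "y \<notin> U" by blast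
  then show "dist (S x *v V x) (S y *v V y) \<le> real CARD('n) * (B * M + L * C) * dist x y"
  proof cases
    case 1
    then show ?thesis using main[of x y] by (simp add: dist_norm)
  next
    case 2
    then show ?thesis using main[of y x] by (simp add: dist_norm norm_minus_commute)
  next
    case 3
    then show ?thesis using V(3) nn S by simp
  qed
qed

subsection \<open>Locality of weak directional derivatives\<close>

text \<open>\<open>dv P\<close> is Lebesgue measurable and bounded almost everywhere, whereas
  \<open>kernel_avg_osc\<close> wants a Borel kernel with bound and support at every point. Clipping
  a Borel version of the divergence and cutting it off at \<open>K\<close> changes it on a null set
  only.\<close>

lemma dv_borel_version:
  fixes P :: "real ^ 'n \<Rightarrow> real ^ 'n"
  assumes lip: "L-lipschitz_on UNIV P" and K: "compact K" "\<And>x. x \<notin> K \<Longrightarrow> P x = 0"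
  obtains b where "b \<in> borel_measurable borel" "\<And>x. \<bar>b x\<bar> \<le> real CARD('n) * L" "\<And>x. x \<notin> K \<Longrightarrow> b x = 0"
    "AE x in lborel. P differentiable (at x) \<and> b x = dv P x" "integrable lborel b" "(LINT x|lborel. b x) = 0"
proof -
  note l = lipschitz_vec_nth[OF lip]
  let ?c = "real CARD('n) * L"
  have c: "0 \<le> ?c" using lipschitz_on_nonneg[OF lip] by simp
  have [measurable]: "dirD (\<lambda>y. P y $ i) e \<in> borel_measurable borel" for i e
    by (intro dirD_measurable lipschitz_on_continuous_on[OF l])
  have [measurable]: "K \<in> sets borel" using K(1) by (simp add: compact_imp_closed)
  define a where "a x = (\<Sum>i\<in>UNIV. dirD (\<lambda>y. P y $ i) (axis i 1) x)" for x
  have [measurable]: "a \<in> borel_measurable borel" unfolding a_def[abs_def] by measurable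
  define b where "b x = indicator K x * max (- ?c) (min ?c (a x))" for x
  have bm: "b \<in> borel_measurable borel" unfolding b_def[abs_def] by measurable
  have b1: "\<bar>b x\<bar> \<le> ?c" for x using c by (auto simp: b_def indicator_def)
  have ae: "AE x in lborel. P differentiable (at x)"
    using lipschitz_differentiable_AE[OF lip] by (simp only: AE_completion_iff)
  then have ae: "AE x in lborel. P differentiable (at x) \<and> b x = dv P x"
  proof eventually_elim
    case (elim x)
    then have "(\<lambda>y. P y $ i) differentiable (at x)" for i using differentiable_vec_nth by blast
    then have "a x = dv P x" by (simp add: dv_eq[OF elim] a_def grad_nth_eq_dirD)
    moreover have "dv P x = 0" if "x \<notin> K" using that K by (intro dv_outside[of K]) (auto simp: compact_imp_closed)
    moreover have "\<bar>dv P x\<bar> \<le> ?c" by (rule abs_dv_le[OF lip elim])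
    ultimately show ?case using elim by (auto simp: b_def indicator_def)
  qed
  have bl: "b \<in> borel_measurable lebesgue" using bm by (intro measurable_completion) simp
  have ael: "AE x in lebesgue. b x = dv P x" using AE_completion[OF ae] by eventually_elim simp
  have "integrable lebesgue b" "(LINT x|lebesgue. b x) = 0"
    using integral_dv[OF lip K] integrable_cong_AE[OF bl dv_measurable[OF lip] ael]
      integral_cong_AE[OF bl dv_measurable[OF lip] ael] by auto
  then have "integrable lborel b" "(LINT x|lborel. b x) = 0"
    using bm by (simp_all add: integral_completion integrable_completion)
  moreover have "b x = 0" if "x \<notin> K" for x using that by (simp add: b_def)
  ultimately show ?thesis using that[OF bm b1 _ ae] by blast
qed

definition mollify :: "(real ^ 'n \<Rightarrow> real) \<Rightarrow> nat \<Rightarrow> real ^ 'n \<Rightarrow> real" where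
  "mollify f k x = (LINT y|lborel. moll k (y - x) * f y)"

lemma moll_shift_lipschitz:
  "(moll_const TYPE('a) * real (Suc k) ^ (DIM('a) + 1))-lipschitz_on UNIV (\<lambda>x. moll k (y - x :: 'a::euclidean_space))"
  "(moll_const TYPE('a) * real (Suc k) ^ (DIM('a) + 1))-lipschitz_on UNIV (\<lambda>x. moll k (x - y :: 'a::euclidean_space))"
proof -
  note l = moll_lipschitz[of k, where 'a = 'a]
  show "(moll_const TYPE('a) * real (Suc k) ^ (DIM('a) + 1))-lipschitz_on UNIV (\<lambda>x. moll k (y - x))"
    using lipschitz_onD[OF l, of "y - _" "y - _"] lipschitz_on_nonneg[OF l]
    by (intro lipschitz_onI) (auto simp: dist_norm norm_minus_commute)
  show "(moll_const TYPE('a) * real (Suc k) ^ (DIM('a) + 1))-lipschitz_on UNIV (\<lambda>x. moll k (x - y))"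
    using lipschitz_onD[OF l, of "_ - y" "_ - y"] lipschitz_on_nonneg[OF l]
    by (intro lipschitz_onI) (auto simp: dist_norm)
qed

lemma mollify_lipschitz:
  fixes f :: "real ^ 'n \<Rightarrow> real"
  assumes f: "integrable lborel f"
  obtains M where "M-lipschitz_on UNIV (mollify f k)"
proof
  let ?C = "moll_const TYPE(real ^ 'n) * real (Suc k) ^ (DIM(real ^ 'n) + 1)"
  show "(?C * (LINT y|lborel. \<bar>f y\<bar>))-lipschitz_on UNIV (mollify f k)"
  proof (rule lipschitz_onI)
    fix x x' :: "real ^ 'n"
    have "mollify f k x - mollify f k x' = (LINT y|lborel. (moll k (y - x) - moll k (y - x')) * f y)"
      unfolding mollify_def using integrable_moll_mult[OF f]
      by (subst Bochner_Integration.integral_diff[symmetric]) (auto simp: algebra_simps)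
    also have "\<bar>\<dots>\<bar> \<le> (LINT y|lborel. ?C * dist x x' * \<bar>f y\<bar>)"
    proof (rule integral_abs_bound_integral)
      show "integrable lborel (\<lambda>y. (moll k (y - x) - moll k (y - x')) * f y)"
        using Bochner_Integration.integrable_diff[OF integrable_moll_mult[OF f, of k x] integrable_moll_mult[OF f, of k x']]
        by (simp add: algebra_simps)
      show "\<bar>(moll k (y - x) - moll k (y - x')) * f y\<bar> \<le> ?C * dist x x' * \<bar>f y\<bar>" for y
        using lipschitz_onD[OF moll_shift_lipschitz(1)[of k y], of x x']
        by (auto simp: abs_mult dist_real_def intro!: mult_right_mono)
    qed (use f in auto)
    finally show "dist (mollify f k x) (mollify f k x') \<le> ?C * (LINT y|lborel. \<bar>f y\<bar>) * dist x x'"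
      by (simp add: dist_real_def mult_ac)
  qed (use moll_const_pos[where 'a = "real ^ 'n"] in \<open>simp add: integral_nonneg_AE\<close>)
qed

text \<open>The kernel depends on \<open>y - x\<close>, so its derivative in \<open>x\<close> is the
  negative of that in \<open>y\<close>, and the latter along a fixed \<open>e\<close> is the
  divergence of the kernel times \<open>e\<close>.\<close>

lemma grad_mollify:
  fixes f :: "real ^ 'n \<Rightarrow> real"
  assumes f: "integrable lborel f" and d: "mollify f k differentiable (at x)"
  shows "grad (mollify f k) x \<bullet> e = - (LINT y|lborel. f y * dv (\<lambda>y. moll k (y - x) *\<^sub>R e) y)"
    and "integrable lborel (\<lambda>y. f y * dv (\<lambda>y. moll k (y - x) *\<^sub>R e) y)"
proof -
  let ?C = "moll_const TYPE(real ^ 'n) * real (Suc k) ^ (DIM(real ^ 'n) + 1)"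
  have [measurable]: "f \<in> borel_measurable borel" using f by (auto dest: borel_measurable_integrable)
  define s where "s n y = (moll k (y - (x + e /\<^sub>R real (Suc n))) - moll k (y - x)) * real (Suc n) * f y" for n y
  have sm: "s n \<in> borel_measurable lborel" for n unfolding s_def by measurable
  have lim: "(\<lambda>n. s n y) \<longlonglongrightarrow> - (f y * dv (\<lambda>y. moll k (y - x) *\<^sub>R e) y)" for y
  proof -
    obtain D where D: "(moll k has_derivative D) (at (y - x))" using moll_differentiable by (auto simp: differentiable_def)
    have "((\<lambda>x. y - x) has_derivative (\<lambda>h. - h)) (at x)" by (auto intro!: derivative_eq_intros)
    from has_derivative_compose[OF this D] have 1: "((\<lambda>x. moll k (y - x)) has_derivative (\<lambda>h. D (- h))) (at x)" .
    have "((\<lambda>y. y - x) has_derivative (\<lambda>h. h)) (at y)" by (auto intro!: derivative_eq_intros)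
    from has_derivative_compose[OF this D] have 2: "((\<lambda>y. moll k (y - x)) has_derivative D) (at y)" .
    have "dv (\<lambda>y. moll k (y - x) *\<^sub>R e) y = (\<Sum>i\<in>UNIV. (D (axis i 1) *\<^sub>R e) $ i)"
      using dv_has_derivative[OF has_derivative_scaleR_left[OF 2, of e]] by simp
    also have "\<dots> = D (\<Sum>i\<in>UNIV. (e $ i) *\<^sub>R axis i 1)"
      using has_derivative_linear[OF D] by (simp add: linear_sum linear_cmul mult.commute)
    also have "(\<Sum>i\<in>UNIV. (e $ i) *\<^sub>R axis i 1) = e"
      by (simp add: basis_expansion flip: scalar_mult_eq_scaleR)
    finally have "D (- e) = - dv (\<lambda>y. moll k (y - x) *\<^sub>R e) y" 
      using has_derivative_linear[OF D] by (simp add: linear_neg)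
    with has_derivative_directional_seq[OF 1, of e]
    have "(\<lambda>n. (moll k (y - (x + e /\<^sub>R real (Suc n))) - moll k (y - x)) * real (Suc n)) \<longlonglongrightarrow> - dv (\<lambda>y. moll k (y - x) *\<^sub>R e) y"
      by simp
    from tendsto_mult[OF this tendsto_const[of "f y"]] show ?thesis unfolding s_def by (simp add: mult.commute)
  qed
  have b: "norm (s n y) \<le> ?C * norm e * norm (f y)" for n y
    unfolding s_def real_norm_def
    unfolding abs_mult[of _ "f y"]
    by (rule mult_right_mono[OF difference_quotient_le[OF moll_shift_lipschitz(1)[of k y], of x n e]]) simp
  have w: "integrable lborel (\<lambda>y. ?C * norm e * norm (f y))" using f by simp
  have m: "(\<lambda>y. - (f y * dv (\<lambda>y. moll k (y - x) *\<^sub>R e) y)) \<in> borel_measurable lborel"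
    by (rule borel_measurable_LIMSEQ_real[OF lim sm])
  have ae: "AE y in lborel. (\<lambda>n. s n y) \<longlonglongrightarrow> - (f y * dv (\<lambda>y. moll k (y - x) *\<^sub>R e) y)"
    "AE y in lborel. norm (s n y) \<le> ?C * norm e * norm (f y)" for n
    using lim b by blast+
  have *: "(\<lambda>n. LINT y|lborel. s n y) \<longlonglongrightarrow> (LINT y|lborel. - (f y * dv (\<lambda>y. moll k (y - x) *\<^sub>R e) y))"
    "integrable lborel (\<lambda>y. - (f y * dv (\<lambda>y. moll k (y - x) *\<^sub>R e) y))"
    by (rule integral_dominated_convergence[OF m sm w ae] integrable_dominated_convergence[OF m sm w ae])+
  then show "integrable lborel (\<lambda>y. f y * dv (\<lambda>y. moll k (y - x) *\<^sub>R e) y)"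
    using Bochner_Integration.integrable_minus by fastforce
  have "(LINT y|lborel. s n y) = (mollify f k (x + e /\<^sub>R real (Suc n)) - mollify f k x) * real (Suc n)" for n
  proof -
    have "s n = (\<lambda>y. real (Suc n) * (moll k (y - (x + e /\<^sub>R real (Suc n))) * f y - moll k (y - x) * f y))"
      unfolding s_def by (simp add: fun_eq_iff algebra_simps)
    then show ?thesis
      unfolding mollify_def using integrable_moll_mult[OF f]
      by (simp only: integral_mult_right_zero Bochner_Integration.integral_diff) (simp only: mult.commute)
  qed
  then have "(\<lambda>n. LINT y|lborel. s n y) \<longlonglongrightarrow> grad (mollify f k) x \<bullet> e"
    using has_derivative_directional_seq[OF grad_has_derivative[OF d], of e] by (simp only:)
  from LIMSEQ_unique[OF this *(1)]
  show "grad (mollify f k) x \<bullet> e = - (LINT y|lborel. f y * dv (\<lambda>y. moll k (y - x) *\<^sub>R e) y)"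
    by simp
qed

lemma cube_subset_ball:
  fixes x :: "'a::euclidean_space"
  assumes "y \<in> cbox x (x + One /\<^sub>R real (Suc k))"
  shows "norm (y - x) \<le> norm (One::'a) / real (Suc k)"
proof -
  have "norm (y - x) \<le> norm (One /\<^sub>R real (Suc k) :: 'a)"
    using assms by (intro norm_le_componentwise) (auto simp: mem_box inner_diff_left inner_add_left)
  then show ?thesis by (simp add: divide_inverse_commute)
qed

definition cubes_inside :: "(real ^ 'n) set \<Rightarrow> nat \<Rightarrow> real ^ 'n \<Rightarrow> bool" where
  "cubes_inside \<Omega> k x \<longleftrightarrow> cbox x (x + One /\<^sub>R real (Suc k)) \<subseteq> \<Omega>"

text \<open>\<open>s \<bullet> \<nabla>z = g\<close> in \<open>\<Omega>\<close>, tested with mollifiers only.\<close>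

definition weak_dirderiv :: "(real ^ 'n) set \<Rightarrow> (real ^ 'n \<Rightarrow> real ^ 'n) \<Rightarrow> (real ^ 'n \<Rightarrow> real) \<Rightarrow> (real ^ 'n \<Rightarrow> real) \<Rightarrow> bool" where
  "weak_dirderiv \<Omega> s z g \<longleftrightarrow> integrable lborel z \<and> integrable lborel g \<and>
    (\<forall>k x. cubes_inside \<Omega> k x \<longrightarrow>
      (LINT y|lborel. moll k (y - x) * g y) = - (LINT y|lebesgue. z y * dv (\<lambda>y. moll k (y - x) *\<^sub>R s y) y))"

text \<open>Nearest-point projection onto a convex set is 1-Lipschitz, so the coefficient field
  extends off the cube with the same constant. The mollifier meets only its values on the
  cube.\<close>

lemma lipschitz_on_cube_extension:
  fixes s :: "'a::euclidean_space \<Rightarrow> 'b::metric_space"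
  assumes "L-lipschitz_on \<Omega> s" "cbox a b \<subseteq> \<Omega>" "cbox a b \<noteq> {}"
  shows "L-lipschitz_on UNIV (\<lambda>y. s (closest_point (cbox a b) y))"
proof (rule lipschitz_onI)
  show "0 \<le> L" by (rule lipschitz_on_nonneg[OF assms(1)])
  fix x y
  let ?p = "closest_point (cbox a b)"
  have "?p x \<in> \<Omega>" "?p y \<in> \<Omega>" using assms closest_point_in_set[of "cbox a b"] by auto
  then have "dist (s (?p x)) (s (?p y)) \<le> L * dist (?p x) (?p y)" by (rule lipschitz_onD[OF assms(1)])
  also have "\<dots> \<le> L * dist x y"
    using assms \<open>0 \<le> L\<close> by (intro mult_left_mono closest_point_lipschitz) auto
  finally show "dist (s (?p x)) (s (?p y)) \<le> L * dist x y" .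
qed

text \<open>Friedrichs' commutator estimate. The difference between \<open>s \<bullet> \<nabla>(mollify z)\<close> and \<open>mollify (s \<bullet> \<nabla>z)\<close> is
  the average of \<open>z\<close> against the divergence of \<open>moll (y - x) (s y - s x)\<close>, which is of the size of the
  mollifier and has mean zero.\<close>

lemma commutator_estimate:
  fixes z g :: "real ^ 'n \<Rightarrow> real"
  assumes zg: "weak_dirderiv \<Omega> s z g" and s: "L-lipschitz_on \<Omega> s"
  defines "C \<equiv> real CARD('n) * (moll_const TYPE(real ^ 'n) * L * (1 + norm (One :: real ^ 'n)))"
  assumes x: "cubes_inside \<Omega> k x" and d: "mollify z k differentiable (at x)"
  shows "ennreal \<bar>grad (mollify z k) x \<bullet> s x - mollify g k x\<bar> \<le> ennreal C * avg_osc z k x"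
proof -
  define Q where "Q = cbox x (x + One /\<^sub>R real (Suc k))"
  let ?c = "moll_const TYPE(real ^ 'n)" and ?m = "real (Suc k)" and ?d = "DIM(real ^ 'n)"
  let ?p = "closest_point Q"
  have c0: "0 \<le> ?c" using moll_const_pos[where 'a = "real ^ 'n"] by simp
  have z: "integrable lborel z" and g: "integrable lborel g"
    and eq: "(LINT y|lborel. moll k (y - x) * g y) = - (LINT y|lebesgue. z y * dv (\<lambda>y. moll k (y - x) *\<^sub>R s y) y)"
    using zg x by (auto simp: weak_dirderiv_def)
  have [measurable]: "z \<in> borel_measurable borel" using z by (auto dest: borel_measurable_integrable)
  have Q: "Q \<subseteq> \<Omega>" "compact Q" "x \<in> Q" using x by (auto simp: Q_def cubes_inside_def mem_box inner_add_left)
  have off: "moll k (y - x) = 0" if "y \<notin> Q" for y using moll_shift_support[of k y x] that by (auto simp: Q_def)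
  have p: "?p y = y" if "y \<in> Q" for y using that by (rule closest_point_self)
  have pQ: "?p y \<in> Q" for y using Q by (intro closest_point_in_set compact_imp_closed) auto
  have lp: "L-lipschitz_on UNIV (\<lambda>y. s (?p y))"
    unfolding Q_def using Q s by (intro lipschitz_on_cube_extension) (auto simp: Q_def)
  have L0: "0 \<le> L" by (rule lipschitz_on_nonneg[OF s])
  have lR: "L-lipschitz_on UNIV (\<lambda>y. s (?p y) - s x)" using lp by (simp add: lipschitz_on_def dist_norm)
  have bR: "norm (s (?p y) - s x) \<le> L * (norm (One :: real ^ 'n) / ?m)" for y
  proof -
    have "norm (s (?p y) - s x) \<le> L * norm (?p y - x)"
      using lipschitz_onD[OF s, of "?p y" x] pQ[of y] Q by (auto simp: dist_norm)
    also have "\<dots> \<le> L * (norm (One :: real ^ 'n) / ?m)"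
      using pQ[of y] L0 by (intro mult_left_mono cube_subset_ball) (auto simp: Q_def)
    finally show ?thesis .
  qed
  have lm: "(?c * ?m ^ (?d + 1))-lipschitz_on UNIV (\<lambda>y. moll k (y - x))" by (rule moll_shift_lipschitz(2))
  have bm: "\<bar>moll k (y - x)\<bar> \<le> ?c * ?m ^ ?d" for y using moll_le[of k "y - x"] moll_nonneg[of k "y - x"] by simp
  \<comment> \<open>\<open>R\<close> is the true test field and \<open>E\<close> has the coefficient
    frozen at \<open>x\<close>; the divergence of their difference \<open>P\<close> is the
    commutator kernel.\<close>
  define P where "P y = moll k (y - x) *\<^sub>R (s (?p y) - s x)" for y
  define R where "R y = moll k (y - x) *\<^sub>R s (?p y)" for y
  define E where "E y = moll k (y - x) *\<^sub>R s x" for y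
  have R: "R = (\<lambda>y. moll k (y - x) *\<^sub>R s y)" unfolding R_def using off p by force
  have PRE: "P = (\<lambda>y. R y - E y)" by (auto simp: P_def R_def E_def scaleR_diff_right)
  \<comment> \<open>The Lipschitz constant of the mollifier has one power of \<open>k + 1\<close>
    too many; the factor \<open>s y - s x\<close>, of order \<open>L / (k + 1)\<close> on the cube,
    takes it back.\<close>
  have lP: "(?c * ?m ^ ?d * L + ?c * ?m ^ (?d + 1) * (L * (norm (One :: real ^ 'n) / ?m)))-lipschitz_on UNIV P"
    unfolding P_def by (rule lipschitz_scaleR[OF lm lR bm bR])
  have K: "?c * ?m ^ ?d * L + ?c * ?m ^ (?d + 1) * (L * (norm (One :: real ^ 'n) / ?m)) = ?c * L * (1 + norm (One :: real ^ 'n)) * ?m ^ ?d"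
    by (simp add: field_simps)
  have CK: "real CARD('n) * (?c * ?m ^ ?d * L + ?c * ?m ^ (?d + 1) * (L * (norm (One :: real ^ 'n) / ?m))) = C * ?m ^ ?d"
    unfolding K C_def by (simp only: mult.assoc)
  have Pz: "P y = 0" if "y \<notin> Q" for y using off[OF that] by (simp add: P_def)
  obtain b where b: "b \<in> borel_measurable borel" "\<And>x. \<bar>b x\<bar> \<le> C * ?m ^ ?d" "\<And>x. x \<notin> Q \<Longrightarrow> b x = 0"
    "AE x in lborel. P differentiable (at x) \<and> b x = dv P x" "integrable lborel b" "(LINT x|lborel. b x) = 0"
    using dv_borel_version[OF lP Q(2) Pz, unfolded CK] by blast
  have dE: "E differentiable (at y)" for y
  proof -
    obtain D where D: "(moll k has_derivative D) (at (y - x))" using moll_differentiable by (auto simp: differentiable_def)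
    have "((\<lambda>y. y - x) has_derivative (\<lambda>h. h)) (at y)" by (auto intro!: derivative_eq_intros)
    from has_derivative_compose[OF this D] have "((\<lambda>y. moll k (y - x)) has_derivative D) (at y)" .
    from has_derivative_scaleR_left[OF this, of "s x"] show ?thesis
      unfolding E_def[abs_def] differentiable_def by blast
  qed
  have "AE y in lborel. dv R y = b y + dv E y"
    using b(4)
  proof eventually_elim
    case (elim y)
    have "R = (\<lambda>y. P y + E y)" by (simp add: PRE)
    then have "R differentiable (at y)" using elim dE[of y] by (auto intro!: differentiable_add)
    from dv_diff[OF this dE] elim show ?case by (simp add: PRE)
  qed
  then have ae: "AE y in lebesgue. z y * dv R y = z y * b y + z y * dv E y"
    by (rule AE_mp[OF AE_completion]) (auto simp: algebra_simps)
  note gm = grad_mollify[OF z d, of "s x", folded E_def]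
  have [measurable]: "b \<in> borel_measurable borel" by (rule b(1))
  have zb: "integrable lborel (\<lambda>y. z y * b y)"
  proof (rule Bochner_Integration.integrable_bound[OF integrable_mult_right[OF z, of "C * ?m ^ ?d"]])
    show "AE y in lborel. norm (z y * b y) \<le> norm (C * ?m ^ ?d * z y)"
    proof (rule AE_I2)
      fix y show "norm (z y * b y) \<le> norm (C * ?m ^ ?d * z y)"
        using b(2)[of y] abs_ge_self[of "C * ?m ^ ?d"]
        by (simp only: real_norm_def abs_mult[of "z y"] abs_mult[of _ "z y"] mult.commute[of _ "\<bar>z y\<bar>"])
          (intro mult_left_mono, auto)
    qed
  qed simp
  have lR': "\<exists>M. M-lipschitz_on UNIV R"
  proof -
    have "norm (s (?p y)) \<le> norm (s x) + L * (norm (One :: real ^ 'n) / ?m)" for y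
      using bR[of y] norm_triangle_ineq2[of "s (?p y)" "s x"] by linarith
    from lipschitz_scaleR[OF lm lp bm this] show ?thesis unfolding R_def by blast
  qed
  then obtain M where lR': "M-lipschitz_on UNIV R" by blast
  have [measurable]: "dv R \<in> borel_measurable lebesgue" by (rule dv_measurable[OF lR'])
  have zl: "z \<in> borel_measurable lebesgue" by (rule measurable_completion) simp
  have "(LINT y|lebesgue. z y * dv R y) = (LINT y|lebesgue. z y * b y + z y * dv E y)"
  proof (rule integral_cong_AE)
    show "(\<lambda>y. z y * dv R y) \<in> borel_measurable lebesgue" using zl by measurable
    show "(\<lambda>y. z y * b y + z y * dv E y) \<in> borel_measurable lebesgue"
      using zb gm(2) by (intro borel_measurable_add measurable_completion) auto
  qed (rule ae)
  also have "\<dots> = (LINT y|lborel. z y * b y + z y * dv E y)"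
    using zb gm(2) by (intro integral_completion borel_measurable_add) auto
  also have "\<dots> = (LINT y|lborel. z y * b y) - grad (mollify z k) x \<bullet> s x"
    using zb gm by simp
  finally have "grad (mollify z k) x \<bullet> s x - mollify g k x = (LINT y|lborel. b y * z y)"
    using eq by (simp add: R mollify_def mult.commute)
  \<comment> \<open>As a divergence of a compactly supported field, \<open>b\<close> has mean zero,
    so the constant \<open>z x\<close> may be subtracted.\<close>
  also have "\<dots> = (LINT y|lborel. b y * (z y - z x))"
    using zb b(5,6) by (simp add: right_diff_distrib mult.commute)
  finally have "ennreal \<bar>grad (mollify z k) x \<bullet> s x - mollify g k x\<bar> = ennreal \<bar>LINT y|lborel. b y * (z y - z x)\<bar>" by simp
  also have "\<dots> \<le> ennreal C * avg_osc z k x"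
  proof (rule kernel_avg_osc[OF z b(1)])
    show "\<And>y. b y \<noteq> 0 \<Longrightarrow> y \<in> cbox x (x + One /\<^sub>R real (Suc k))" using b(3) unfolding Q_def by blast
    show "0 \<le> C" unfolding C_def using c0 L0 by simp
  qed (rule b(2))
  finally show ?thesis .
qed

section \<open>Chain rule for weak directional derivatives\<close>

text \<open>A smooth bounded function of slope at most one in place of a truncation: the chain rule
  is classical wherever the inner Lipschitz function is differentiable.\<close>

definition atan_scaled :: "nat \<Rightarrow> real \<Rightarrow> real" where
  "atan_scaled n t = arctan (real (Suc n) * t) / real (Suc n)"

lemma atan_scaled_bound: "\<bar>atan_scaled n t\<bar> \<le> 2 / real (Suc n)" "\<bar>atan_scaled n t\<bar> \<le> 2"
proof -
  have "\<bar>arctan s\<bar> \<le> 2" for s using arctan_bounded[of s] pi_less_4 by (simp add: abs_le_iff)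
  then show "\<bar>atan_scaled n t\<bar> \<le> 2 / real (Suc n)" unfolding atan_scaled_def abs_divide
    by (simp add: divide_right_mono)
  also have "\<dots> \<le> 2 / 1" by (intro divide_left_mono) auto
  finally show "\<bar>atan_scaled n t\<bar> \<le> 2" by simp
qed

lemma atan_scaled_deriv:
  "(atan_scaled n has_real_derivative 1 / (1 + (real (Suc n) * t)\<^sup>2)) (at t)"
proof -
  have "((\<lambda>t. arctan (m * t) / m) has_real_derivative 1 / (1 + (m * t)\<^sup>2)) (at t)" if "0 < m" for m :: real
  proof (rule DERIV_cong)
    show "((\<lambda>t. arctan (m * t) / m) has_real_derivative inverse (1 + (m * t)\<^sup>2) * m / m) (at t)"
      by (rule DERIV_cdivide, rule DERIV_chain'[of "\<lambda>t. m * t" m _ _ arctan])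
        (auto intro!: derivative_eq_intros DERIV_arctan)
  qed (use that in \<open>simp add: inverse_eq_divide\<close>)
  from this[of "real (Suc n)"] show ?thesis unfolding atan_scaled_def[abs_def] by simp
qed

lemma atan_scaled_deriv_bound: "0 \<le> 1 / (1 + (real (Suc n) * t)\<^sup>2)" "1 / (1 + (real (Suc n) * t)\<^sup>2) \<le> 1"
  by (auto simp: divide_le_eq_1 add_pos_nonneg)

lemma atan_scaled_lipschitz: "1-lipschitz_on UNIV (atan_scaled n)"
proof (rule bounded_derivative_imp_lipschitz)
  show "(atan_scaled n has_derivative (\<lambda>h. 1 / (1 + (real (Suc n) * t)\<^sup>2) * h)) (at t within UNIV)" for t
    using atan_scaled_deriv[of n t] by (simp only: has_field_derivative_def)
  show "onorm (\<lambda>h. 1 / (1 + (real (Suc n) * t)\<^sup>2) * h) \<le> 1" for t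
    using atan_scaled_deriv_bound[of n t]
    by (intro onorm_le) (auto simp only: real_norm_def abs_mult abs_of_nonneg intro!: mult_right_mono)
qed auto

lemma atan_scaled_measurable [measurable]: "atan_scaled n \<in> borel_measurable borel"
  by (intro borel_measurable_continuous_onI lipschitz_on_continuous_on[OF atan_scaled_lipschitz])

lemma lipschitz_compose_UNIV:
  assumes "L-lipschitz_on UNIV f" "M-lipschitz_on UNIV g"
  shows "(L * M)-lipschitz_on UNIV (\<lambda>x. f (g x))"
  using lipschitz_on_compose2[OF assms(2) lipschitz_on_subset[OF assms(1)]] by (simp add: mult.commute)

text \<open>\<open>s\<close> is given on \<open>\<Omega>\<close> only, but the mollifier vanishes
  off a cube inside \<open>\<Omega>\<close>, so \<open>s\<close> may be replaced by its extension
  from that cube.\<close>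

lemma moll_field_lipschitz:
  fixes s :: "real ^ 'n \<Rightarrow> real ^ 'n"
  assumes s: "L-lipschitz_on \<Omega> s" and x: "cubes_inside \<Omega> j x"
  obtains M B where "M-lipschitz_on UNIV (\<lambda>y. moll j (y - x) *\<^sub>R s y)" "\<And>y. norm (moll j (y - x) *\<^sub>R s y) \<le> B"
proof -
  define Q where "Q = cbox x (x + One /\<^sub>R real (Suc j))"
  let ?p = "closest_point Q"
  have Q: "Q \<subseteq> \<Omega>" "compact Q" "x \<in> Q" using x by (auto simp: Q_def cubes_inside_def mem_box inner_add_left)
  have off: "moll j (y - x) = 0" if "y \<notin> Q" for y using moll_shift_support[of j y x] that by (auto simp: Q_def)
  have pQ: "?p y \<in> Q" for y using Q by (intro closest_point_in_set compact_imp_closed) auto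
  have lp: "L-lipschitz_on UNIV (\<lambda>y. s (?p y))"
    unfolding Q_def using Q s by (intro lipschitz_on_cube_extension) (auto simp: Q_def)
  have "compact (s ` Q)"
    using Q lipschitz_on_continuous_on[OF lipschitz_on_subset[OF s Q(1)]] by (intro compact_continuous_image)
  then obtain B where "\<And>y. y \<in> Q \<Longrightarrow> norm (s y) \<le> B" using compact_imp_bounded by (force simp: bounded_iff)
  then have "norm (s (?p y)) \<le> B" for y using pQ by blast
  moreover have "\<bar>moll j (y - x)\<bar> \<le> moll_const TYPE(real ^ 'n) * real (Suc j) ^ DIM(real ^ 'n)" for y
    using moll_le[of j "y - x"] moll_nonneg[of j "y - x"] by simp
  ultimately obtain M where M: "M-lipschitz_on UNIV (\<lambda>y. moll j (y - x) *\<^sub>R s (?p y))"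
    using lipschitz_scaleR[OF moll_shift_lipschitz(2) lp] by blast
  have eq: "(\<lambda>y. moll j (y - x) *\<^sub>R s (?p y)) = (\<lambda>y. moll j (y - x) *\<^sub>R s y)"
  proof
    fix y show "moll j (y - x) *\<^sub>R s (?p y) = moll j (y - x) *\<^sub>R s y"
      using off[of y] closest_point_self[of y Q] by (cases "y \<in> Q") auto
  qed
  have "moll j (y - x) *\<^sub>R s y = 0" if "y \<notin> Q" for y using off[OF that] by simp
  then obtain B' where "\<And>y. norm (moll j (y - x) *\<^sub>R s y) \<le> B'"
    using lipschitz_bounded_if_compact_support[OF M[unfolded eq] Q(2)] by blast
  then show ?thesis using that M[unfolded eq] by blast
qed

lemma mollify_tendsto_AE:
  fixes z :: "real ^ 'n \<Rightarrow> real"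
  assumes z: "integrable lborel z"
  obtains r :: "nat \<Rightarrow> nat" where "strict_mono r" "AE x in lborel. (\<lambda>n. mollify z (r n) x) \<longlonglongrightarrow> z x"
proof -
  let ?c = "ennreal (moll_const TYPE(real ^ 'n))"
  have [measurable]: "z \<in> borel_measurable borel" using z by (auto dest: borel_measurable_integrable)
  have [measurable]: "mollify z k \<in> borel_measurable borel" for k
    using mollify_lipschitz[OF z] by (meson borel_measurable_continuous_onI lipschitz_on_continuous_on)
  have "(\<integral>\<^sup>+x. ennreal \<bar>mollify z k x - z x\<bar> \<partial>lborel) \<le> ?c * (\<integral>\<^sup>+x. avg_osc z k x \<partial>lborel)" for k
  proof -
    have "(\<integral>\<^sup>+x. ennreal \<bar>mollify z k x - z x\<bar> \<partial>lborel) \<le> (\<integral>\<^sup>+x. ?c * avg_osc z k x \<partial>lborel)"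
      unfolding mollify_def by (intro nn_integral_mono moll_average z)
    then show ?thesis by (simp add: nn_integral_cmult)
  qed
  note le = this
  have lim0: "(\<lambda>k. ?c * (\<integral>\<^sup>+x. avg_osc z k x \<partial>lborel)) \<longlonglongrightarrow> ?c * 0"
    by (intro ennreal_tendsto_cmult avg_osc_tendsto_0 z) simp
  have lim: "(\<lambda>k. \<integral>\<^sup>+x. ennreal \<bar>mollify z k x - z x\<bar> \<partial>lborel) \<longlonglongrightarrow> 0"
  proof (rule tendsto_sandwich[where f = "\<lambda>_. 0"])
    show "\<forall>\<^sub>F k in sequentially. (\<integral>\<^sup>+x. ennreal \<bar>mollify z k x - z x\<bar> \<partial>lborel) \<le> ?c * (\<integral>\<^sup>+x. avg_osc z k x \<partial>lborel)"
      using le by (intro always_eventually allI)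
    show "(\<lambda>k. ?c * (\<integral>\<^sup>+x. avg_osc z k x \<partial>lborel)) \<longlonglongrightarrow> 0" using lim0 by simp
  qed auto
  then have "eventually (\<lambda>k. (\<integral>\<^sup>+x. ennreal \<bar>mollify z k x - z x\<bar> \<partial>lborel) < 1) sequentially"
    by (rule order_tendstoD) simp
  \<comment> \<open>Dropping the initial indices guarantees that the error is integrable, which the
    extraction of a subsequence converging almost everywhere requires.\<close>
  then obtain k0 where k0: "\<And>k. k \<ge> k0 \<Longrightarrow> (\<integral>\<^sup>+x. ennreal \<bar>mollify z k x - z x\<bar> \<partial>lborel) < 1"
    by (auto simp: eventually_sequentially)
  define u where "u n x = mollify z (n + k0) x - z x" for n x
  have iu: "integrable lborel (u n)" for n
    unfolding integrable_iff_bounded u_def using less_trans[OF k0[of "n + k0"], of \<infinity>] by simp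
  have "ennreal (LINT x|lborel. norm (u n x)) = (\<integral>\<^sup>+x. ennreal \<bar>mollify z (n + k0) x - z x\<bar> \<partial>lborel)" for n
  proof -
    have "(\<integral>\<^sup>+x. ennreal (norm (u n x)) \<partial>lborel) = ennreal (LINT x|lborel. norm (u n x))"
      using iu[of n] by (intro nn_integral_eq_integral integrable_norm) auto
    then show ?thesis by (simp add: u_def)
  qed
  then have "(\<lambda>n. ennreal (LINT x|lborel. norm (u n x))) \<longlonglongrightarrow> ennreal 0"
    using LIMSEQ_ignore_initial_segment[OF lim, of k0] by simp
  then have "(\<lambda>n. LINT x|lborel. norm (u n x)) \<longlonglongrightarrow> 0"
    by (subst (asm) tendsto_ennreal_iff) (auto intro!: always_eventually integral_nonneg_AE)
  from tendsto_L1_AE_subseq[OF iu this] obtain r :: "nat \<Rightarrow> nat" where r: "strict_mono r" "AE x in lborel. (\<lambda>n. u (r n) x) \<longlonglongrightarrow> 0"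
    by blast
  show thesis
  proof
    show "strict_mono (\<lambda>n. r n + k0)" using r(1) by (simp add: strict_mono_def)
    show "AE x in lborel. (\<lambda>n. mollify z (r n + k0) x) \<longlonglongrightarrow> z x"
      using r(2) by eventually_elim (simp add: u_def LIM_zero_iff)
  qed
qed

text \<open>\<open>mollify z k\<close> is Lipschitz, so the product field is Lipschitz with compact
  support and its divergence has zero integral; product and chain rule hold wherever both factors
  are differentiable.\<close>

lemma integral_chain_mollify:
  fixes z :: "real ^ 'n \<Rightarrow> real"
  assumes z: "integrable lborel z" and P: "M-lipschitz_on UNIV P" "\<And>y. norm (P y) \<le> B"
    and K: "compact K" "\<And>x. x \<notin> K \<Longrightarrow> P x = 0"
  shows "(LINT x|lebesgue. dv (\<lambda>y. atan_scaled n (mollify z k y) *\<^sub>R P y) x) = 0"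
    and "integrable lebesgue (dv (\<lambda>y. atan_scaled n (mollify z k y) *\<^sub>R P y))"
    and "AE x in lebesgue. dv (\<lambda>y. atan_scaled n (mollify z k y) *\<^sub>R P y) x = atan_scaled n (mollify z k x) * dv P x
      + 1 / (1 + (real (Suc n) * mollify z k x)\<^sup>2) * (grad (mollify z k) x \<bullet> P x)"
proof -
  obtain L where L: "L-lipschitz_on UNIV (mollify z k)" using mollify_lipschitz[OF z] .
  have 1: "(1 * L)-lipschitz_on UNIV (\<lambda>y. atan_scaled n (mollify z k y))"
    by (rule lipschitz_compose_UNIV[OF atan_scaled_lipschitz L])
  have 2: "(2 * M + 1 * L * B)-lipschitz_on UNIV (\<lambda>y. atan_scaled n (mollify z k y) *\<^sub>R P y)"
    by (rule lipschitz_scaleR[OF 1 P(1) _ P(2)]) (rule atan_scaled_bound)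
  have z: "atan_scaled n (mollify z k y) *\<^sub>R P y = 0" if "y \<notin> K" for y using K(2)[OF that] by simp
  show "(LINT x|lebesgue. dv (\<lambda>y. atan_scaled n (mollify z k y) *\<^sub>R P y) x) = 0"
    "integrable lebesgue (dv (\<lambda>y. atan_scaled n (mollify z k y) *\<^sub>R P y))"
    using integral_dv[OF 2 K(1) z] by auto
  show "AE x in lebesgue. dv (\<lambda>y. atan_scaled n (mollify z k y) *\<^sub>R P y) x = atan_scaled n (mollify z k x) * dv P x
      + 1 / (1 + (real (Suc n) * mollify z k x)\<^sup>2) * (grad (mollify z k) x \<bullet> P x)"
    using Rademacher_lebesgue[OF L] lipschitz_differentiable_AE[OF P(1)]
  proof eventually_elim
    case (elim x)
    let ?c = "1 / (1 + (real (Suc n) * mollify z k x)\<^sup>2)"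
    have "((\<lambda>y. atan_scaled n (mollify z k y)) has_derivative (\<lambda>h. ?c * (grad (mollify z k) x \<bullet> h))) (at x)"
      using has_derivative_compose[OF grad_has_derivative[OF elim(1)], of "atan_scaled n" "(*) ?c"]
        atan_scaled_deriv[of n "mollify z k x"] by (simp only: has_field_derivative_def)
    then have d: "((\<lambda>y. atan_scaled n (mollify z k y)) has_derivative (\<lambda>h. (?c *\<^sub>R grad (mollify z k) x) \<bullet> h)) (at x)"
      by (simp only: inner_scaleR_left)
    then have "(\<lambda>y. atan_scaled n (mollify z k y)) differentiable (at x)" unfolding differentiable_def by blast
    from dv_scaleR[OF this elim(2)] show ?case by (simp only: grad_eqI[OF d] inner_scaleR_left)
  qed
qed

lemma cubes_inside_uniform:
  assumes "open \<Omega>" "compact K" "K \<subseteq> \<Omega>"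
  shows "eventually (\<lambda>k. \<forall>y\<in>K. cubes_inside \<Omega> k y) sequentially"
proof -
  obtain d where d: "0 < d" "\<And>x y. x \<in> K \<Longrightarrow> dist x y < d \<Longrightarrow> y \<in> \<Omega>"
  proof -
    have "closed (- \<Omega>)" "K \<inter> (- \<Omega>) = {}" using assms by auto
    then obtain d where "d > 0" "\<forall>x\<in>K. \<forall>y\<in>-\<Omega>. d \<le> dist x y"
      using separate_compact_closed[OF assms(2)] by metis
    then show ?thesis by (intro that[of d]) force+
  qed
  have "(\<lambda>k. norm (One :: real ^ 'a) / real (Suc k)) \<longlonglongrightarrow> 0" by (intro lim_const_over_n LIMSEQ_Suc)
  then have "eventually (\<lambda>k. norm (One :: real ^ 'a) / real (Suc k) < d) sequentially"
    using d(1) by (rule order_tendstoD)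
  then show ?thesis
  proof eventually_elim
    case (elim k)
    show ?case unfolding cubes_inside_def
    proof (intro ballI subsetI)
      fix y x assume "y \<in> K" "x \<in> cbox y (y + One /\<^sub>R real (Suc k))"
      then show "x \<in> \<Omega>" using d(2)[of y x] cube_subset_ball[of x y k] elim
        by (simp add: dist_norm norm_minus_commute)
    qed
  qed
qed

text \<open>The chain rule holds for \<open>mollify z k\<close>, and by the commutator estimate \<open>s \<bullet> \<nabla>(mollify z k)\<close> tends to \<open>g\<close> in \<open>L\<^sup>1\<close>.\<close>

lemma weak_dirderiv_chain:
  fixes z g :: "real ^ 'n \<Rightarrow> real"
  assumes zg: "weak_dirderiv \<Omega> s z g" and s: "L-lipschitz_on \<Omega> s" and \<Omega>: "open \<Omega>"
    and x: "cubes_inside \<Omega> j x"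
    and b: "b \<in> borel_measurable borel" "\<And>y. \<bar>b y\<bar> \<le> c" "integrable lborel b"
      "AE y in lborel. b y = dv (\<lambda>y. moll j (y - x) *\<^sub>R s y) y"
  shows "(LINT y|lborel. atan_scaled n (z y) * b y + 1 / (1 + (real (Suc n) * z y)\<^sup>2) * (moll j (y - x) * g y)) = 0"
proof -
  let ?\<psi> = "\<lambda>t. 1 / (1 + (real (Suc n) * t)\<^sup>2)"
  have z: "integrable lborel z" and g: "integrable lborel g" using zg by (auto simp: weak_dirderiv_def)
  have [measurable]: "z \<in> borel_measurable borel" "g \<in> borel_measurable borel" "b \<in> borel_measurable borel"
    using z g b(1) by (auto dest: borel_measurable_integrable)
  define P where "P y = moll j (y - x) *\<^sub>R s y" for y
  define Q where "Q = cbox x (x + One /\<^sub>R real (Suc j))"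
  have Q: "compact Q" "Q \<subseteq> \<Omega>" using x by (auto simp: Q_def cubes_inside_def)
  have off: "moll j (y - x) = 0" if "y \<notin> Q" for y using moll_shift_support[of j y x] that by (auto simp: Q_def)
  have Pz: "P y = 0" if "y \<notin> Q" for y using off[OF that] by (simp add: P_def)
  obtain M B where MB: "M-lipschitz_on UNIV P" "\<And>y. norm (P y) \<le> B"
    using moll_field_lipschitz[OF s x] unfolding P_def[abs_def] by blast
  define m where "m = moll_const TYPE(real ^ 'n) * real (Suc j) ^ DIM(real ^ 'n)"
  have m: "0 \<le> moll j (y - x)" "moll j (y - x) \<le> m" for y using moll_le[of j "y - x"] moll_nonneg[of j "y - x"] by (auto simp: m_def)
  have m0: "0 \<le> m" using m[of x] by linarith
  let ?Z = "mollify z"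
  have Zm [measurable]: "?Z k \<in> borel_measurable borel" "mollify g k \<in> borel_measurable borel" for k
    using mollify_lipschitz[OF z, of k] mollify_lipschitz[OF g, of k]
    by (meson borel_measurable_continuous_onI lipschitz_on_continuous_on)+
  define h where "h k = dv (\<lambda>y. atan_scaled n (?Z k y) *\<^sub>R P y)" for k
  \<comment> \<open>\<open>h k\<close> with the directional derivative of the mollification replaced
    by its expected limit \<open>g\<close> and the divergence by its Borel version. The difference
    is controlled by the averaging errors of \<open>z\<close> and \<open>g\<close>.\<close>
  define h' where "h' k y = atan_scaled n (?Z k y) * b y + ?\<psi> (?Z k y) * (moll j (y - x) * g y)" for k y
  define h0 where "h0 y = atan_scaled n (z y) * b y + ?\<psi> (z y) * (moll j (y - x) * g y)" for y
  have h'm [measurable]: "h' k \<in> borel_measurable borel" for k unfolding h'_def by measurable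
  have h0m [measurable]: "h0 \<in> borel_measurable borel" unfolding h0_def by measurable
  have ch: "(LINT x|lebesgue. h k x) = 0" "integrable lebesgue (h k)"
    "AE x in lebesgue. h k x = atan_scaled n (?Z k x) * dv P x + ?\<psi> (?Z k x) * (grad (?Z k) x \<bullet> P x)" for k
    unfolding h_def using integral_chain_mollify[OF z MB Q(1), of n k] Pz by auto
  define C where "C = real CARD('n) * (moll_const TYPE(real ^ 'n) * L * (1 + norm (One :: real ^ 'n)))"
  define w where "w = (\<lambda>y. 2 * norm (b y) + m * norm (g y))"
  have wi: "integrable lborel w" unfolding w_def using b(3) g by simp
  have bound: "\<bar>atan_scaled n t * b y + ?\<psi> t * (moll j (y - x) * g y)\<bar> \<le> w y" for t y
  proof -
    have "\<bar>atan_scaled n t * b y\<bar> \<le> 2 * \<bar>b y\<bar>"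
      unfolding abs_mult by (intro mult_right_mono atan_scaled_bound) simp
    moreover have "\<bar>?\<psi> t * (moll j (y - x) * g y)\<bar> \<le> 1 * (m * \<bar>g y\<bar>)"
      unfolding abs_mult using atan_scaled_deriv_bound[of n t] m[of y] m0
      by (intro mult_mono) (auto simp only: abs_of_nonneg abs_ge_zero mult_nonneg_nonneg)
    ultimately show ?thesis unfolding w_def real_norm_def by linarith
  qed
  have h'i: "integrable lborel (h' k)" for k
    using bound by (intro Bochner_Integration.integrable_bound[OF wi]) (auto simp: h'_def intro!: AE_I2 order_trans[OF _ abs_ge_self])
  obtain r :: "nat \<Rightarrow> nat" where r: "strict_mono r" "AE y in lborel. (\<lambda>k. ?Z (r k) y) \<longlonglongrightarrow> z y"
    using mollify_tendsto_AE[OF z] .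
  have "(\<lambda>k. LINT y|lborel. h' (r k) y) \<longlonglongrightarrow> (LINT y|lborel. h0 y)"
  proof (rule integral_dominated_convergence[where w = w])
    show "AE y in lborel. (\<lambda>k. h' (r k) y) \<longlonglongrightarrow> h0 y"
      using r(2)
    proof eventually_elim
      case (elim y)
      have "continuous_on UNIV (atan_scaled n)" by (rule lipschitz_on_continuous_on[OF atan_scaled_lipschitz])
      from continuous_on_tendsto_compose[OF this elim]
      have 1: "(\<lambda>k. atan_scaled n (?Z (r k) y)) \<longlonglongrightarrow> atan_scaled n (z y)" by simp
      have 2: "(\<lambda>k. ?\<psi> (?Z (r k) y)) \<longlonglongrightarrow> ?\<psi> (z y)"
        by (intro tendsto_intros elim) (auto simp: add_nonneg_eq_0_iff)
      show ?case unfolding h'_def h0_def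
        by (rule tendsto_add[OF tendsto_mult[OF 1 tendsto_const] tendsto_mult[OF 2 tendsto_const]])
    qed
    show "AE y in lborel. norm (h' (r k) y) \<le> w y" for k using bound by (auto simp: h'_def)
  qed (auto intro: wi)
  moreover have "(\<lambda>k. LINT y|lborel. h' k y) \<longlonglongrightarrow> 0"
  proof -
    define e where "e k = ennreal m * (ennreal C * (\<integral>\<^sup>+y. avg_osc z k y \<partial>lborel)
        + ennreal (moll_const TYPE(real ^ 'n)) * (\<integral>\<^sup>+y. avg_osc g k y \<partial>lborel))" for k
    have "e \<longlonglongrightarrow> ennreal m * (ennreal C * 0 + ennreal (moll_const TYPE(real ^ 'n)) * 0)"
      unfolding e_def[abs_def] by (intro ennreal_tendsto_cmult tendsto_add avg_osc_tendsto_0 z g) auto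
    then have e0: "e \<longlonglongrightarrow> 0" by simp
    \<comment> \<open>For large \<open>k\<close> only: the commutator estimate at \<open>y\<close>
      asks for the cube at \<open>y\<close> to lie in \<open>\<Omega>\<close>, and this must hold
      for all \<open>y\<close> in the compact \<open>Q\<close>.\<close>
    have "eventually (\<lambda>k. ennreal \<bar>LINT y|lborel. h' k y\<bar> \<le> e k) sequentially"
      using cubes_inside_uniform[OF \<Omega> Q]
    proof eventually_elim
      case (elim k)
      obtain L' where L': "L'-lipschitz_on UNIV (?Z k)" using mollify_lipschitz[OF z] .
      have hm: "h k \<in> borel_measurable lebesgue" using ch(2) by (rule borel_measurable_integrable)
      have h'l: "h' k \<in> borel_measurable lebesgue" by (rule measurable_completion) simp
      have h'li: "integrable lebesgue (h' k)" using h'i by (simp add: integrable_completion)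
      have "AE y in lebesgue. ennreal \<bar>h k y - h' k y\<bar> \<le> ennreal m * (ennreal C * avg_osc z k y
          + ennreal (moll_const TYPE(real ^ 'n)) * avg_osc g k y)"
        using ch(3)[of k] AE_completion[OF b(4)] Rademacher_lebesgue[OF L']
      proof eventually_elim
        case (elim y)
        let ?D = "grad (?Z k) y \<bullet> s y"
        have "h k y - h' k y = ?\<psi> (?Z k y) * (moll j (y - x) * (?D - g y))"
          using elim by (simp add: h'_def P_def[abs_def] algebra_simps diff_divide_distrib)
        then have le: "\<bar>h k y - h' k y\<bar> \<le> 1 * (moll j (y - x) * \<bar>?D - g y\<bar>)"
          unfolding abs_mult using atan_scaled_deriv_bound[of n "?Z k y"] m[of y]
          by (simp only: abs_mult abs_of_nonneg) (intro mult_right_mono mult_nonneg_nonneg abs_ge_zero)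
        show ?case
        proof (cases "y \<in> Q")
          case True
          have 1: "ennreal \<bar>?D - mollify g k y\<bar> \<le> ennreal C * avg_osc z k y"
            unfolding C_def using \<open>\<forall>y\<in>Q. cubes_inside \<Omega> k y\<close> True elim(3) by (intro commutator_estimate[OF zg s]) auto
          have 2: "ennreal \<bar>mollify g k y - g y\<bar> \<le> ennreal (moll_const TYPE(real ^ 'n)) * avg_osc g k y"
            unfolding mollify_def by (rule moll_average[OF g])
          have "ennreal \<bar>h k y - h' k y\<bar> \<le> ennreal (m * (\<bar>?D - mollify g k y\<bar> + \<bar>mollify g k y - g y\<bar>))"
          proof (rule ennreal_leI)
            have "moll j (y - x) * \<bar>?D - g y\<bar> \<le> m * (\<bar>?D - mollify g k y\<bar> + \<bar>mollify g k y - g y\<bar>)"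
              using m[of y] m0 by (intro mult_mono) auto
            then show "\<bar>h k y - h' k y\<bar> \<le> m * (\<bar>?D - mollify g k y\<bar> + \<bar>mollify g k y - g y\<bar>)" using le by linarith
          qed
          also have "\<dots> = ennreal m * (ennreal \<bar>?D - mollify g k y\<bar> + ennreal \<bar>mollify g k y - g y\<bar>)"
            using m0 by (simp add: ennreal_mult)
          also have "\<dots> \<le> ennreal m * (ennreal C * avg_osc z k y
            + ennreal (moll_const TYPE(real ^ 'n)) * avg_osc g k y)"
            using 1 2 by (intro mult_left_mono add_mono) auto
          finally show ?thesis .
        next
          case False
          then show ?thesis using le off[OF False] by simp
        qed
      qed
      then have "(\<integral>\<^sup>+y. ennreal \<bar>h k y - h' k y\<bar> \<partial>lebesgue) \<le> (\<integral>\<^sup>+y. ennreal m * (ennreal C * avg_osc z k y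
          + ennreal (moll_const TYPE(real ^ 'n)) * avg_osc g k y) \<partial>lebesgue)"
        by (rule nn_integral_mono_AE)
      also have "\<dots> = e k" unfolding e_def
        by (subst nn_integral_completion) (auto simp: nn_integral_cmult nn_integral_add)
      finally have le: "(\<integral>\<^sup>+y. ennreal \<bar>h k y - h' k y\<bar> \<partial>lebesgue) \<le> e k" .
      have "(LINT y|lborel. h' k y) = (LINT y|lebesgue. h' k y)" by (simp add: integral_completion)
      also have "\<dots> = - (LINT y|lebesgue. h k y - h' k y)" using ch(1,2)[of k] h'li by simp
      finally have "ennreal \<bar>LINT y|lborel. h' k y\<bar> = ennreal (norm (LINT y|lebesgue. h k y - h' k y))" by simp
      also have "\<dots> \<le> (\<integral>\<^sup>+y. ennreal (norm (h k y - h' k y)) \<partial>lebesgue)"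
        using ch(2)[of k] h'li by (intro integral_norm_bound_ennreal) auto
      also have "\<dots> \<le> e k" using le by simp
      finally show ?case .
    qed
    from tendsto_sandwich[OF _ this tendsto_const e0]
    have "(\<lambda>k. ennreal \<bar>LINT y|lborel. h' k y\<bar>) \<longlonglongrightarrow> 0" by simp
    then have "(\<lambda>k. ennreal \<bar>LINT y|lborel. h' k y\<bar>) \<longlonglongrightarrow> ennreal 0" by simp
    then have "(\<lambda>k. \<bar>LINT y|lborel. h' k y\<bar>) \<longlonglongrightarrow> 0" by (rule tendsto_ennrealD) auto
    then show ?thesis by (rule tendsto_rabs_zero_cancel)
  qed
  \<comment> \<open>The whole sequence tends to zero, while its limit was identified along the
    subsequence \<open>r\<close> of almost everywhere convergence.\<close>
  then have "(\<lambda>k. LINT y|lborel. h' (r k) y) \<longlonglongrightarrow> 0"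
    using LIMSEQ_subseq_LIMSEQ[OF _ r(1)] by (auto simp: o_def)
  ultimately have "(LINT y|lborel. h0 y) = 0" by (metis LIMSEQ_unique)
  then show ?thesis by (simp only: h0_def)
qed

text \<open>As \<open>n\<close> grows, \<open>atan_scaled n\<close> tends to \<open>0\<close> while its derivative tends to the indicator of \<open>{0}\<close>, so the
  chain rule leaves \<open>g\<close> restricted to \<open>{z = 0}\<close> with vanishing averages.\<close>

theorem weak_dirderiv_locality:
  fixes z g :: "real ^ 'n \<Rightarrow> real"
  assumes zg: "weak_dirderiv \<Omega> s z g" and s: "L-lipschitz_on \<Omega> s" and \<Omega>: "open \<Omega>"
  shows "AE x in lborel. x \<in> \<Omega> \<longrightarrow> z x = 0 \<longrightarrow> g x = 0"
proof -
  have z: "integrable lborel z" and g: "integrable lborel g" using zg by (auto simp: weak_dirderiv_def)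
  have [measurable]: "z \<in> borel_measurable borel" "g \<in> borel_measurable borel"
    using z g by (auto dest: borel_measurable_integrable)
  define f where "f y = (if z y = 0 then g y else 0)" for y
  have [measurable]: "f \<in> borel_measurable borel" unfolding f_def[abs_def] by measurable
  have fi: "integrable lborel f" by (rule Bochner_Integration.integrable_bound[OF g]) (auto simp: f_def)
  have main: "(LINT y|lborel. moll j (y - x) * f y) = 0" if x: "cubes_inside \<Omega> j x" for j x
  proof -
    define P where "P y = moll j (y - x) *\<^sub>R s y" for y
    define Q where "Q = cbox x (x + One /\<^sub>R real (Suc j))"
    have Q: "compact Q" by (simp add: Q_def)
    have Pz: "P y = 0" if "y \<notin> Q" for y using moll_shift_support[of j y x] that by (auto simp: Q_def P_def)
    obtain M B where MB: "M-lipschitz_on UNIV P" "\<And>y. norm (P y) \<le> B"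
      using moll_field_lipschitz[OF s x] unfolding P_def[abs_def] by blast
    obtain b where b: "b \<in> borel_measurable borel" "\<And>x. \<bar>b x\<bar> \<le> real CARD('n) * M"
      "AE x in lborel. P differentiable (at x) \<and> b x = dv P x" "integrable lborel b"
      by (rule dv_borel_version[OF MB(1) Q Pz]) (assumption, rule that)
    have b3: "AE x in lborel. b x = dv P x" using b(3) by eventually_elim simp
    define m where "m = moll_const TYPE(real ^ 'n) * real (Suc j) ^ DIM(real ^ 'n)"
    have m: "0 \<le> moll j (y - x)" "moll j (y - x) \<le> m" for y using moll_le[of j "y - x"] moll_nonneg[of j "y - x"] by (auto simp: m_def)
    have [measurable]: "b \<in> borel_measurable borel" by (rule b(1))
    define h where "h n y = atan_scaled n (z y) * b y + 1 / (1 + (real (Suc n) * z y)\<^sup>2) * (moll j (y - x) * g y)" for n y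
    have "(\<lambda>n. LINT y|lborel. h n y) \<longlonglongrightarrow> (LINT y|lborel. moll j (y - x) * f y)"
    proof (rule integral_dominated_convergence[where w = "\<lambda>y. 2 * norm (b y) + m * norm (g y)"])
      show "integrable lborel (\<lambda>y. 2 * norm (b y) + m * norm (g y))" using b(4) g by simp
      show "h n \<in> borel_measurable lborel" for n unfolding h_def by measurable
      show "AE y in lborel. (\<lambda>n. h n y) \<longlonglongrightarrow> moll j (y - x) * f y"
      proof (rule AE_I2)
        fix y
        have 1: "(\<lambda>n. atan_scaled n (z y)) \<longlonglongrightarrow> 0"
        proof (rule Lim_null_comparison)
          show "eventually (\<lambda>n. norm (atan_scaled n (z y)) \<le> 2 / real (Suc n)) sequentially"
            unfolding real_norm_def by (intro always_eventually allI atan_scaled_bound)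
          show "(\<lambda>n. 2 / real (Suc n)) \<longlonglongrightarrow> 0" by (intro lim_const_over_n LIMSEQ_Suc)
        qed
        have 2: "(\<lambda>n. 1 / (1 + (real (Suc n) * z y)\<^sup>2)) \<longlonglongrightarrow> (if z y = 0 then 1 else 0)"
        proof (cases "z y = 0")
          case False
          then have "0 < \<bar>z y\<bar>" by simp
          then have "(\<lambda>n. 1 / (1 + (real (Suc n) * \<bar>z y\<bar>)\<^sup>2)) \<longlonglongrightarrow> 0" by real_asymp
          then show ?thesis using False by (simp add: power_mult_distrib)
        qed simp
        have "(\<lambda>n. h n y) \<longlonglongrightarrow> 0 * b y + (if z y = 0 then 1 else 0) * (moll j (y - x) * g y)"
          unfolding h_def by (rule tendsto_add[OF tendsto_mult[OF 1 tendsto_const] tendsto_mult[OF 2 tendsto_const]])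
        then show "(\<lambda>n. h n y) \<longlonglongrightarrow> moll j (y - x) * f y" by (cases "z y = 0") (auto simp: f_def)
      qed
      show "AE y in lborel. norm (h n y) \<le> 2 * norm (b y) + m * norm (g y)" for n
      proof (rule AE_I2)
        fix y
        have "\<bar>atan_scaled n (z y) * b y\<bar> \<le> 2 * \<bar>b y\<bar>"
          unfolding abs_mult by (intro mult_right_mono atan_scaled_bound) simp
        moreover have "\<bar>1 / (1 + (real (Suc n) * z y)\<^sup>2) * (moll j (y - x) * g y)\<bar> \<le> 1 * (m * \<bar>g y\<bar>)"
          unfolding abs_mult using atan_scaled_deriv_bound[of n "z y"] m[of y]
          by (intro mult_mono) (auto simp only: abs_of_nonneg abs_ge_zero mult_nonneg_nonneg)
        ultimately show "norm (h n y) \<le> 2 * norm (b y) + m * norm (g y)" unfolding h_def real_norm_def by linarith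
      qed
    qed measurable
    moreover have "(LINT y|lborel. h n y) = 0" for n
      unfolding h_def by (rule weak_dirderiv_chain[OF zg s \<Omega> x b(1,2,4) b3[unfolded P_def]])
    ultimately show ?thesis using LIMSEQ_unique[of "\<lambda>n::nat. 0::real" 0] by simp
  qed
  \<comment> \<open>The points at distance at least \<open>\<rho>\<close> from the complement. These
    closed sets exhaust the open \<open>\<Omega>\<close>, and over each of them all sufficiently
    small cubes stay inside \<open>\<Omega>\<close>.\<close>
  define T where "T \<rho> = (\<Inter>y\<in>-\<Omega>. - ball y \<rho>)" for \<rho>
  have "AE x in lborel. x \<in> T (1 / real (Suc i)) \<longrightarrow> f x = 0" for i
  proof -
    let ?\<rho> = "1 / real (Suc i)"
    have "closed (T ?\<rho>)" unfolding T_def by (intro closed_INT) auto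
    then have Tb: "T ?\<rho> \<in> sets borel" by simp
    have "(\<lambda>k. norm (One :: real ^ 'n) / real (Suc k)) \<longlonglongrightarrow> 0" by (intro lim_const_over_n LIMSEQ_Suc)
    then have "eventually (\<lambda>k. norm (One :: real ^ 'n) / real (Suc k) < ?\<rho>) sequentially" by (rule order_tendstoD) simp
    then obtain k0 where k0: "\<And>k. k \<ge> k0 \<Longrightarrow> norm (One :: real ^ 'n) / real (Suc k) < ?\<rho>"
      by (auto simp: eventually_sequentially)
    have "cubes_inside \<Omega> k x" if "k \<ge> k0" "x \<in> T ?\<rho>" for k x
      unfolding cubes_inside_def
    proof
      fix y assume "y \<in> cbox x (x + One /\<^sub>R real (Suc k))"
      then have "dist x y < ?\<rho>" using cube_subset_ball[of y x k] k0[OF that(1)] by (simp add: dist_norm norm_minus_commute)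
      then show "y \<in> \<Omega>" using that(2) unfolding T_def by (force simp: dist_commute)
    qed
    then show ?thesis using main by (intro fundamental_lemma_moll[OF fi Tb, of k0]) auto
  qed
  then have "AE x in lborel. \<forall>i::nat. x \<in> T (1 / real (Suc i)) \<longrightarrow> f x = 0" unfolding AE_all_countable by (rule allI)
  then show ?thesis
  proof eventually_elim
    case (elim x)
    show ?case
    proof (intro impI)
      assume x: "x \<in> \<Omega>" "z x = 0"
      obtain e where e: "0 < e" "ball x e \<subseteq> \<Omega>" using \<Omega> x(1) open_contains_ball by blast
      obtain i where i: "1 / real (Suc i) < e" using e(1) nat_approx_posE by blast
      have "e \<le> dist x y" if "y \<notin> \<Omega>" for y using that e(2) by (auto simp: subset_eq not_less)
      then have "x \<in> T (1 / real (Suc i))" using i by (force simp: T_def dist_commute)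
      then show "g x = 0" using elim x(2) by (auto simp: f_def)
    qed
  qed
qed

section \<open>From weak gradients to weak directional derivatives\<close>

text \<open>Mollification is set up for Borel functions on the whole space; this is the extension by
  zero, up to a null set.\<close>

lemma integrable_lebesgue_on_borel_version:
  fixes f :: "'a::euclidean_space \<Rightarrow> real"
  assumes f: "integrable (lebesgue_on S) f" and S: "S \<in> sets borel"
  obtains g where "integrable lborel g" "\<And>x. x \<notin> S \<Longrightarrow> g x = 0" "AE x in lebesgue_on S. f x = g x"
proof -
  have Sl: "S \<in> sets lebesgue" using S by (simp add: sets_completionI_sets)
  have i: "integrable lebesgue (\<lambda>x. indicator S x *\<^sub>R f x)"
    using f Sl by (simp add: integrable_restrict_space)
  obtain h where h: "h \<in> borel_measurable lborel" "AE x in lborel. indicator S x *\<^sub>R f x = h x"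
    using completion_ex_borel_measurable_real[OF borel_measurable_integrable[OF i]] by blast
  have [measurable]: "h \<in> borel_measurable borel" "S \<in> sets borel" using h S by auto
  define g where "g x = indicator S x * h x" for x
  have gm: "g \<in> borel_measurable lborel" unfolding g_def by measurable
  have ae: "AE x in lborel. indicator S x *\<^sub>R f x = g x" using h(2) by eventually_elim (auto simp: g_def indicator_def)
  have "integrable lebesgue g"
    using i by (rule integrable_cong_AE_imp) (use gm AE_completion[OF ae] in \<open>auto intro: measurable_completion simp: eq_commute\<close>)
  then have "integrable lborel g" using gm by (simp add: integrable_completion)
  moreover have "AE x in lebesgue_on S. f x = g x"
    unfolding AE_lebesgue_on_iff[OF Sl] using AE_completion[OF ae] by eventually_elim (auto simp: indicator_def)
  ultimately show ?thesis using that[of g] by (simp add: g_def)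
qed

lemma L2_integrable:
  fixes f :: "real ^ 'n \<Rightarrow> 'b::euclidean_space"
  assumes f: "f \<in> L2 \<Omega>" and \<Omega>: "bounded \<Omega>" "\<Omega> \<in> sets lebesgue"
  shows "integrable (lebesgue_on \<Omega>) f"
proof -
  have "\<Omega> \<in> lmeasurable" using \<Omega> by (simp add: bounded_set_imp_lmeasurable)
  then have 1: "integrable (lebesgue_on \<Omega>) (\<lambda>x. 1 :: real)" using finite_measure.integrable_const[OF finite_measure_lebesgue_on] by blast
  show ?thesis
  proof (rule Bochner_Integration.integrable_bound)
    show "integrable (lebesgue_on \<Omega>) (\<lambda>x. 1 + (norm (f x))\<^sup>2)" using 1 f by (auto simp: L2_def)
    have "t \<le> 1 + t\<^sup>2" for t :: real using sum_squares_ge_zero[of "t - 1/2" "0"] by (simp add: power2_eq_square algebra_simps)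
    then show "AE x in lebesgue_on \<Omega>. norm (f x) \<le> norm (1 + (norm (f x))\<^sup>2)"
      by (intro AE_I2) (auto simp: add_nonneg_nonneg abs_of_nonneg)
  qed (use f in \<open>auto simp: L2_def\<close>)
qed

text \<open>The test field with the mollifier as its \<open>i\<close>-th component turns
  \<open>div_A\<close> into the divergence of the mollifier times the \<open>i\<close>-th column of
  the square root, so component \<open>i\<close> of \<open>G\<close> is the weak derivative of
  \<open>u\<close> along that column.\<close>

lemma is_weak_grad_imp_weak_dirderiv:
  assumes \<Omega>: "open \<Omega>" "bounded \<Omega>" and psd: "\<forall>x\<in>\<Omega>. sym_psd (A x)"
    and s: "L-lipschitz_on \<Omega> (\<lambda>y. mat_sqrt (A y) *v axis i 1)"
    and u: "u \<in> L2 \<Omega>" and G: "is_weak_grad \<Omega> A u G"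
  obtains z g where "weak_dirderiv \<Omega> (\<lambda>y. mat_sqrt (A y) *v axis i 1) z g"
    "AE x in lebesgue_on \<Omega>. u x = z x" "AE x in lebesgue_on \<Omega>. G x $ i = g x"
proof -
  let ?s = "\<lambda>y. mat_sqrt (A y) *v axis i 1"
  let ?M = "lebesgue_on \<Omega>"
  have \<Omega>b: "\<Omega> \<in> sets borel" and \<Omega>l: "\<Omega> \<in> sets lebesgue" using \<Omega> by (auto intro: sets_completionI_sets)
  have GL: "G \<in> L2 \<Omega>" using G by (simp add: is_weak_grad_def)
  have Gi: "integrable ?M G" by (rule L2_integrable[OF GL \<Omega>(2) \<Omega>l])
  have Gi': "integrable ?M (\<lambda>x. G x $ i)"
    using integrable_inner_left[OF Gi, of "axis i 1"] by (simp add: inner_axis)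
  obtain z where z: "integrable lborel z" "\<And>x. x \<notin> \<Omega> \<Longrightarrow> z x = 0" "AE x in ?M. u x = z x"
    using integrable_lebesgue_on_borel_version[OF L2_integrable[OF u \<Omega>(2) \<Omega>l] \<Omega>b] by blast
  obtain g where g: "integrable lborel g" "\<And>x. x \<notin> \<Omega> \<Longrightarrow> g x = 0" "AE x in ?M. G x $ i = g x"
    using integrable_lebesgue_on_borel_version[OF Gi' \<Omega>b] by blast
  have zm: "z \<in> borel_measurable lebesgue" and gm: "g \<in> borel_measurable lebesgue"
    using z(1) g(1) by (auto intro: measurable_completion dest: borel_measurable_integrable)
  have um: "u \<in> borel_measurable ?M" using u by (simp add: L2_def)
  have "(LINT y|lborel. moll k (y - x) * g y) = - (LINT y|lebesgue. z y * dv (\<lambda>y. moll k (y - x) *\<^sub>R ?s y) y)"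
    if x: "cubes_inside \<Omega> k x" for k x
  proof -
    define Q where "Q = cbox x (x + One /\<^sub>R real (Suc k))"
    have Q: "compact Q" "Q \<subseteq> \<Omega>" using x by (auto simp: Q_def cubes_inside_def)
    have off: "moll k (y - x) = 0" if "y \<notin> Q" for y using moll_shift_support[of k y x] that by (auto simp: Q_def)
    define V where "V y = moll k (y - x) *\<^sub>R axis i (1::real)" for y
    have "(\<lambda>y. V y $ j) \<in> Lip_c \<Omega>" for j
    proof (cases "j = i")
      case True
      have "(\<lambda>y. moll k (y - x)) \<in> Lip_c \<Omega>" by (rule Lip_cI[OF moll_shift_lipschitz(2) Q off])
      then show ?thesis using True by (simp add: V_def axis_def)
    next
      case False
      then show ?thesis using Lip_c_zero[of \<Omega>] by (simp add: V_def axis_def)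
    qed
    with G have eq: "(LINT y|?M. G y \<bullet> V y) = - (LINT y|?M. u y * div_A A V y)"
      unfolding is_weak_grad_def by blast
    have mm: "(\<lambda>y. moll k (y - x)) \<in> borel_measurable lebesgue"
      by (rule measurable_completion) measurable
    have "(LINT y|?M. G y \<bullet> V y) = (LINT y|?M. moll k (y - x) * g y)"
    proof (rule integral_cong_AE)
      show "(\<lambda>y. G y \<bullet> V y) \<in> borel_measurable ?M"
        unfolding V_def inner_scaleR_right using borel_measurable_integrable[OF Gi'] measurable_restrict_space1[OF mm]
        by (intro borel_measurable_times) (simp_all add: inner_axis)
      show "(\<lambda>y. moll k (y - x) * g y) \<in> borel_measurable ?M"
        using gm mm by (intro borel_measurable_times measurable_restrict_space1)
      show "AE y in ?M. G y \<bullet> V y = moll k (y - x) * g y"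
        using g(3) by eventually_elim (simp add: V_def inner_axis)
    qed
    also have "\<dots> = (LINT y|lebesgue. moll k (y - x) * g y)"
      using \<Omega>l g(2) by (subst integral_restrict_space) (auto intro!: Bochner_Integration.integral_cong simp: indicator_def)
    also have "\<dots> = (LINT y|lborel. moll k (y - x) * g y)"
      using g(1) by (intro integral_completion) (auto dest: borel_measurable_integrable)
    finally have 1: "(LINT y|?M. G y \<bullet> V y) = (LINT y|lborel. moll k (y - x) * g y)" .
    have dA: "div_A A V y = dv (\<lambda>y. moll k (y - x) *\<^sub>R ?s y) y" for y
      by (simp add: div_A_def dv_def V_def matrix_vector_mult_scaleR)
    obtain M B where MB: "M-lipschitz_on UNIV (\<lambda>y. moll k (y - x) *\<^sub>R ?s y)"
      using moll_field_lipschitz[OF s x] by blast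
    have dm: "dv (\<lambda>y. moll k (y - x) *\<^sub>R ?s y) \<in> borel_measurable lebesgue" by (rule dv_measurable[OF MB])
    have "(LINT y|?M. u y * div_A A V y) = (LINT y|?M. z y * dv (\<lambda>y. moll k (y - x) *\<^sub>R ?s y) y)"
    proof (rule integral_cong_AE)
      show "(\<lambda>y. u y * div_A A V y) \<in> borel_measurable ?M"
        unfolding dA using um measurable_restrict_space1[OF dm] by (intro borel_measurable_times)
      show "(\<lambda>y. z y * dv (\<lambda>y. moll k (y - x) *\<^sub>R ?s y) y) \<in> borel_measurable ?M"
        using zm dm by (intro borel_measurable_times measurable_restrict_space1)
      show "AE y in ?M. u y * div_A A V y = z y * dv (\<lambda>y. moll k (y - x) *\<^sub>R ?s y) y"
        using z(3) by eventually_elim (simp add: dA)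
    qed
    also have "\<dots> = (LINT y|lebesgue. z y * dv (\<lambda>y. moll k (y - x) *\<^sub>R ?s y) y)"
      using \<Omega>l z(2) by (subst integral_restrict_space) (auto intro!: Bochner_Integration.integral_cong simp: indicator_def)
    finally show ?thesis using 1 eq by simp
  qed
  then have "weak_dirderiv \<Omega> ?s z g" using z(1) g(1) by (simp add: weak_dirderiv_def)
  then show ?thesis using that z(3) g(3) by blast
qed

subsection \<open>Weak A-gradients\<close>

lemma matrix_vector_measurable:
  fixes S :: "'a \<Rightarrow> real ^ 'n ^ 'm"
  assumes "\<And>i. (\<lambda>x. S x *v axis i 1) \<in> borel_measurable M" "g \<in> borel_measurable M"
  shows "(\<lambda>x. S x *v g x) \<in> borel_measurable M"
proof -
  have "S x *v g x = (\<Sum>i\<in>UNIV. (g x \<bullet> axis i 1) *\<^sub>R (S x *v axis i 1))" for x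
    unfolding matrix_mult_sum[of "S x" "g x"]
    by (simp add: inner_axis matrix_vector_mult_basis scalar_mult_eq_scaleR)
  then show ?thesis
    using assms by (auto intro!: borel_measurable_sum borel_measurable_scaleR borel_measurable_inner)
qed

locale lipschitz_sqrt =
  fixes \<Omega> :: "(real ^ 'n) set" and A :: "real ^ 'n \<Rightarrow> real ^ 'n ^ 'n" and B L :: real
  assumes open_\<Omega>: "open \<Omega>" and bounded_\<Omega>: "bounded \<Omega>"
    and psd: "\<And>x. x \<in> \<Omega> \<Longrightarrow> sym_psd (A x)"
    and sqrt_bound: "\<And>x. x \<in> \<Omega> \<Longrightarrow> norm (mat_sqrt (A x)) \<le> B"
    and sqrt_lipschitz: "L-lipschitz_on \<Omega> (\<lambda>x. mat_sqrt (A x))"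
begin

abbreviation "M \<equiv> lebesgue_on \<Omega>"

lemma sets_\<Omega>: "\<Omega> \<in> sets lebesgue"
  using open_\<Omega> by (auto intro: sets_completionI_sets)

lemma lmeasurable_\<Omega>: "\<Omega> \<in> lmeasurable"
  using bounded_\<Omega> sets_\<Omega> by (rule bounded_set_imp_lmeasurable)

sublocale finite_measure M
  by (rule finite_measure_lebesgue_on[OF lmeasurable_\<Omega>])

sublocale complete_measure M
  by (rule complete_measure_lebesgue_on[OF sets_\<Omega>])

lemma AE_in_\<Omega>: "AE x in M. x \<in> \<Omega>"
  by (rule AE_I2) simp

lemma AE_restrict: "AE x in lebesgue. P x \<Longrightarrow> AE x in M. P x"
  unfolding AE_lebesgue_on_iff[OF sets_\<Omega>] by (auto elim: eventually_mono)

lemma measurable_restrict: "f \<in> borel_measurable lebesgue \<Longrightarrow> f \<in> borel_measurable M"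
  by (rule measurable_restrict_space1)

lemma L2_imp_integrable: "f \<in> L2 \<Omega> \<Longrightarrow> integrable M (f :: real ^ 'n \<Rightarrow> 'b::euclidean_space)"
  by (rule L2_integrable[OF _ bounded_\<Omega> sets_\<Omega>])

lemma bounded_L2:
  assumes "f \<in> borel_measurable M" "AE x in M. norm (f x) \<le> c"
  shows "f \<in> L2 \<Omega>"
  unfolding L2_def
proof (intro CollectI conjI)
  show "integrable M (\<lambda>x. (norm (f x))\<^sup>2)"
  proof (rule integrable_const_bound[where B = "c\<^sup>2"])
    show "AE x in M. norm ((norm (f x))\<^sup>2) \<le> c\<^sup>2"
      using assms(2) by eventually_elim (simp add: power_mono)
  qed (use assms in measurable)
qed fact

lemma L2_diff:
  fixes f g :: "real ^ 'n \<Rightarrow> 'b::euclidean_space"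
  assumes f: "f \<in> L2 \<Omega>" and g: "g \<in> L2 \<Omega>"
  shows "(\<lambda>x. f x - g x) \<in> L2 \<Omega>"
proof -
  have m [measurable]: "f \<in> borel_measurable M" "g \<in> borel_measurable M" using f g by (auto simp: L2_def)
  have "integrable M (\<lambda>x. (norm (f x - g x))\<^sup>2)"
  proof (rule Bochner_Integration.integrable_bound)
    show "integrable M (\<lambda>x. 2 * (norm (f x))\<^sup>2 + 2 * (norm (g x))\<^sup>2)" using f g by (auto simp: L2_def)
    have "(norm (a - b))\<^sup>2 \<le> 2 * (norm a)\<^sup>2 + 2 * (norm b)\<^sup>2" for a b :: 'b
    proof -
      have "(norm (a - b))\<^sup>2 \<le> (norm a + norm b)\<^sup>2" by (intro power_mono norm_triangle_ineq4) auto
      also have "\<dots> \<le> 2 * (norm a)\<^sup>2 + 2 * (norm b)\<^sup>2"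
        using zero_le_power2[of "norm a - norm b"] by (simp add: power2_eq_square algebra_simps)
      finally show ?thesis .
    qed
    then show "AE x in M. norm ((norm (f x - g x))\<^sup>2) \<le> norm (2 * (norm (f x))\<^sup>2 + 2 * (norm (g x))\<^sup>2)"
      by (intro AE_I2) (simp add: abs_of_nonneg)
  qed measurable
  then show ?thesis using m by (simp add: L2_def)
qed

lemma integrable_times_bounded:
  fixes f h :: "real ^ 'n \<Rightarrow> real"
  assumes f: "integrable M f" and h: "h \<in> borel_measurable M" "AE x in M. \<bar>h x\<bar> \<le> c"
  shows "integrable M (\<lambda>x. f x * h x)"
proof (rule Bochner_Integration.integrable_bound)
  show "integrable M (\<lambda>x. c * f x)" using f by simp
  show "AE x in M. norm (f x * h x) \<le> norm (c * f x)"
    using h(2) by eventually_elim (auto simp: abs_mult mult.commute[of "\<bar>f _\<bar>"] intro!: mult_right_mono)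
qed (use f h in \<open>auto intro!: borel_measurable_times\<close>)

lemma integrable_inner_bounded:
  fixes f h :: "real ^ 'n \<Rightarrow> real ^ 'n"
  assumes f: "integrable M f" and h: "h \<in> borel_measurable M" "AE x in M. norm (h x) \<le> c"
  shows "integrable M (\<lambda>x. f x \<bullet> h x)"
proof (rule Bochner_Integration.integrable_bound)
  show "integrable M (\<lambda>x. c * norm (f x))" using f by simp
  show "AE x in M. norm (f x \<bullet> h x) \<le> norm (c * norm (f x))"
    using h(2)
  proof eventually_elim
    case (elim x)
    have "\<bar>f x \<bullet> h x\<bar> \<le> norm (f x) * norm (h x)" by (rule Cauchy_Schwarz_ineq2)
    also have "\<dots> \<le> norm (f x) * c" using elim by (intro mult_left_mono) auto
    finally show ?case by (simp add: mult.commute abs_mult) (metis abs_ge_self mult.commute norm_ge_zero order_trans mult_right_mono)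
  qed
qed (use f h in \<open>auto intro!: borel_measurable_inner\<close>)

lemma sqrt_column_lipschitz: "(real CARD('n) * L)-lipschitz_on \<Omega> (\<lambda>y. mat_sqrt (A y) *v axis i 1)"
proof (rule lipschitz_onI)
  show "0 \<le> real CARD('n) * L" using lipschitz_on_nonneg[OF sqrt_lipschitz] by simp
  fix x y assume xy: "x \<in> \<Omega>" "y \<in> \<Omega>"
  have "norm ((mat_sqrt (A x) - mat_sqrt (A y)) *v axis i 1) \<le> real CARD('n) * (norm (mat_sqrt (A x) - mat_sqrt (A y)) * norm (axis i 1 :: real ^ 'n))"
    by (rule norm_matrix_vector_le)
  also have "\<dots> \<le> real CARD('n) * (L * dist x y * 1)"
    using lipschitz_onD[OF sqrt_lipschitz xy] lipschitz_on_nonneg[OF sqrt_lipschitz]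
    by (intro mult_left_mono mult_mono) (auto simp: dist_norm)
  finally show "dist (mat_sqrt (A x) *v axis i 1) (mat_sqrt (A y) *v axis i 1) \<le> real CARD('n) * L * dist x y"
    by (simp add: dist_norm matrix_vector_mult_diff_rdistrib mult.assoc)
qed

lemma sqrt_vector_measurable:
  assumes "g \<in> borel_measurable M"
  shows "(\<lambda>x. mat_sqrt (A x) *v g x) \<in> borel_measurable M"
  by (rule matrix_vector_measurable[OF continuous_imp_measurable_on_sets_lebesgue[OF
      lipschitz_on_continuous_on[OF sqrt_column_lipschitz] sets_\<Omega>] assms])

text \<open>Each component of \<open>G\<close> is a derivative of \<open>u\<close> along a column of
  the square root, to which locality applies. Used for differences, it covers uniqueness, level sets
  and sets on which two functions coincide.\<close>

lemma weak_grad_zero_AE: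
  assumes u: "u \<in> L2 \<Omega>" and G: "is_weak_grad \<Omega> A u G"
  shows "AE x in M. u x = 0 \<longrightarrow> G x = 0"
proof -
  have "AE x in M. u x = 0 \<longrightarrow> G x $ i = 0" for i
  proof -
    have "\<forall>x\<in>\<Omega>. sym_psd (A x)" using psd by blast
    then obtain z g where zg: "weak_dirderiv \<Omega> (\<lambda>y. mat_sqrt (A y) *v axis i 1) z g"
      "AE x in M. u x = z x" "AE x in M. G x $ i = g x"
      using is_weak_grad_imp_weak_dirderiv[OF open_\<Omega> bounded_\<Omega> _ sqrt_column_lipschitz u G] by blast
    have "AE x in M. x \<in> \<Omega> \<longrightarrow> z x = 0 \<longrightarrow> g x = 0"
      by (rule AE_lebesgue_onI[OF sets_\<Omega> weak_dirderiv_locality[OF zg(1) sqrt_column_lipschitz open_\<Omega>]])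
    with zg(2,3) AE_in_\<Omega> show ?thesis by eventually_elim simp
  qed
  then have "AE x in M. \<forall>i. u x = 0 \<longrightarrow> G x $ i = 0" by (intro AE_all_countable[THEN iffD2] allI)
  then show ?thesis by eventually_elim (simp add: vec_eq_iff)
qed

text \<open>Collects what makes both integrals in \<open>is_weak_grad\<close> exist for integrable
  functions: the field is bounded, and its \<open>div_A\<close> is bounded almost everywhere, being
  the divergence of a Lipschitz field.\<close>

lemma test_field:
  fixes V :: "real ^ 'n \<Rightarrow> real ^ 'n"
  assumes V: "\<And>i. (\<lambda>x. V x $ i) \<in> Lip_c \<Omega>"
  obtains C K D where "C-lipschitz_on UNIV (\<lambda>x. mat_sqrt (A x) *v V x)" "compact K" "K \<subseteq> \<Omega>"
    "\<And>x. x \<notin> K \<Longrightarrow> V x = 0" "V \<in> borel_measurable M" "\<And>x. norm (V x) \<le> D"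
    "div_A A V \<in> borel_measurable M" "AE x in M. \<bar>div_A A V x\<bar> \<le> real CARD('n) * C"
proof -
  obtain L' K D where V: "L'-lipschitz_on UNIV V" "compact K" "K \<subseteq> \<Omega>" "\<And>x. x \<notin> K \<Longrightarrow> V x = 0" "0 \<le> D" "\<And>x. norm (V x) \<le> D"
    using vector_Lip_cE[OF V] by blast
  have b: "norm (mat_sqrt (A x)) \<le> max B 0" if "x \<in> K" "x \<in> \<Omega>" for x using sqrt_bound[OF that(2)] by simp
  define C where "C = real CARD('n) * (max B 0 * L' + L * D)"
  have l: "C-lipschitz_on UNIV (\<lambda>x. mat_sqrt (A x) *v V x)"
    unfolding C_def by (rule lipschitz_matrix_vector[OF sqrt_lipschitz b _ V(1,6,4,3)]) auto
  have dA: "div_A A V = dv (\<lambda>x. mat_sqrt (A x) *v V x)" by (simp add: fun_eq_iff div_A_def dv_def)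
  have m: "div_A A V \<in> borel_measurable M" unfolding dA by (intro measurable_restrict dv_measurable[OF l])
  have Vm: "V \<in> borel_measurable M"
    using lipschitz_on_continuous_on[OF V(1)]
    by (intro measurable_restrict measurable_completion) (simp add: borel_measurable_continuous_onI)
  have "AE x in M. \<bar>div_A A V x\<bar> \<le> real CARD('n) * C"
    unfolding dA by (rule AE_restrict) (use lipschitz_differentiable_AE[OF l] abs_dv_le[OF l] in \<open>auto elim: eventually_mono\<close>)
  then show ?thesis using that[OF l V(2,3,4) Vm V(6) m] by blast
qed

lemma is_weak_grad_diff:
  assumes u: "u \<in> L2 \<Omega>" "is_weak_grad \<Omega> A u G" and v: "v \<in> L2 \<Omega>" "is_weak_grad \<Omega> A v H"
  shows "is_weak_grad \<Omega> A (\<lambda>x. u x - v x) (\<lambda>x. G x - H x)"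
  unfolding is_weak_grad_def
proof (intro conjI allI impI)
  have GH: "G \<in> L2 \<Omega>" "H \<in> L2 \<Omega>" using u v by (auto simp: is_weak_grad_def)
  show "(\<lambda>x. G x - H x) \<in> L2 \<Omega>" by (rule L2_diff[OF GH])
  fix V :: "real ^ 'n \<Rightarrow> real ^ 'n" assume V: "\<forall>i. (\<lambda>x. V x $ i) \<in> Lip_c \<Omega>"
  obtain K C D where "C-lipschitz_on UNIV (\<lambda>x. mat_sqrt (A x) *v V x)" "compact K" "K \<subseteq> \<Omega>"
    "\<And>x. x \<notin> K \<Longrightarrow> V x = 0" and t: "V \<in> borel_measurable M" "\<And>x. norm (V x) \<le> D"
    "div_A A V \<in> borel_measurable M" "AE x in M. \<bar>div_A A V x\<bar> \<le> real CARD('n) * C"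
    by (rule test_field[OF V[rule_format]]) (rule that)
  have 1: "integrable M (\<lambda>x. F x \<bullet> V x)" if "F \<in> L2 \<Omega>" for F
    using integrable_inner_bounded[OF L2_imp_integrable[OF that] t(1)] t(2) by blast
  have 2: "integrable M (\<lambda>x. f x * div_A A V x)" if "f \<in> L2 \<Omega>" for f
    by (rule integrable_times_bounded[OF L2_imp_integrable[OF that] t(3,4)])
  show "(LINT x|M. (G x - H x) \<bullet> V x) = - (LINT x|M. (u x - v x) * div_A A V x)"
    using u(2) v(2) V 1[OF GH(1)] 1[OF GH(2)] 2[OF u(1)] 2[OF v(1)]
    by (simp add: is_weak_grad_def inner_diff_left left_diff_distrib)
qed

text \<open>The field \<open>mat_sqrt (A x) *v V x\<close> has compact support in
  \<open>\<Omega>\<close>, so its divergence integrates to zero.\<close>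

lemma is_weak_grad_const: "is_weak_grad \<Omega> A (\<lambda>x. c) (\<lambda>x. 0)"
  unfolding is_weak_grad_def
proof (intro conjI allI impI)
  show "(\<lambda>x. 0 :: real ^ 'n) \<in> L2 \<Omega>" by (rule bounded_L2[where c = 0]) auto
  fix V :: "real ^ 'n \<Rightarrow> real ^ 'n" assume V: "\<forall>i. (\<lambda>x. V x $ i) \<in> Lip_c \<Omega>"
  obtain K C D where t: "C-lipschitz_on UNIV (\<lambda>x. mat_sqrt (A x) *v V x)" "compact K" "K \<subseteq> \<Omega>"
    "\<And>x. x \<notin> K \<Longrightarrow> V x = 0" "V \<in> borel_measurable M" "\<And>x. norm (V x) \<le> D"
    "div_A A V \<in> borel_measurable M" "AE x in M. \<bar>div_A A V x\<bar> \<le> real CARD('n) * C"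
    by (rule test_field[OF V[rule_format]]) (rule that)
  have z: "mat_sqrt (A x) *v V x = 0" if "x \<notin> K" for x using t(4)[OF that] by simp
  have dz: "dv (\<lambda>x. mat_sqrt (A x) *v V x) x = 0" if "x \<notin> K" for x
    using compact_imp_closed[OF t(2)] that z by (rule dv_outside)
  have "(LINT x|M. div_A A V x) = (LINT x|lebesgue. indicator \<Omega> x *\<^sub>R dv (\<lambda>x. mat_sqrt (A x) *v V x) x)"
    using sets_\<Omega> by (subst integral_restrict_space) (auto simp: div_A_def dv_def)
  also have "\<dots> = (LINT x|lebesgue. dv (\<lambda>x. mat_sqrt (A x) *v V x) x)"
    using t(3) dz by (intro Bochner_Integration.integral_cong) (auto simp: indicator_def)
  also have "\<dots> = 0" by (rule integral_dv[OF t(1,2) z])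
  finally show "(LINT x|M. 0 \<bullet> V x) = - (LINT x|M. c * div_A A V x)" by simp
qed

lemma Lip_c_AE_differentiable:
  assumes "w \<in> Lip_c \<Omega>"
  shows "AE x in M. w differentiable (at x)"
  using assms by (elim Lip_cE) (rule AE_restrict[OF Rademacher_lebesgue])

text \<open>The integration by parts is the vanishing integral of the divergence of \<open>w\<close>
  times the field; symmetry of the square root moves it from \<open>V\<close> to
  \<open>grad w\<close>, which produces \<open>grad_A\<close>.\<close>

lemma Lip_c_grad_A:
  assumes w: "w \<in> Lip_c \<Omega>"
  shows "grad_A A w \<in> L2 \<Omega>" "w \<in> L2 \<Omega>" "is_weak_grad \<Omega> A w (grad_A A w)" "\<exists>c. \<forall>x. \<bar>w x\<bar> \<le> c"
    "w \<in> borel_measurable M"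
proof -
  obtain C K where C: "C-lipschitz_on UNIV w" "compact K" "K \<subseteq> \<Omega>" "\<And>x. x \<notin> K \<Longrightarrow> w x = 0"
    by (rule Lip_cE[OF w]) (rule that)
  obtain D where D: "0 \<le> D" "\<And>x. norm (w x) \<le> D"
    using lipschitz_bounded_if_compact_support[OF C(1,2,4)] by blast
  then show "\<exists>c. \<forall>x. \<bar>w x\<bar> \<le> c" by auto
  show wm: "w \<in> borel_measurable M"
    using lipschitz_on_continuous_on[OF C(1)]
    by (intro measurable_restrict measurable_completion) (simp add: borel_measurable_continuous_onI)
  show wL: "w \<in> L2 \<Omega>" using D by (intro bounded_L2[OF wm, of D]) auto
  have gm: "grad_A A w \<in> borel_measurable M"
    unfolding grad_A_def[abs_def] by (intro sqrt_vector_measurable measurable_restrict grad_measurable[OF C(1)])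
  show gL: "grad_A A w \<in> L2 \<Omega>"
  proof (rule bounded_L2[OF gm])
    show "AE x in M. norm (grad_A A w x) \<le> real CARD('n) * (B * C)"
      using Lip_c_AE_differentiable[OF w] AE_in_\<Omega>
    proof eventually_elim
      case (elim x)
      have "norm (grad_A A w x) \<le> real CARD('n) * (norm (mat_sqrt (A x)) * norm (grad w x))"
        unfolding grad_A_def by (rule norm_matrix_vector_le)
      also have "\<dots> \<le> real CARD('n) * (B * C)"
        using sqrt_bound[OF elim(2)] norm_grad_le[OF C(1) elim(1)] order_trans[OF norm_ge_zero sqrt_bound[OF elim(2)]]
        by (intro mult_left_mono mult_mono) auto
      finally show ?case .
    qed
  qed
  show "is_weak_grad \<Omega> A w (grad_A A w)"
    unfolding is_weak_grad_def
  proof (intro conjI allI impI gL)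
    fix V :: "real ^ 'n \<Rightarrow> real ^ 'n" assume V: "\<forall>i. (\<lambda>x. V x $ i) \<in> Lip_c \<Omega>"
    obtain K' C' D' where t: "C'-lipschitz_on UNIV (\<lambda>x. mat_sqrt (A x) *v V x)" "compact K'" "K' \<subseteq> \<Omega>"
      "\<And>x. x \<notin> K' \<Longrightarrow> V x = 0" "V \<in> borel_measurable M" "\<And>x. norm (V x) \<le> D'"
      "div_A A V \<in> borel_measurable M" "AE x in M. \<bar>div_A A V x\<bar> \<le> real CARD('n) * C'"
      by (rule test_field[OF V[rule_format]]) (rule that)
    define P where "P x = mat_sqrt (A x) *v V x" for x
    have Pz: "P x = 0" if "x \<notin> K'" for x using t(4)[OF that] by (simp add: P_def)
    have lP: "C'-lipschitz_on UNIV P" using t(1) by (simp add: P_def)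
    obtain D'' where D'': "\<And>x. norm (P x) \<le> D''"
      using lipschitz_bounded_if_compact_support[OF lP t(2) Pz] by blast
    have D_abs: "\<bar>w x\<bar> \<le> D" for x using D(2)[of x] by simp
    note lwP = lipschitz_scaleR[OF C(1) lP D_abs D'']
    have wPz: "w x *\<^sub>R P x = 0" if "x \<notin> K'" for x using Pz[OF that] by simp
    have wPdz: "dv (\<lambda>x. w x *\<^sub>R P x) x = 0" if "x \<notin> K'" for x
      using compact_imp_closed[OF t(2)] that wPz by (rule dv_outside)
    have i1: "integrable M (\<lambda>x. grad_A A w x \<bullet> V x)"
      using integrable_inner_bounded[OF L2_imp_integrable[OF gL] t(5)] t(6) by blast
    have i2: "integrable M (\<lambda>x. w x * div_A A V x)"
      by (rule integrable_times_bounded[OF L2_imp_integrable[OF wL] t(7,8)])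
    have "0 = (LINT x|lebesgue. dv (\<lambda>y. w y *\<^sub>R P y) x)" using integral_dv(1)[OF lwP t(2) wPz] by simp
    also have "\<dots> = (LINT x|lebesgue. indicator \<Omega> x *\<^sub>R dv (\<lambda>y. w y *\<^sub>R P y) x)"
      using t(3) wPdz by (intro Bochner_Integration.integral_cong) (auto simp: indicator_def)
    also have "\<dots> = (LINT x|M. dv (\<lambda>y. w y *\<^sub>R P y) x)"
      using sets_\<Omega> by (subst integral_restrict_space) auto
    also have "\<dots> = (LINT x|M. w x * div_A A V x + grad_A A w x \<bullet> V x)"
    proof (rule integral_cong_AE)
      show "dv (\<lambda>y. w y *\<^sub>R P y) \<in> borel_measurable M" by (intro measurable_restrict dv_measurable[OF lwP])
      show "AE x in M. dv (\<lambda>y. w y *\<^sub>R P y) x = w x * div_A A V x + grad_A A w x \<bullet> V x"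
        using Lip_c_AE_differentiable[OF w] AE_restrict[OF lipschitz_differentiable_AE[OF lP]] AE_in_\<Omega>
      proof eventually_elim
        case (elim x)
        have "div_A A V x = dv P x" by (simp add: div_A_def dv_def P_def[abs_def])
        then show ?case using dv_scaleR[OF elim(1,2)] inner_mat_sqrt[OF psd[OF elim(3)], of "grad w x" "V x"]
          by (simp add: grad_A_def P_def)
      qed
    qed (use i1 i2 in \<open>auto intro: borel_measurable_add\<close>)
    also have "\<dots> = (LINT x|M. w x * div_A A V x) + (LINT x|M. grad_A A w x \<bullet> V x)" using i1 i2 by simp
    finally show "(LINT x|M. grad_A A w x \<bullet> V x) = - (LINT x|M. w x * div_A A V x)" by simp
  qed
qed

end

section \<open>Approximation by Lipschitz functions and truncation\<close>

context lipschitz_sqrt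
begin

text \<open>Locality applied to the zero function \<open>u - u\<close>, one of whose weak gradients
  is \<open>G - H\<close>.\<close>

lemma weak_grad_unique_AE:
  assumes "u \<in> L2 \<Omega>" "is_weak_grad \<Omega> A u G" "is_weak_grad \<Omega> A u H"
  shows "AE x in M. G x = H x"
  using weak_grad_zero_AE[OF L2_diff[OF assms(1,1)] is_weak_grad_diff[OF assms(1,2,1,3)]]
  by eventually_elim simp

text \<open>\<open>W12_norm\<close> involves a chosen weak gradient of the difference, which by
  uniqueness agrees almost everywhere with \<open>G - grad_A A w\<close>. A subsequence then
  converges pointwise as well.\<close>

lemma W12_0_approx:
  assumes v: "v \<in> W12_0 \<Omega> A" and G: "is_weak_grad \<Omega> A v G"
  obtains w :: "nat \<Rightarrow> real ^ 'n \<Rightarrow> real" where "\<And>n. w n \<in> Lip_c \<Omega>" "AE x in M. (\<lambda>n. w n x) \<longlonglongrightarrow> v x"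
    "AE x in M. (\<lambda>n. grad_A A (w n) x) \<longlonglongrightarrow> G x"
    "(\<lambda>n. LINT x|M. (norm (G x - grad_A A (w n) x))\<^sup>2) \<longlonglongrightarrow> 0"
proof -
  have vL: "v \<in> L2 \<Omega>" and GL: "G \<in> L2 \<Omega>" using v G by (auto simp: W12_0_def W12_def is_weak_grad_def)
  have "\<exists>w\<in>Lip_c \<Omega>. W12_norm \<Omega> A (\<lambda>x. v x - w x) < 1 / real (Suc n)" for n
    using v by (simp add: W12_0_def)
  then obtain w where w: "\<And>n. w n \<in> Lip_c \<Omega>" "\<And>n. W12_norm \<Omega> A (\<lambda>x. v x - w n x) < 1 / real (Suc n)" by metis
  define e where "e n x = \<bar>v x - w n x\<bar>\<^sup>2 + (norm (G x - grad_A A (w n) x))\<^sup>2" for n x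
  have d1: "(\<lambda>x. v x - w n x) \<in> L2 \<Omega>" for n by (rule L2_diff[OF vL Lip_c_grad_A(2)[OF w(1)]])
  have d2: "(\<lambda>x. G x - grad_A A (w n) x) \<in> L2 \<Omega>" for n by (rule L2_diff[OF GL Lip_c_grad_A(1)[OF w(1)]])
  have i1: "integrable M (\<lambda>x. \<bar>v x - w n x\<bar>\<^sup>2)" for n using d1[of n] by (simp add: L2_def)
  have i2: "integrable M (\<lambda>x. (norm (G x - grad_A A (w n) x))\<^sup>2)" for n using d2[of n] by (simp add: L2_def)
  have ei: "integrable M (e n)" for n unfolding e_def using i1 i2 by (rule Bochner_Integration.integrable_add)
  have e0: "0 \<le> e n x" for n x by (simp add: e_def)
  have le: "(LINT x|M. e n x) \<le> 1 / real (Suc n)" for n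
  proof -
    have wg: "is_weak_grad \<Omega> A (\<lambda>x. v x - w n x) (\<lambda>x. G x - grad_A A (w n) x)"
      by (rule is_weak_grad_diff[OF vL G Lip_c_grad_A(2,3)[OF w(1)]])
    then have sg: "is_weak_grad \<Omega> A (\<lambda>x. v x - w n x) (weak_grad \<Omega> A (\<lambda>x. v x - w n x))"
      unfolding weak_grad_def by (rule someI[where P = "is_weak_grad \<Omega> A (\<lambda>x. v x - w n x)"])
    have m: "weak_grad \<Omega> A (\<lambda>x. v x - w n x) \<in> borel_measurable M" using sg by (simp add: is_weak_grad_def L2_def)
    have m': "(\<lambda>x. v x - w n x) \<in> borel_measurable M" using d1[of n] by (simp add: L2_def)
    have "(LINT x|M. e n x) = (LINT x|M. \<bar>v x - w n x\<bar>\<^sup>2 + (norm (weak_grad \<Omega> A (\<lambda>x. v x - w n x) x))\<^sup>2)"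
    proof (rule integral_cong_AE)
      show "e n \<in> borel_measurable M" by (rule borel_measurable_integrable[OF ei])
      show "(\<lambda>x. \<bar>v x - w n x\<bar>\<^sup>2 + (norm (weak_grad \<Omega> A (\<lambda>x. v x - w n x) x))\<^sup>2) \<in> borel_measurable M"
        using m m' by measurable
      show "AE x in M. e n x = \<bar>v x - w n x\<bar>\<^sup>2 + (norm (weak_grad \<Omega> A (\<lambda>x. v x - w n x) x))\<^sup>2"
        using weak_grad_unique_AE[OF d1 wg sg] by eventually_elim (simp add: e_def)
    qed
    then have "sqrt (LINT x|M. e n x) < 1 / real (Suc n)" using w(2)[of n] by (simp add: W12_norm_def)
    then have "(sqrt (LINT x|M. e n x))\<^sup>2 \<le> (1 / real (Suc n))\<^sup>2" using e0 by (intro power_mono) (auto intro: integral_nonneg_AE)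
    then have "(LINT x|M. e n x) \<le> (1 / real (Suc n))\<^sup>2" using e0 by (simp add: integral_nonneg_AE)
    also have "\<dots> \<le> 1 / real (Suc n)" unfolding power2_eq_square by (intro mult_left_le) auto
    finally show ?thesis .
  qed
  have lim: "(\<lambda>n. LINT x|M. e n x) \<longlonglongrightarrow> 0"
  proof (rule tendsto_sandwich[OF _ _ tendsto_const])
    show "(\<lambda>n. 1 / real (Suc n)) \<longlonglongrightarrow> 0" by (intro lim_const_over_n LIMSEQ_Suc)
    show "eventually (\<lambda>n. (LINT x|M. e n x) \<le> 1 / real (Suc n)) sequentially" using le by (intro always_eventually allI)
    show "eventually (\<lambda>n. 0 \<le> (LINT x|M. e n x)) sequentially" using e0 by (intro always_eventually allI integral_nonneg_AE AE_I2)
  qed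
  then have "(\<lambda>n. LINT x|M. norm (e n x)) \<longlonglongrightarrow> 0" using e0 by simp
  from tendsto_L1_AE_subseq[OF ei this] obtain r :: "nat \<Rightarrow> nat" where r: "strict_mono r" "AE x in M. (\<lambda>n. e (r n) x) \<longlonglongrightarrow> 0"
    by blast
  have sq: "f \<longlonglongrightarrow> 0" if "(\<lambda>n. a n) \<longlonglongrightarrow> 0" "\<And>n. 0 \<le> f n" "\<And>n. (f n)\<^sup>2 \<le> a n" for a f :: "nat \<Rightarrow> real"
  proof (rule tendsto_sandwich[OF _ _ tendsto_const])
    show "(\<lambda>n. sqrt (a n)) \<longlonglongrightarrow> 0" using tendsto_real_sqrt[OF that(1)] by simp
    show "eventually (\<lambda>n. f n \<le> sqrt (a n)) sequentially" using that(3) by (intro always_eventually allI real_le_rsqrt)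
  qed (use that in auto)
  show thesis
  proof
    show "w (r n) \<in> Lip_c \<Omega>" for n by (rule w)
    show "AE x in M. (\<lambda>n. w (r n) x) \<longlonglongrightarrow> v x"
      using r(2)
    proof eventually_elim
      case (elim x)
      have "(\<lambda>n. \<bar>v x - w (r n) x\<bar>) \<longlonglongrightarrow> 0" by (rule sq[OF elim]) (auto simp: e_def)
      from tendsto_diff[OF tendsto_const[of "v x"] tendsto_rabs_zero_cancel[OF this]] show ?case by simp
    qed
    show "AE x in M. (\<lambda>n. grad_A A (w (r n)) x) \<longlonglongrightarrow> G x"
      using r(2)
    proof eventually_elim
      case (elim x)
      have "(\<lambda>n. norm (G x - grad_A A (w (r n)) x)) \<longlonglongrightarrow> 0" by (rule sq[OF elim]) (auto simp: e_def)
      from tendsto_diff[OF tendsto_const[of "G x"] tendsto_norm_zero_cancel[OF this]] show ?case by simp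
    qed
    show "(\<lambda>n. LINT x|M. (norm (G x - grad_A A (w (r n)) x))\<^sup>2) \<longlonglongrightarrow> 0"
    proof (rule tendsto_sandwich[OF _ _ tendsto_const])
      show "(\<lambda>n. LINT x|M. e (r n) x) \<longlonglongrightarrow> 0" using LIMSEQ_subseq_LIMSEQ[OF lim r(1)] by (simp add: o_def)
      show "eventually (\<lambda>n. (LINT x|M. (norm (G x - grad_A A (w (r n)) x))\<^sup>2) \<le> (LINT x|M. e (r n) x)) sequentially"
        by (intro always_eventually allI integral_mono i2 ei) (simp add: e_def)
    qed auto
  qed
qed

text \<open>Cauchy-Schwarz by way of the weighted estimate \<open>a * b \<le> (\<epsilon> *
  a\<^sup>2 + b\<^sup>2 / \<epsilon>) / 2\<close>, the weight being about the L2 norm of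
  \<open>q n\<close>.\<close>

lemma L2_pairing_tendsto_0:
  fixes f :: "real ^ 'n \<Rightarrow> 'b::euclidean_space" and q :: "nat \<Rightarrow> real ^ 'n \<Rightarrow> 'c::euclidean_space"
  assumes f: "f \<in> L2 \<Omega>" and q: "\<And>n. q n \<in> L2 \<Omega>" and lim: "(\<lambda>n. LINT x|M. (norm (q n x))\<^sup>2) \<longlonglongrightarrow> 0"
  shows "(\<lambda>n. LINT x|M. norm (f x) * norm (q n x)) \<longlonglongrightarrow> 0" "integrable M (\<lambda>x. norm (f x) * norm (q n x))"
proof -
  define Q where "Q n = (LINT x|M. (norm (q n x))\<^sup>2)" for n
  define F where "F = (LINT x|M. (norm (f x))\<^sup>2)"
  have fi: "integrable M (\<lambda>x. (norm (f x))\<^sup>2)" and qi: "integrable M (\<lambda>x. (norm (q n x))\<^sup>2)" for n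
    using f q[of n] by (auto simp: L2_def)
  have fm [measurable]: "f \<in> borel_measurable M" "q n \<in> borel_measurable M" for n using f q[of n] by (auto simp: L2_def)
  have am: "a * b \<le> (\<epsilon> * a\<^sup>2 + b\<^sup>2 / \<epsilon>) / 2" if "0 < \<epsilon>" for a b \<epsilon> :: real
  proof -
    have "0 \<le> (\<epsilon> * a - b)\<^sup>2 / \<epsilon>" using that by simp
    also have "\<dots> = \<epsilon> * a\<^sup>2 + b\<^sup>2 / \<epsilon> - 2 * (a * b)" using that by (simp add: power2_eq_square field_simps)
    finally show ?thesis by simp
  qed
  show i: "integrable M (\<lambda>x. norm (f x) * norm (q n x))" for n
  proof (rule Bochner_Integration.integrable_bound)
    show "integrable M (\<lambda>x. (norm (f x))\<^sup>2 + (norm (q n x))\<^sup>2)" using fi qi by simp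
    have "a * b \<le> a\<^sup>2 + b\<^sup>2" for a b :: real
    proof -
      have "a * b \<le> (a\<^sup>2 + b\<^sup>2) / 2" using am[of 1 a b] by simp
      also have "s / 2 \<le> s" if "0 \<le> s" for s :: real using that by simp
      then have "(a\<^sup>2 + b\<^sup>2) / 2 \<le> a\<^sup>2 + b\<^sup>2" by simp
      finally show ?thesis .
    qed
    then show "AE x in M. norm (norm (f x) * norm (q n x)) \<le> norm ((norm (f x))\<^sup>2 + (norm (q n x))\<^sup>2)"
      by (intro AE_I2) (simp add: abs_mult)
  qed measurable
  have Q0: "0 \<le> Q n" for n unfolding Q_def by (intro integral_nonneg_AE) auto
  \<comment> \<open>The summand \<open>1 / (n + 1)\<close> keeps the weight positive when
    \<open>q n\<close> has norm zero.\<close>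
  define \<epsilon> where "\<epsilon> n = sqrt (Q n) + 1 / real (Suc n)" for n
  have \<epsilon>: "0 < \<epsilon> n" for n unfolding \<epsilon>_def using Q0[of n] by (intro add_nonneg_pos) auto
  have le: "(LINT x|M. norm (f x) * norm (q n x)) \<le> (\<epsilon> n * F + sqrt (Q n)) / 2" for n
  proof -
    have "(LINT x|M. norm (f x) * norm (q n x)) \<le> (LINT x|M. (\<epsilon> n * (norm (f x))\<^sup>2 + (norm (q n x))\<^sup>2 / \<epsilon> n) / 2)"
      using am[OF \<epsilon>] fi qi by (intro integral_mono i) auto
    also have "\<dots> = (\<epsilon> n * F + Q n / \<epsilon> n) / 2" using fi qi by (simp add: F_def Q_def)
    also have "Q n / \<epsilon> n \<le> sqrt (Q n)"
    proof -
      have "Q n = sqrt (Q n) * sqrt (Q n)" using Q0 by simp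
      also have "\<dots> \<le> sqrt (Q n) * \<epsilon> n" using Q0[of n] by (intro mult_left_mono) (auto simp: \<epsilon>_def)
      finally show ?thesis using \<epsilon>[of n] by (simp add: divide_le_eq)
    qed
    finally show ?thesis by simp
  qed
  have s: "(\<lambda>n. sqrt (Q n)) \<longlonglongrightarrow> 0" using tendsto_real_sqrt[OF lim] by (simp add: Q_def)
  have "(\<lambda>n. 1 / real (Suc n)) \<longlonglongrightarrow> 0" by (intro lim_const_over_n LIMSEQ_Suc)
  from tendsto_add[OF s this] have "\<epsilon> \<longlonglongrightarrow> 0" by (simp add: \<epsilon>_def[abs_def])
  from tendsto_divide[OF tendsto_add[OF tendsto_mult[OF this tendsto_const[of F]] s] tendsto_const[of 2]]
  have b: "(\<lambda>n. (\<epsilon> n * F + sqrt (Q n)) / 2) \<longlonglongrightarrow> 0" by simp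
  show "(\<lambda>n. LINT x|M. norm (f x) * norm (q n x)) \<longlonglongrightarrow> 0"
  proof (rule tendsto_sandwich[OF _ _ tendsto_const b])
    show "eventually (\<lambda>n. (LINT x|M. norm (f x) * norm (q n x)) \<le> (\<epsilon> n * F + sqrt (Q n)) / 2) sequentially"
      using le by (intro always_eventually allI)
  qed auto
qed

text \<open>\<open>k \<ge> 0\<close> keeps the truncation zero outside the support of
  \<open>w\<close>. Where \<open>w x \<le> k\<close> the truncation has a minimum at
  \<open>x\<close>, so its gradient, which exists almost everywhere, is zero.\<close>

lemma Lip_c_truncate:
  assumes w: "w \<in> Lip_c \<Omega>" and k: "0 \<le> k"
  shows "(\<lambda>x. max (w x - k) 0) \<in> Lip_c \<Omega>"
    and "AE x in M. grad_A A (\<lambda>x. max (w x - k) 0) x = (if k < w x then grad_A A w x else 0)"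
proof -
  obtain C K where C: "C-lipschitz_on UNIV w" "compact K" "K \<subseteq> \<Omega>" "\<And>x. x \<notin> K \<Longrightarrow> w x = 0"
    by (rule Lip_cE[OF w]) (rule that)
  have l: "C-lipschitz_on UNIV (\<lambda>x. max (w x - k) 0)"
  proof (rule lipschitz_onI)
    show "0 \<le> C" by (rule lipschitz_on_nonneg[OF C(1)])
    fix x y show "dist (max (w x - k) 0) (max (w y - k) 0) \<le> C * dist x y"
      using lipschitz_onD[OF C(1), of x y] by (auto simp: dist_real_def max_def split: if_splits)
  qed
  show t: "(\<lambda>x. max (w x - k) 0) \<in> Lip_c \<Omega>"
    by (rule Lip_cI[OF l C(2,3)]) (use C(4) k in auto)
  have wc: "isCont w x" for x using lipschitz_on_continuous_on[OF C(1)] by (simp add: continuous_on_eq_continuous_at)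
  show "AE x in M. grad_A A (\<lambda>x. max (w x - k) 0) x = (if k < w x then grad_A A w x else 0)"
    using Lip_c_AE_differentiable[OF w] Lip_c_AE_differentiable[OF t]
  proof eventually_elim
    case (elim x)
    show ?case
    proof (cases "k < w x")
      case True
      have "open {y. k < w y}" using lipschitz_on_continuous_on[OF C(1)] by (intro open_Collect_less) auto
      moreover have "((\<lambda>y. w y - k) has_derivative (\<lambda>h. grad w x \<bullet> h)) (at x)"
        using has_derivative_diff[OF grad_has_derivative[OF elim(1)] has_derivative_const] by simp
      ultimately have "((\<lambda>x. max (w x - k) 0) has_derivative (\<lambda>h. grad w x \<bullet> h)) (at x)"
        using True by (elim has_derivative_transform_within_open) auto
      from grad_eqI[OF this] show ?thesis using True by (simp add: grad_A_def)
    next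
      case False
      have "((\<lambda>x. max (w x - k) 0) has_derivative (\<lambda>h. grad (\<lambda>x. max (w x - k) 0) x \<bullet> h)) (at x)"
        by (rule grad_has_derivative[OF elim(2)])
      moreover have "max (w x - k) 0 \<le> max (w y - k) 0" for y using False by simp
      ultimately have "(\<lambda>h. grad (\<lambda>x. max (w x - k) 0) x \<bullet> h) = (\<lambda>h. 0)"
        by (intro differential_zero_maxmin[of x UNIV "\<lambda>x. max (w x - k) 0"]) auto
      then have "grad (\<lambda>x. max (w x - k) 0) x = 0" by (metis inner_eq_zero_iff)
      then show ?thesis using False by (simp add: grad_A_def)
    qed
  qed
qed

text \<open>The cut-off \<open>k < w n x\<close> can fail to converge only where
  \<open>v x = k\<close>, and there \<open>G\<close> vanishes. The intermediate \<open>c n\<close>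
  combines the cut-off of \<open>w n\<close> with the gradient \<open>G\<close>: dominated
  convergence treats \<open>p - c n\<close>, and \<open>c n - q n\<close> is no larger than
  \<open>G - g n\<close>.\<close>

lemma truncated_gradient_tendsto:
  fixes G :: "real ^ 'n \<Rightarrow> real ^ 'n" and g :: "nat \<Rightarrow> real ^ 'n \<Rightarrow> real ^ 'n" and v :: "real ^ 'n \<Rightarrow> real"
  assumes w: "\<And>n. w n \<in> borel_measurable M" "AE x in M. (\<lambda>n. w n x) \<longlonglongrightarrow> v x" and v: "v \<in> borel_measurable M"
    and g: "\<And>n. g n \<in> L2 \<Omega>" "AE x in M. (\<lambda>n. g n x) \<longlonglongrightarrow> G x" "(\<lambda>n. LINT x|M. (norm (G x - g n x))\<^sup>2) \<longlonglongrightarrow> 0"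
    and G: "G \<in> L2 \<Omega>" "AE x in M. v x = k \<longrightarrow> G x = 0"
  defines "p \<equiv> \<lambda>x. if k < v x then G x else 0" and "q \<equiv> \<lambda>n x. if k < w n x then g n x else 0"
  shows "p \<in> L2 \<Omega>" "\<And>n. q n \<in> L2 \<Omega>" "AE x in M. (\<lambda>n. q n x) \<longlonglongrightarrow> p x"
    "(\<lambda>n. LINT x|M. (norm (p x - q n x))\<^sup>2) \<longlonglongrightarrow> 0"
proof -
  have m [measurable]: "w n \<in> borel_measurable M" "v \<in> borel_measurable M" "g n \<in> borel_measurable M" "G \<in> borel_measurable M" for n
    using w(1) v g(1)[of n] G(1) by (auto simp: L2_def)
  have Gi: "integrable M (\<lambda>x. (norm (G x))\<^sup>2)" and gi: "integrable M (\<lambda>x. (norm (g n x))\<^sup>2)" for n using G(1) g(1)[of n] by (auto simp: L2_def)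
  have pm [measurable]: "p \<in> borel_measurable M" "q n \<in> borel_measurable M" for n unfolding p_def q_def by measurable
  show pL: "p \<in> L2 \<Omega>" unfolding L2_def
    using pm(1) by (auto simp: p_def intro: Bochner_Integration.integrable_bound[OF Gi])
  have "integrable M (\<lambda>x. (norm (q n x))\<^sup>2)" for n
  proof (rule Bochner_Integration.integrable_bound[OF gi[of n]])
    show "(\<lambda>x. (norm (q n x))\<^sup>2) \<in> borel_measurable M" by measurable
  qed (auto simp: q_def)
  then show qL: "q n \<in> L2 \<Omega>" for n using pm(2) by (simp add: L2_def)
  define c where "c n x = (if k < w n x then G x else 0)" for n x
  have cm [measurable]: "c n \<in> borel_measurable M" for n unfolding c_def by measurable
  have cl: "AE x in M. (\<lambda>n. c n x) \<longlonglongrightarrow> p x"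
    using w(2) G(2)
  proof eventually_elim
    case (elim x)
    consider "k < v x" | "v x < k" | "v x = k" by linarith
    then show ?case
    proof cases
      case 1
      then have "eventually (\<lambda>n. k < w n x) sequentially" using elim(1) by (intro order_tendstoD)
      then have "eventually (\<lambda>n. c n x = p x) sequentially" by eventually_elim (use 1 in \<open>simp add: c_def p_def\<close>)
      then show ?thesis by (rule tendsto_eventually)
    next
      case 2
      then have "eventually (\<lambda>n. w n x < k) sequentially" using elim(1) by (intro order_tendstoD)
      then have "eventually (\<lambda>n. c n x = p x) sequentially" by eventually_elim (use 2 in \<open>simp add: c_def p_def\<close>)
      then show ?thesis by (rule tendsto_eventually)
    next
      case 3
      then have "c n x = p x" for n using elim(2) by (simp add: c_def p_def)
      then show ?thesis by simp
    qed
  qed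
  show "AE x in M. (\<lambda>n. q n x) \<longlonglongrightarrow> p x"
    using cl g(2)
  proof eventually_elim
    case (elim x)
    have "(\<lambda>n. norm (g n x - G x)) \<longlonglongrightarrow> 0" using elim(2) by (simp add: LIM_zero tendsto_norm_zero)
    then have "(\<lambda>n. q n x - c n x) \<longlonglongrightarrow> 0"
      by (rule Lim_null_comparison[rotated]) (auto simp: q_def c_def)
    from tendsto_add[OF this elim(1)] show ?case by simp
  qed
  have ci: "integrable M (\<lambda>x. (norm (p x - c n x))\<^sup>2)" for n
    by (rule Bochner_Integration.integrable_bound[OF Gi]) (auto simp: p_def c_def)
  have c0: "(\<lambda>n. LINT x|M. (norm (p x - c n x))\<^sup>2) \<longlonglongrightarrow> (LINT x|M. 0)"
  proof (rule integral_dominated_convergence[OF _ _ Gi])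
    show "AE x in M. (\<lambda>n. (norm (p x - c n x))\<^sup>2) \<longlonglongrightarrow> 0"
      using cl
    proof eventually_elim
      case (elim x)
      have "(\<lambda>n. (norm (p x - c n x))\<^sup>2) \<longlonglongrightarrow> (norm (p x - p x))\<^sup>2" by (intro tendsto_intros elim)
      then show ?case by simp
    qed
    show "AE x in M. norm ((norm (p x - c n x))\<^sup>2) \<le> (norm (G x))\<^sup>2" for n by (auto simp: p_def c_def)
  qed auto
  have di: "integrable M (\<lambda>x. (norm (G x - g n x))\<^sup>2)" for n using L2_diff[OF G(1) g(1)[of n]] by (simp add: L2_def)
  have pq: "integrable M (\<lambda>x. (norm (p x - q n x))\<^sup>2)" for n using L2_diff[OF pL qL[of n]] by (simp add: L2_def)
  have le: "(LINT x|M. (norm (p x - q n x))\<^sup>2) \<le> 2 * (LINT x|M. (norm (p x - c n x))\<^sup>2) + 2 * (LINT x|M. (norm (G x - g n x))\<^sup>2)" for n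
  proof -
    have "(LINT x|M. (norm (p x - q n x))\<^sup>2) \<le> (LINT x|M. 2 * (norm (p x - c n x))\<^sup>2 + 2 * (norm (G x - g n x))\<^sup>2)"
    proof (intro integral_mono pq Bochner_Integration.integrable_add integrable_mult_right ci di)
      fix x
      have "norm (p x - q n x) \<le> norm (p x - c n x) + norm (c n x - q n x)"
        using norm_triangle_ineq[of "p x - c n x" "c n x - q n x"] by simp
      also have "norm (c n x - q n x) \<le> norm (G x - g n x)" by (auto simp: c_def q_def)
      finally have "(norm (p x - q n x))\<^sup>2 \<le> (norm (p x - c n x) + norm (G x - g n x))\<^sup>2" by (intro power_mono) auto
      also have "\<dots> \<le> 2 * (norm (p x - c n x))\<^sup>2 + 2 * (norm (G x - g n x))\<^sup>2"
        using zero_le_power2[of "norm (p x - c n x) - norm (G x - g n x)"] by (simp add: power2_eq_square algebra_simps)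
      finally show "(norm (p x - q n x))\<^sup>2 \<le> 2 * (norm (p x - c n x))\<^sup>2 + 2 * (norm (G x - g n x))\<^sup>2" .
    qed
    also have "\<dots> = 2 * (LINT x|M. (norm (p x - c n x))\<^sup>2) + 2 * (LINT x|M. (norm (G x - g n x))\<^sup>2)"
      using ci di by simp
    finally show ?thesis .
  qed
  have b: "(\<lambda>n. 2 * (LINT x|M. (norm (p x - c n x))\<^sup>2) + 2 * (LINT x|M. (norm (G x - g n x))\<^sup>2)) \<longlonglongrightarrow> 2 * 0 + 2 * 0"
    using c0 by (intro tendsto_intros g(3)) simp
  show "(\<lambda>n. LINT x|M. (norm (p x - q n x))\<^sup>2) \<longlonglongrightarrow> 0"
  proof (rule tendsto_sandwich[OF _ _ tendsto_const])
    show "(\<lambda>n. 2 * (LINT x|M. (norm (p x - c n x))\<^sup>2) + 2 * (LINT x|M. (norm (G x - g n x))\<^sup>2)) \<longlonglongrightarrow> 0"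
      using b by simp
    show "eventually (\<lambda>n. (LINT x|M. (norm (p x - q n x))\<^sup>2) \<le> 2 * (LINT x|M. (norm (p x - c n x))\<^sup>2) + 2 * (LINT x|M. (norm (G x - g n x))\<^sup>2)) sequentially"
      using le by (intro always_eventually allI)
  qed auto
qed

end

subsection \<open>Level sets of subsolutions\<close>

lemma Young_measurable:
  assumes m: "1 < m" and f: "f \<in> borel_measurable M"
  shows "(\<lambda>x. Young m \<bar>f x\<bar>) \<in> borel_measurable M"
proof -
  have "mono (\<lambda>t. Young m (max 0 t))" by (intro monoI Young_mono[OF m]) auto
  from measurable_compose[OF _ borel_measurable_mono[OF this], of "\<lambda>x. \<bar>f x\<bar>" M] f
  show ?thesis by simp
qed

lemma Young_exp: "0 < m \<Longrightarrow> Young m (exp (2 powr m)) = exp (3 powr m)"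
  by (simp add: Young_def powr_powr)

context lipschitz_sqrt
begin

text \<open>Completeness gives measurability of \<open>f\<close> from that of \<open>g\<close>; this
  is how expressions in the data and in the factor between the square roots become
  measurable.\<close>

lemma integral_cong_AE_complete:
  fixes f g :: "real ^ 'n \<Rightarrow> real"
  assumes "integrable M g" "AE x in M. f x = g x"
  shows "integrable M f" "(LINT x|M. f x) = (LINT x|M. g x)"
proof -
  note g = borel_measurable_integrable[OF assms(1)]
  have f: "f \<in> borel_measurable M" by (rule borel_measurable_AE_eq[OF g assms(2)])
  show "integrable M f" by (rule integrable_cong_AE[OF f g assms(2), THEN iffD2, OF assms(1)])
  show "(LINT x|M. f x) = (LINT x|M. g x)" by (rule integral_cong_AE[OF f g assms(2)])
qed

lemma Lip_c_scale:
  assumes w: "w \<in> Lip_c \<Omega>"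
  shows "(\<lambda>x. c * w x) \<in> Lip_c \<Omega>" "AE x in M. grad_A A (\<lambda>x. c * w x) x = c *\<^sub>R grad_A A w x"
proof -
  obtain C K where C: "C-lipschitz_on UNIV w" "compact K" "K \<subseteq> \<Omega>" "\<And>x. x \<notin> K \<Longrightarrow> w x = 0"
    by (rule Lip_cE[OF w]) (rule that)
  have "(\<bar>c\<bar> * C)-lipschitz_on UNIV (\<lambda>x. c * w x)"
  proof (rule lipschitz_onI)
    show "0 \<le> \<bar>c\<bar> * C" using lipschitz_on_nonneg[OF C(1)] by simp
    fix x y show "dist (c * w x) (c * w y) \<le> \<bar>c\<bar> * C * dist x y"
      using mult_left_mono[OF lipschitz_onD[OF C(1), of x y], of "\<bar>c\<bar>"]
      by (simp add: dist_real_def mult.assoc flip: abs_mult right_diff_distrib)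
  qed
  then show "(\<lambda>x. c * w x) \<in> Lip_c \<Omega>" using C(2,3) by (rule Lip_cI) (use C(4) in auto)
  show "AE x in M. grad_A A (\<lambda>x. c * w x) x = c *\<^sub>R grad_A A w x"
    using Lip_c_AE_differentiable[OF w]
  proof eventually_elim
    case (elim x)
    have "((\<lambda>x. c * w x) has_derivative (\<lambda>h. (c *\<^sub>R grad w x) \<bullet> h)) (at x)"
      using has_derivative_mult_right[OF grad_has_derivative[OF elim], of c] by simp
    from grad_eqI[OF this] show ?case by (simp add: grad_A_def matrix_vector_mult_scaleR)
  qed
qed

lemma Lip_c_gradient_integrable:
  assumes "w \<in> Lip_c \<Omega>"
  shows "integrable M (\<lambda>x. norm (grad_A A w x))" "0 \<le> (LINT x|M. norm (grad_A A w x))"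
  using L2_imp_integrable[OF Lip_c_grad_A(1)[OF assms]] by (auto intro: integral_nonneg_AE)

lemma Lip_c_Young_integrable:
  assumes m: "1 < m" and w: "w \<in> Lip_c \<Omega>"
  shows "integrable M (\<lambda>x. Young m \<bar>w x\<bar>)"
proof -
  obtain c where c: "\<And>x. \<bar>w x\<bar> \<le> c" using Lip_c_grad_A(4)[OF w] by blast
  show ?thesis
  proof (rule integrable_const_bound[where B = "Young m c"])
    show "AE x in M. norm (Young m \<bar>w x\<bar>) \<le> Young m c"
      using c by (intro AE_I2) (auto simp: Young_nonneg[OF m] intro!: Young_mono[OF m])
  qed (rule Young_measurable[OF m Lip_c_grad_A(5)[OF w]])
qed

text \<open>Composing with \<open>Young m\<close> removes the inverse. Passing to the absolute value
  of the constant only weakens the bound, as the gradient norm is nonnegative, and yields the sign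
  that later scalings use.\<close>

lemma orlicz_sobolev_constant:
  assumes m: "1 < m" and O: "orlicz_sobolev_bump \<Omega> A (Young m)"
  obtains C where "0 \<le> C" "\<And>w. w \<in> Lip_c \<Omega> \<Longrightarrow>
    (LINT x|M. Young m \<bar>w x\<bar>) \<le> Young m (C * (LINT x|M. norm (grad_A A w x)))"
proof -
  from O obtain C where C: "\<And>w. w \<in> Lip_c \<Omega> \<Longrightarrow>
     inv_into {0..} (Young m) (LINT x|M. Young m \<bar>w x\<bar>) \<le> C * (LINT x|M. norm (grad_A A w x))"
    unfolding orlicz_sobolev_bump_def by blast
  show thesis
  proof
    show "0 \<le> \<bar>C\<bar>" by simp
    fix w assume w: "w \<in> Lip_c \<Omega>"
    have "C * (LINT x|M. norm (grad_A A w x)) \<le> \<bar>C\<bar> * (LINT x|M. norm (grad_A A w x))"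
      using Lip_c_gradient_integrable(2)[OF w] by (intro mult_right_mono) auto
    with C[OF w] have "inv_into {0..} (Young m) (LINT x|M. Young m \<bar>w x\<bar>) \<le> \<bar>C\<bar> * (LINT x|M. norm (grad_A A w x))"
      by linarith
    then show "(LINT x|M. Young m \<bar>w x\<bar>) \<le> Young m (\<bar>C\<bar> * (LINT x|M. norm (grad_A A w x)))"
      by (intro Young_le_if_inv_le[OF m]) (auto intro!: integral_nonneg_AE simp: Young_nonneg[OF m])
  qed
qed

text \<open>Normalising a function by its gradient norm fails when that norm is zero; the
  Orlicz-Sobolev inequality disposes of this case.\<close>

lemma gradient_zero_imp_zero:
  assumes m: "1 < m" and O: "orlicz_sobolev_bump \<Omega> A (Young m)"
    and w: "w \<in> Lip_c \<Omega>" and z: "(LINT x|M. norm (grad_A A w x)) = 0"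
  shows "AE x in M. w x = 0"
proof -
  obtain C where "0 \<le> C" "\<And>w. w \<in> Lip_c \<Omega> \<Longrightarrow>
    (LINT x|M. Young m \<bar>w x\<bar>) \<le> Young m (C * (LINT x|M. norm (grad_A A w x)))"
    by (rule orlicz_sobolev_constant[OF m O]) (rule that)
  from this(2)[OF w] have "(LINT x|M. Young m \<bar>w x\<bar>) \<le> 0" by (simp add: z)
  moreover have "0 \<le> (LINT x|M. Young m \<bar>w x\<bar>)" by (intro integral_nonneg_AE) (simp add: Young_nonneg[OF m])
  ultimately have "(LINT x|M. Young m \<bar>w x\<bar>) = 0" by simp
  then have "AE x in M. Young m \<bar>w x\<bar> = 0"
    using integral_nonneg_eq_0_iff_AE[OF Lip_c_Young_integrable[OF m w]] by (simp add: Young_nonneg[OF m])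
  then show ?thesis
  proof eventually_elim
    case (elim x)
    then show ?case using Young_strict_mono[OF m, of 0 "\<bar>w x\<bar>"] by (cases "w x = 0") auto
  qed
qed

text \<open>The admissibility norm is a supremum over unit gradient norm, so the estimate is the one
  for \<open>w / I\<close> rescaled, with \<open>I\<close> the gradient norm of \<open>w\<close>. If
  \<open>I = 0\<close>, both \<open>w\<close> and its gradient vanish almost everywhere and so does
  the left side.\<close>

lemma admissible_le:
  assumes m: "1 < m" and O: "orlicz_sobolev_bump \<Omega> A (Young m)"
    and adm: "admissible \<Omega> A \<phi>\<^sub>0 \<phi>\<^sub>1" and w: "w \<in> Lip_c \<Omega>"
  shows "(LINT x|M. \<phi>\<^sub>0 x * w x + \<phi>\<^sub>1 x \<bullet> grad_A A w x) \<le> enn2real (X_norm \<Omega> A \<phi>\<^sub>0 \<phi>\<^sub>1) * (LINT x|M. norm (grad_A A w x))"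
proof -
  let ?X = "X_norm \<Omega> A \<phi>\<^sub>0 \<phi>\<^sub>1"
  define I where "I = (LINT x|M. norm (grad_A A w x))"
  have gi: "integrable M (\<lambda>x. norm (grad_A A w x))" and I0: "0 \<le> I"
    using Lip_c_gradient_integrable[OF w] by (auto simp: I_def)
  show ?thesis
  proof (cases "I = 0")
    case True
    have "AE x in M. w x = 0" by (rule gradient_zero_imp_zero[OF m O w True[unfolded I_def]])
    moreover have "AE x in M. norm (grad_A A w x) = 0"
      using integral_nonneg_eq_0_iff_AE[OF gi] True by (simp add: I_def)
    ultimately have "AE x in M. \<phi>\<^sub>0 x * w x + \<phi>\<^sub>1 x \<bullet> grad_A A w x = 0" by eventually_elim simp
    then have "(LINT x|M. \<phi>\<^sub>0 x * w x + \<phi>\<^sub>1 x \<bullet> grad_A A w x) = 0" by (rule integral_eq_zero_AE)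
    then show ?thesis using True by (simp add: I_def)
  next
    case False
    define v where "v = (\<lambda>x. (1 / I) * w x)"
    define g where "g = grad_A A v"
    have vL: "v \<in> Lip_c \<Omega>" and gv: "AE x in M. g x = (1 / I) *\<^sub>R grad_A A w x"
      using Lip_c_scale[OF w, of "1 / I"] by (auto simp: v_def g_def)
    have "(LINT x|M. norm (g x)) = (LINT x|M. norm (grad_A A w x) / I)"
    proof (rule integral_cong_AE_complete(2))
      show "AE x in M. norm (g x) = norm (grad_A A w x) / I"
        using gv by eventually_elim (use I0 in \<open>simp add: divide_inverse mult.commute\<close>)
    qed (use gi in simp)
    also have "\<dots> = 1" using False by (simp add: I_def)
    finally have g1: "(LINT x|M. norm (g x)) = 1" .
    have "(v, g) \<in> W11_0 \<Omega> A"
      unfolding W11_0_def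
    proof (intro CollectI case_prodI conjI allI impI)
      show "integrable M v" by (rule L2_imp_integrable[OF Lip_c_grad_A(2)[OF vL]])
      show "integrable M g" unfolding g_def by (rule L2_imp_integrable[OF Lip_c_grad_A(1)[OF vL]])
      show "\<exists>w\<in>Lip_c \<Omega>. (LINT x|M. \<bar>v x - w x\<bar> + norm (g x - grad_A A w x)) < \<epsilon>" if "0 < \<epsilon>" for \<epsilon>
        using vL that by (intro bexI[of _ v]) (auto simp: g_def)
    qed
    then have u: "(v, g) \<in> unit_W11_0 \<Omega> A" using g1 by (simp add: unit_W11_0_def)
    have i: "integrable M (\<lambda>x. v x * \<phi>\<^sub>0 x)" "integrable M (\<lambda>x. g x \<bullet> \<phi>\<^sub>1 x)" and X: "?X < \<infinity>"
      using adm u unfolding admissible_def by auto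
    have "ennreal \<bar>LINT x|M. v x * \<phi>\<^sub>0 x\<bar> \<le> (SUP (v, g) \<in> unit_W11_0 \<Omega> A. ennreal \<bar>LINT x|M. v x * \<phi>\<^sub>0 x\<bar>)"
      by (rule SUP_upper2[OF u]) simp
    moreover have "ennreal \<bar>LINT x|M. g x \<bullet> \<phi>\<^sub>1 x\<bar> \<le> (SUP (v, g) \<in> unit_W11_0 \<Omega> A. ennreal \<bar>LINT x|M. g x \<bullet> \<phi>\<^sub>1 x\<bar>)"
      by (rule SUP_upper2[OF u]) simp
    ultimately have "ennreal \<bar>LINT x|M. v x * \<phi>\<^sub>0 x\<bar> + ennreal \<bar>LINT x|M. g x \<bullet> \<phi>\<^sub>1 x\<bar> \<le> ?X"
      unfolding X_norm_def by (rule add_mono)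
    then have "ennreal (\<bar>LINT x|M. v x * \<phi>\<^sub>0 x\<bar> + \<bar>LINT x|M. g x \<bullet> \<phi>\<^sub>1 x\<bar>) \<le> ennreal (enn2real ?X)"
      using X by simp
    then have le: "\<bar>LINT x|M. v x * \<phi>\<^sub>0 x\<bar> + \<bar>LINT x|M. g x \<bullet> \<phi>\<^sub>1 x\<bar> \<le> enn2real ?X"
      by (subst (asm) ennreal_le_iff) auto
    have "(LINT x|M. \<phi>\<^sub>0 x * w x + \<phi>\<^sub>1 x \<bullet> grad_A A w x) = (LINT x|M. I * (v x * \<phi>\<^sub>0 x + g x \<bullet> \<phi>\<^sub>1 x))"
    proof (rule integral_cong_AE_complete(2))
      show "integrable M (\<lambda>x. I * (v x * \<phi>\<^sub>0 x + g x \<bullet> \<phi>\<^sub>1 x))" using i by simp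
      show "AE x in M. \<phi>\<^sub>0 x * w x + \<phi>\<^sub>1 x \<bullet> grad_A A w x = I * (v x * \<phi>\<^sub>0 x + g x \<bullet> \<phi>\<^sub>1 x)"
        using gv
      proof eventually_elim
        case (elim x)
        have e: "grad_A A w x = I *\<^sub>R g x" "w x = I * v x" using elim False by (auto simp: v_def)
        show ?case unfolding e by (simp add: inner_commute algebra_simps)
      qed
    qed
    also have "\<dots> = I * ((LINT x|M. v x * \<phi>\<^sub>0 x) + (LINT x|M. g x \<bullet> \<phi>\<^sub>1 x))" using i by simp
    also have "\<dots> \<le> I * enn2real ?X" using le I0 by (intro mult_left_mono) auto
    finally show ?thesis by (simp add: I_def mult.commute)
  qed
qed

section \<open>Energy estimate above a level\<close>

text \<open>The functions \<open>max (w n - k) 0\<close> are admissible as test functions, whereas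
  \<open>max (v - k) 0\<close> need not be; the inequality passes to the limit because
  \<open>q n\<close> tends to \<open>p\<close> in L2. The convergence of the L1 norms is exported
  for the Orlicz-Sobolev inequality, which is again applied before the limit.\<close>

lemma energy_estimate:
  fixes \<A> :: "real ^ 'n \<Rightarrow> real \<Rightarrow> real ^ 'n ^ 'n" and u :: "real ^ 'n \<Rightarrow> real"
  assumes m: "1 < m" and O: "orlicz_sobolev_bump \<Omega> A (Young m)"
    and adm: "admissible \<Omega> A \<phi>\<^sub>0 \<phi>\<^sub>1" and sub: "weak_subsolution \<Omega> A \<A> \<phi>\<^sub>0 \<phi>\<^sub>1 u"
    and \<A>: "\<And>x z. x \<in> \<Omega> \<Longrightarrow> sym_psd (\<A> x z)"
    and ell: "AE x in M. \<forall>\<xi> z. lam * (\<xi> \<bullet> (A x *v \<xi>)) \<le> \<xi> \<bullet> (\<A> x z *v \<xi>)"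
    and k: "0 \<le> k"
    and v: "v = (\<lambda>x. max (u x - l) 0)" and G: "is_weak_grad \<Omega> A v G"
    and w: "\<And>n. w n \<in> Lip_c \<Omega>" "AE x in M. (\<lambda>n. w n x) \<longlonglongrightarrow> v x"
      "AE x in M. (\<lambda>n. grad_A A (w n) x) \<longlonglongrightarrow> G x"
      "(\<lambda>n. LINT x|M. (norm (G x - grad_A A (w n) x))\<^sup>2) \<longlonglongrightarrow> 0"
    and vL: "v \<in> L2 \<Omega>"
  defines "p \<equiv> \<lambda>x. if k < v x then G x else 0" and "q \<equiv> \<lambda>n x. if k < w n x then grad_A A (w n) x else 0"
  shows "lam * (LINT x|M. (norm (p x))\<^sup>2) \<le> enn2real (X_norm \<Omega> A \<phi>\<^sub>0 \<phi>\<^sub>1) * (LINT x|M. norm (p x))"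
    and "(\<lambda>n. LINT x|M. norm (q n x)) \<longlonglongrightarrow> (LINT x|M. norm (p x))" and "p \<in> L2 \<Omega>"
proof -
  let ?X = "enn2real (X_norm \<Omega> A \<phi>\<^sub>0 \<phi>\<^sub>1)"
  have const: "(\<lambda>x. c) \<in> L2 \<Omega>" for c :: real by (rule bounded_L2[where c = "norm c"]) auto
  have GL: "G \<in> L2 \<Omega>" using G by (simp add: is_weak_grad_def)
  \<comment> \<open>Locality applied to \<open>v - k\<close>, which has the same weak gradient
    \<open>G\<close>.\<close>
  have Gk: "AE x in M. v x = k \<longrightarrow> G x = 0"
    using weak_grad_zero_AE[OF L2_diff[OF vL const] is_weak_grad_diff[OF vL G const is_weak_grad_const], of k]
    by eventually_elim simp
  have vm: "v \<in> borel_measurable M" using vL by (simp add: L2_def)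
  note tg = truncated_gradient_tendsto[OF Lip_c_grad_A(5)[OF w(1)] w(2) vm Lip_c_grad_A(1)[OF w(1)] w(3,4) GL Gk]
  show pL: "p \<in> L2 \<Omega>" unfolding p_def by (rule tg(1))
  have qL: "q n \<in> L2 \<Omega>" for n unfolding q_def by (rule tg(2))
  have ql: "AE x in M. (\<lambda>n. q n x) \<longlonglongrightarrow> p x" unfolding p_def q_def by (rule tg(3))
  have pq: "(\<lambda>n. LINT x|M. (norm (p x - q n x))\<^sup>2) \<longlonglongrightarrow> 0" unfolding p_def q_def by (rule tg(4))
  have dL: "(\<lambda>x. p x - q n x) \<in> L2 \<Omega>" for n by (rule L2_diff[OF pL qL])
  note pair = L2_pairing_tendsto_0[OF _ dL pq]
  have pi: "integrable M (\<lambda>x. norm (p x))" and qi: "integrable M (\<lambda>x. norm (q n x))" for n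
    using L2_imp_integrable[OF pL] L2_imp_integrable[OF qL[of n]] by auto
  show np: "(\<lambda>n. LINT x|M. norm (q n x)) \<longlonglongrightarrow> (LINT x|M. norm (p x))"
  proof (rule LIM_zero_cancel, rule Lim_null_comparison)
    show "eventually (\<lambda>n. norm ((LINT x|M. norm (q n x)) - (LINT x|M. norm (p x))) \<le> (LINT x|M. norm (1::real) * norm (p x - q n x))) sequentially"
    proof (intro always_eventually allI)
      fix n
      have "(LINT x|M. norm (q n x)) - (LINT x|M. norm (p x)) = (LINT x|M. norm (q n x) - norm (p x))" using pi qi by simp
      also have "norm \<dots> \<le> (LINT x|M. norm (1::real) * norm (p x - q n x))"
        unfolding real_norm_def[of "LINT x|M. norm (q n x) - norm (p x)"]
        using pair(2)[OF const[of 1], of n] pi qi norm_triangle_ineq3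
        by (intro integral_abs_bound_integral) (auto simp: norm_minus_commute[of "p _"])
      finally show "norm ((LINT x|M. norm (q n x)) - (LINT x|M. norm (p x))) \<le> (LINT x|M. norm (1::real) * norm (p x - q n x))" .
    qed
    show "(\<lambda>n. LINT x|M. norm (1::real) * norm (p x - q n x)) \<longlonglongrightarrow> 0" by (rule pair(1)[OF const])
  qed
  define H where "H = weak_grad \<Omega> A u"
  have uL: "u \<in> L2 \<Omega>" using sub by (simp add: weak_subsolution_def W12_def)
  have "\<exists>g. is_weak_grad \<Omega> A u g" using sub by (simp add: weak_subsolution_def W12_def)
  then have H: "is_weak_grad \<Omega> A u H" unfolding H_def weak_grad_def by (rule someI_ex)
  have HL: "H \<in> L2 \<Omega>" using H by (simp add: is_weak_grad_def)
  \<comment> \<open>Locality applied to \<open>u - l - v\<close>, which vanishes wherever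
    \<open>v\<close> is positive.\<close>
  have HG: "AE x in M. k < v x \<longrightarrow> H x = G x"
    using weak_grad_zero_AE[OF L2_diff[OF L2_diff[OF uL const] vL]
      is_weak_grad_diff[OF L2_diff[OF uL const] is_weak_grad_diff[OF uL H const is_weak_grad_const] vL G], of l]
    by eventually_elim (use k in \<open>auto simp: v max_def split: if_splits\<close>)
  obtain N where N: "sqrt_factor \<Omega> A (\<lambda>x. \<A> x (u x)) N"
    and test: "\<And>w. w \<in> Lip_c \<Omega> \<Longrightarrow> (\<forall>x. 0 \<le> w x) \<Longrightarrow>
      integrable M (\<lambda>x. (N x *v H x) \<bullet> (N x *v grad_A A w x)) \<and>
      (LINT x|M. (N x *v H x) \<bullet> (N x *v grad_A A w x)) \<le> (LINT x|M. \<phi>\<^sub>0 x * w x + \<phi>\<^sub>1 x \<bullet> grad_A A w x)"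
    using sub unfolding weak_subsolution_def H_def by blast
  obtain b where b: "\<And>x. x \<in> \<Omega> \<Longrightarrow> norm (N x) \<le> b" "0 \<le> b"
  proof -
    from N have "bounded (N ` \<Omega>)" by (simp add: sqrt_factor_def)
    then obtain b where "\<And>x. x \<in> \<Omega> \<Longrightarrow> norm (N x) \<le> b" by (auto simp: bounded_iff)
    then have "norm (N x) \<le> max b 0" if "x \<in> \<Omega>" for x using that by fastforce
    then show thesis using that[of "max b 0"] by simp
  qed
  define F where "F x = (N x *v H x) \<bullet> (N x *v p x)" for x
  define Fn where "Fn n x = (N x *v H x) \<bullet> (N x *v q n x)" for n x
  have Fn: "integrable M (Fn n)" "(LINT x|M. Fn n x) \<le> ?X * (LINT x|M. norm (q n x))" for n
  proof -
    let ?t = "\<lambda>x. max (w n x - k) 0"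
    note tr = Lip_c_truncate[OF w(1) k, of n]
    have 1: "integrable M (\<lambda>x. (N x *v H x) \<bullet> (N x *v grad_A A ?t x))"
      "(LINT x|M. (N x *v H x) \<bullet> (N x *v grad_A A ?t x)) \<le> (LINT x|M. \<phi>\<^sub>0 x * ?t x + \<phi>\<^sub>1 x \<bullet> grad_A A ?t x)"
      using test[OF tr(1)] by auto
    have "AE x in M. Fn n x = (N x *v H x) \<bullet> (N x *v grad_A A ?t x)"
      using tr(2) by eventually_elim (simp add: Fn_def q_def)
    note eq = integral_cong_AE_complete[OF 1(1) this]
    show "integrable M (Fn n)" by (rule eq(1))
    have "(LINT x|M. norm (q n x)) = (LINT x|M. norm (grad_A A ?t x))"
      by (rule integral_cong_AE_complete(2)[OF Lip_c_gradient_integrable(1)[OF tr(1)]])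
        (use tr(2) in \<open>auto elim!: eventually_mono simp: q_def\<close>)
    then show "(LINT x|M. Fn n x) \<le> ?X * (LINT x|M. norm (q n x))"
      unfolding eq(2) using order_trans[OF 1(2) admissible_le[OF m O adm tr(1)]] by simp
  qed
  define c where "c = (real CARD('n) * b) * (real CARD('n) * b)"
  have bd: "AE x in M. \<bar>F x - Fn n x\<bar> \<le> c * (norm (H x) * norm (p x - q n x))" for n
    using AE_in_\<Omega>
  proof eventually_elim
    case (elim x)
    have nb: "norm (N x *v y) \<le> real CARD('n) * b * norm y" for y
      using order_trans[OF norm_matrix_vector_le[of "N x" y] mult_left_mono[OF mult_right_mono[OF b(1)[OF elim]]]]
      by (simp add: mult.assoc)
    have "F x - Fn n x = (N x *v H x) \<bullet> (N x *v (p x - q n x))"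
      by (simp add: F_def Fn_def matrix_vector_mult_diff_distrib inner_diff_right)
    also have "\<bar>\<dots>\<bar> \<le> norm (N x *v H x) * norm (N x *v (p x - q n x))" by (rule Cauchy_Schwarz_ineq2)
    also have "\<dots> \<le> (real CARD('n) * b * norm (H x)) * (real CARD('n) * b * norm (p x - q n x))"
      using b(2) by (intro mult_mono nb) auto
    finally show ?case by (simp add: c_def mult_ac)
  qed
  \<comment> \<open>\<open>sqrt_factor\<close> says nothing on the measurability of
    \<open>N\<close>, so \<open>F\<close> is recognised as the pointwise limit of the integrable
    \<open>Fn n\<close>.\<close>
  have Fm: "F \<in> borel_measurable M"
  proof (rule borel_measurable_AE_eq)
    show "(\<lambda>x. lim (\<lambda>n. Fn n x)) \<in> borel_measurable M"
      using borel_measurable_integrable[OF Fn(1)] by (rule borel_measurable_lim_metric)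
    show "AE x in M. F x = lim (\<lambda>n. Fn n x)"
      using ql
    proof eventually_elim
      case (elim x)
      have "(\<lambda>n. N x *v q n x) \<longlonglongrightarrow> N x *v p x"
        by (rule bounded_linear.tendsto[OF matrix_vector_mul_bounded_linear elim])
      then have "(\<lambda>n. Fn n x) \<longlonglongrightarrow> F x" unfolding Fn_def F_def by (intro tendsto_inner tendsto_const)
      then show ?case by (simp add: limI)
    qed
  qed
  have cHi: "integrable M (\<lambda>x. c * (norm (H x) * norm (p x - q n x)))" for n
    using pair(2)[OF HL, of n] by simp
  have di: "integrable M (\<lambda>x. F x - Fn n x)" for n
  proof (rule Bochner_Integration.integrable_bound[OF cHi])
    show "(\<lambda>x. F x - Fn n x) \<in> borel_measurable M"
      using Fm borel_measurable_integrable[OF Fn(1)] by (rule borel_measurable_diff)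
    show "AE x in M. norm (F x - Fn n x) \<le> norm (c * (norm (H x) * norm (p x - q n x)))"
      using bd[of n] by eventually_elim simp
  qed
  have Fi: "integrable M F"
    using Bochner_Integration.integrable_add[OF di[of 0] Fn(1)[of 0]] by simp
  have "(\<lambda>n. LINT x|M. Fn n x) \<longlonglongrightarrow> (LINT x|M. F x)"
  proof (rule LIM_zero_cancel, rule Lim_null_comparison)
    show "eventually (\<lambda>n. norm ((LINT x|M. Fn n x) - (LINT x|M. F x)) \<le> c * (LINT x|M. norm (H x) * norm (p x - q n x))) sequentially"
    proof (intro always_eventually allI)
      fix n
      have "norm ((LINT x|M. Fn n x) - (LINT x|M. F x)) = \<bar>LINT x|M. F x - Fn n x\<bar>" using Fi Fn(1) by simp
      also have "\<dots> \<le> (LINT x|M. \<bar>F x - Fn n x\<bar>)" by (rule integral_abs_bound)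
      also have "\<dots> \<le> (LINT x|M. c * (norm (H x) * norm (p x - q n x)))"
        by (intro integral_mono_AE integrable_abs di cHi bd)
      finally show "norm ((LINT x|M. Fn n x) - (LINT x|M. F x)) \<le> c * (LINT x|M. norm (H x) * norm (p x - q n x))"
        by simp
    qed
    show "(\<lambda>n. c * (LINT x|M. norm (H x) * norm (p x - q n x))) \<longlonglongrightarrow> 0"
      using tendsto_mult[OF tendsto_const[of c] pair(1)[OF HL]] by simp
  qed
  from LIMSEQ_le[OF this tendsto_mult[OF tendsto_const[of ?X] np]] Fn(2)
  have FX: "(LINT x|M. F x) \<le> ?X * (LINT x|M. norm (p x))" by blast
  \<comment> \<open>Ellipticity controls \<open>N x\<close> on the range of the square root.
    \<open>G x\<close> is reached as the limit of \<open>grad_A A (w n) x\<close>, which lie in that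
    range.\<close>
  have low: "AE x in M. lam * (norm (p x))\<^sup>2 \<le> F x"
  proof -
    from N have "AE x in M. mat_sqrt (\<A> x (u x)) = N x ** mat_sqrt (A x)" by (simp add: sqrt_factor_def)
    with HG ell w(3) AE_in_\<Omega> show ?thesis
    proof eventually_elim
      case (elim x)
      show ?case
      proof (cases "k < v x")
        case True
        have "lam * (norm (grad_A A (w n) x))\<^sup>2 \<le> (norm (N x *v grad_A A (w n) x))\<^sup>2" for n
        proof -
          let ?g = "grad (w n) x"
          have "N x *v grad_A A (w n) x = mat_sqrt (\<A> x (u x)) *v ?g"
            by (simp add: elim(5) grad_A_def matrix_vector_mul_assoc)
          then have "(norm (N x *v grad_A A (w n) x))\<^sup>2 = ?g \<bullet> (\<A> x (u x) *v ?g)"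
            by (simp add: norm_mat_sqrt[OF \<A>[OF elim(4)]])
          moreover have "(norm (grad_A A (w n) x))\<^sup>2 = ?g \<bullet> (A x *v ?g)"
            by (simp add: grad_A_def norm_mat_sqrt[OF psd[OF elim(4)]])
          ultimately show ?thesis using elim(2) by simp
        qed
        moreover have "(\<lambda>n. lam * (norm (grad_A A (w n) x))\<^sup>2) \<longlonglongrightarrow> lam * (norm (G x))\<^sup>2"
          by (rule tendsto_mult[OF tendsto_const tendsto_power[OF tendsto_norm[OF elim(3)]]])
        moreover have "(\<lambda>n. (norm (N x *v grad_A A (w n) x))\<^sup>2) \<longlonglongrightarrow> (norm (N x *v G x))\<^sup>2"
          by (rule tendsto_power[OF tendsto_norm[OF bounded_linear.tendsto[OF matrix_vector_mul_bounded_linear elim(3)]]])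
        ultimately have "lam * (norm (G x))\<^sup>2 \<le> (norm (N x *v G x))\<^sup>2" by (meson LIMSEQ_le)
        then show ?thesis using True elim(1) by (simp add: F_def p_def power2_norm_eq_inner)
      qed (simp add: F_def p_def)
    qed
  qed
  have p2: "integrable M (\<lambda>x. (norm (p x))\<^sup>2)" using pL by (simp add: L2_def)
  have "lam * (LINT x|M. (norm (p x))\<^sup>2) = (LINT x|M. lam * (norm (p x))\<^sup>2)" by simp
  also have "\<dots> \<le> (LINT x|M. F x)" using p2 by (intro integral_mono_AE Fi low) simp
  finally show "lam * (LINT x|M. (norm (p x))\<^sup>2) \<le> ?X * (LINT x|M. norm (p x))" using FX by linarith
qed

end

section \<open>Decay of level sets and the uniform bound\<close>

context lipschitz_sqrt
begin

text \<open>Integrate \<open>t \<le> t\<^sup>2 / (2 * a) + a / 2\<close> with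
  \<open>t = norm (p x)\<close> over the support of \<open>p\<close>. By the energy bound the
  quadratic term is at most half of the left side, and the rest is half of the claimed
  bound.\<close>

lemma gradient_level_set_le:
  assumes p: "p \<in> L2 \<Omega>" and supp: "\<And>x. x \<notin> S \<Longrightarrow> p x = 0" and S: "S \<inter> \<Omega> \<in> sets M" and a: "0 < a"
    and e: "(LINT x|M. (norm (p x))\<^sup>2) \<le> a * (LINT x|M. norm (p x))"
  shows "(LINT x|M. norm (p x)) \<le> a * measure M (S \<inter> \<Omega>)"
proof -
  have i: "integrable M (\<lambda>x. norm (p x))" and i2: "integrable M (\<lambda>x. (norm (p x))\<^sup>2)"
    using L2_imp_integrable[OF p] p by (auto simp: L2_def)
  have i3: "integrable M (indicator (S \<inter> \<Omega>) :: _ \<Rightarrow> real)"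
    using S by (intro integrable_real_indicator) (auto simp: less_top[symmetric])
  have pt: "norm (p x) \<le> (1 / (2 * a)) * (norm (p x))\<^sup>2 + (a / 2) * indicator (S \<inter> \<Omega>) x" if "x \<in> \<Omega>" for x
  proof (cases "x \<in> S")
    case True
    have "0 \<le> (norm (p x) - a)\<^sup>2 / (2 * a)" using a by simp
    also have "\<dots> = (1 / (2 * a)) * (norm (p x))\<^sup>2 + a / 2 - norm (p x)"
      using a by (simp add: power2_eq_square field_simps)
    finally show ?thesis using True that by simp
  next
    case False
    then show ?thesis using supp[OF False] by simp
  qed
  have "(LINT x|M. norm (p x)) \<le> (LINT x|M. (1 / (2 * a)) * (norm (p x))\<^sup>2 + (a / 2) * indicator (S \<inter> \<Omega>) x)"
    by (intro integral_mono i Bochner_Integration.integrable_add integrable_mult_right i2 i3 pt) simp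
  also have "\<dots> = (1 / (2 * a)) * (LINT x|M. (norm (p x))\<^sup>2) + (a / 2) * measure M (S \<inter> \<Omega>)"
    using i2 i3 S by simp
  also have "\<dots> \<le> (1 / (2 * a)) * (a * (LINT x|M. norm (p x))) + (a / 2) * measure M (S \<inter> \<Omega>)"
    using e a by (intro add_mono mult_left_mono) auto
  finally show ?thesis using a by simp
qed

text \<open>The constant \<open>C + 1\<close> in place of the Sobolev constant \<open>C\<close> leaves the room needed to pass to the limit of
  the approximations of \<open>max (u - l) 0\<close> in \<open>Lip_c \<Omega>\<close>.\<close>

lemma level_set_decay:
  fixes \<A> :: "real ^ 'n \<Rightarrow> real \<Rightarrow> real ^ 'n ^ 'n" and u :: "real ^ 'n \<Rightarrow> real"
  assumes m: "1 < m" and O: "orlicz_sobolev_bump \<Omega> A (Young m)"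
    and C: "0 \<le> C" "\<And>w. w \<in> Lip_c \<Omega> \<Longrightarrow>
      (LINT x|M. Young m \<bar>w x\<bar>) \<le> Young m (C * (LINT x|M. norm (grad_A A w x)))"
    and adm: "admissible \<Omega> A \<phi>\<^sub>0 \<phi>\<^sub>1" and sub: "weak_subsolution \<Omega> A \<A> \<phi>\<^sub>0 \<phi>\<^sub>1 u"
    and \<A>: "\<And>x z. x \<in> \<Omega> \<Longrightarrow> sym_psd (\<A> x z)"
    and ell: "AE x in M. \<forall>\<xi> z. lam * (\<xi> \<bullet> (A x *v \<xi>)) \<le> \<xi> \<bullet> (\<A> x z *v \<xi>)"
    and lam: "0 < lam" and a: "0 < a" "enn2real (X_norm \<Omega> A \<phi>\<^sub>0 \<phi>\<^sub>1) \<le> lam * a"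
    and v: "(\<lambda>x. max (u x - l) 0) \<in> W12_0 \<Omega> A"
  defines "\<mu> \<equiv> \<lambda>k. measure M {x \<in> \<Omega>. k < max (u x - l) 0}"
  assumes k: "0 \<le> k" "0 < \<mu> k" and d: "0 < d"
  shows "\<mu> (k + (C + 1) * a * d) * Young m (exp (2 powr m) * d / \<mu> k) \<le> exp (3 powr m)"
proof -
  define v where "v x = max (u x - l) 0" for x
  have veq: "v = (\<lambda>x. max (u x - l) 0)" by (simp add: v_def[abs_def])
  have vW: "v \<in> W12_0 \<Omega> A" unfolding veq by fact
  have vL: "v \<in> L2 \<Omega>" using vW by (simp add: W12_0_def W12_def)
  have vm [measurable]: "v \<in> borel_measurable M" using vL by (simp add: L2_def)
  obtain G where G: "is_weak_grad \<Omega> A v G" using vW by (auto simp: W12_0_def W12_def)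
  obtain w :: "nat \<Rightarrow> real ^ 'n \<Rightarrow> real" where w: "\<And>n. w n \<in> Lip_c \<Omega>" "AE x in M. (\<lambda>n. w n x) \<longlonglongrightarrow> v x"
    "AE x in M. (\<lambda>n. grad_A A (w n) x) \<longlonglongrightarrow> G x"
    "(\<lambda>n. LINT x|M. (norm (G x - grad_A A (w n) x))\<^sup>2) \<longlonglongrightarrow> 0"
    by (rule W12_0_approx[OF vW G]) (rule that)
  define p where "p = (\<lambda>x. if k < v x then G x else 0)"
  define q where "q = (\<lambda>n x. if k < w n x then grad_A A (w n) x else 0)"
  note ee = energy_estimate[OF m O adm sub _ ell k(1) veq G w vL]
  have en: "lam * (LINT x|M. (norm (p x))\<^sup>2) \<le> enn2real (X_norm \<Omega> A \<phi>\<^sub>0 \<phi>\<^sub>1) * (LINT x|M. norm (p x))"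
    "(\<lambda>n. LINT x|M. norm (q n x)) \<longlonglongrightarrow> (LINT x|M. norm (p x))" "p \<in> L2 \<Omega>"
    unfolding p_def q_def by (rule ee; rule \<A>; assumption)+
  let ?S = "{x. k < v x}"
  have Seq: "?S \<inter> \<Omega> = {x \<in> \<Omega>. k < max (u x - l) 0}" by (auto simp: v_def)
  have level: "{x \<in> \<Omega>. t < v x} \<in> sets M" for t
    using borel_measurable_less[OF borel_measurable_const vm, of t] by simp
  have \<mu>_eq: "\<mu> t = measure M {x \<in> \<Omega>. t < v x}" for t by (simp add: \<mu>_def v_def)
  have np0: "0 \<le> (LINT x|M. norm (p x))" by (simp add: integral_nonneg_AE)
  have pS: "(LINT x|M. norm (p x)) \<le> a * \<mu> k"
  proof -
    have "lam * (LINT x|M. (norm (p x))\<^sup>2) \<le> lam * a * (LINT x|M. norm (p x))"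
      using en(1) mult_right_mono[OF a(2) np0] by linarith
    then have "(LINT x|M. (norm (p x))\<^sup>2) \<le> a * (LINT x|M. norm (p x))" using lam by (simp add: mult.assoc)
    moreover have "?S \<inter> \<Omega> \<in> sets M" using level[of k] by (simp add: Int_def conj_commute)
    ultimately have "(LINT x|M. norm (p x)) \<le> a * measure M (?S \<inter> \<Omega>)"
      using en(3) a(1) by (intro gradient_level_set_le) (auto simp: p_def)
    then show ?thesis by (simp add: \<mu>_def Seq)
  qed
  \<comment> \<open>The scale at which the Sobolev bound, with \<open>C + 1\<close> in place of
    \<open>C\<close>, reaches the threshold \<open>exp (2 powr m)\<close>; the Young function has
    the value \<open>exp (3 powr m)\<close> there.\<close>
  define b where "b = exp (2 powr m) / ((C + 1) * a * \<mu> k)"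
  have den: "0 < (C + 1) * a * \<mu> k" using C(1) a(1) k(2) by simp
  have b: "0 < b" using den by (simp add: b_def)
  define f where "f n x = b * max (w n x - k) 0" for n x
  have fL: "f n \<in> Lip_c \<Omega>" for n unfolding f_def by (rule Lip_c_scale(1)[OF Lip_c_truncate(1)[OF w(1) k(1)]])
  have fg: "(LINT x|M. norm (grad_A A (f n) x)) = b * (LINT x|M. norm (q n x))" for n
  proof -
    have "AE x in M. norm (grad_A A (f n) x) = b * norm (q n x)"
      using Lip_c_scale(2)[OF Lip_c_truncate(1)[OF w(1) k(1)], of b n] Lip_c_truncate(2)[OF w(1) k(1), of n]
      by eventually_elim (use b in \<open>auto simp: f_def[abs_def] q_def\<close>)
    then have "AE x in M. b * norm (q n x) = norm (grad_A A (f n) x)" by (simp add: eq_commute)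
    from integral_cong_AE_complete(2)[OF Lip_c_gradient_integrable(1)[OF fL] this] show ?thesis by simp
  qed
  have "(\<lambda>n. C * (b * (LINT x|M. norm (q n x)))) \<longlonglongrightarrow> C * (b * (LINT x|M. norm (p x)))"
    by (intro tendsto_mult tendsto_const en(2))
  moreover have "C * (b * (LINT x|M. norm (p x))) < exp (2 powr m)"
  proof -
    have "C * (b * (LINT x|M. norm (p x))) \<le> C * (b * (a * \<mu> k))"
      using pS C(1) b by (intro mult_left_mono) auto
    also have "\<dots> < (C + 1) * (b * (a * \<mu> k))" using b a(1) k(2) by (intro mult_strict_right_mono) auto
    also have "\<dots> = b * ((C + 1) * a * \<mu> k)" by (simp add: mult_ac)
    also have "\<dots> = exp (2 powr m)" using less_imp_neq[OF den] unfolding b_def by (metis nonzero_eq_divide_eq)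
    finally show ?thesis .
  qed
  ultimately have "eventually (\<lambda>n. C * (b * (LINT x|M. norm (q n x))) < exp (2 powr m)) sequentially"
    by (rule order_tendstoD)
  then have ev: "eventually (\<lambda>n. (\<integral>\<^sup>+x. ennreal (Young m \<bar>f n x\<bar>) \<partial>M) \<le> ennreal (exp (3 powr m))) sequentially"
  proof eventually_elim
    case (elim n)
    have q0: "0 \<le> (LINT x|M. norm (q n x))" by (simp add: integral_nonneg_AE)
    have "(LINT x|M. Young m \<bar>f n x\<bar>) \<le> Young m (C * (b * (LINT x|M. norm (q n x))))"
      using C(2)[OF fL[of n]] by (simp add: fg)
    also have "\<dots> \<le> Young m (exp (2 powr m))" using elim q0 C(1) b by (intro Young_mono[OF m]) auto
    finally have "(LINT x|M. Young m \<bar>f n x\<bar>) \<le> exp (3 powr m)" using m by (simp add: Young_exp)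
    then show ?case
      using nn_integral_eq_integral[OF Lip_c_Young_integrable[OF m fL[of n]]]
      by (simp add: Young_nonneg[OF m] ennreal_leI)
  qed
  define T where "T = {x \<in> \<Omega>. k + (C + 1) * a * d < v x}"
  define Y where "Y = Young m (exp (2 powr m) * d / \<mu> k)"
  have Y0: "0 \<le> Y" unfolding Y_def using d k(2) by (intro Young_nonneg[OF m]) auto
  have T: "T \<in> sets M" unfolding T_def by (rule level)
  have fm: "(\<lambda>x. ennreal (Young m \<bar>f n x\<bar>)) \<in> borel_measurable M" for n
    using borel_measurable_integrable[OF Lip_c_Young_integrable[OF m fL[of n]]] by simp
  \<comment> \<open>Fatou's lemma takes the place of convergence of level sets: a strict inequality
    for \<open>v x\<close> holds for \<open>w n x\<close> from some index on.\<close>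
  have "AE x in M. ennreal Y * indicator T x \<le> liminf (\<lambda>n. ennreal (Young m \<bar>f n x\<bar>))"
    using w(2)
  proof eventually_elim
    case (elim x)
    show ?case
    proof (cases "x \<in> T")
      case True
      then have "eventually (\<lambda>n. k + (C + 1) * a * d < w n x) sequentially"
        using elim by (intro order_tendstoD) (auto simp: T_def)
      then have "eventually (\<lambda>n. ennreal Y \<le> ennreal (Young m \<bar>f n x\<bar>)) sequentially"
      proof eventually_elim
        case (elim n)
        \<comment> \<open>The factor \<open>(C + 1) * a\<close> in the level increment is there to
          cancel against \<open>b\<close>.\<close>
        have "b * ((C + 1) * a * d) = exp (2 powr m) * d / \<mu> k"
          using k(2) C(1) a(1) by (simp add: b_def)
        moreover have "b * ((C + 1) * a * d) \<le> f n x" unfolding f_def using elim b by (intro mult_left_mono) auto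
        ultimately have "exp (2 powr m) * d / \<mu> k \<le> \<bar>f n x\<bar>" by linarith
        then show ?case unfolding Y_def using d k(2) by (intro ennreal_leI Young_mono[OF m]) auto
      qed
      then show ?thesis using True by (simp add: Liminf_bounded)
    qed simp
  qed
  then have "(\<integral>\<^sup>+x. ennreal Y * indicator T x \<partial>M) \<le> (\<integral>\<^sup>+x. liminf (\<lambda>n. ennreal (Young m \<bar>f n x\<bar>)) \<partial>M)"
    by (rule nn_integral_mono_AE)
  also have "\<dots> \<le> liminf (\<lambda>n. \<integral>\<^sup>+x. ennreal (Young m \<bar>f n x\<bar>) \<partial>M)"
    by (rule nn_integral_liminf[OF fm])
  also have "\<dots> \<le> ennreal (exp (3 powr m))"
    using Liminf_mono[OF ev] by (simp add: Liminf_const)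
  also have "(\<integral>\<^sup>+x. ennreal Y * indicator T x \<partial>M) = ennreal Y * emeasure M T"
    by (rule nn_integral_cmult_indicator[OF T])
  also have "\<dots> = ennreal (\<mu> (k + (C + 1) * a * d) * Y)"
    unfolding \<mu>_eq T_def[symmetric] emeasure_eq_measure using Y0 by (simp add: mult.commute flip: ennreal_mult')
  finally show ?thesis unfolding Y_def by (subst (asm) ennreal_le_iff) auto
qed

text \<open>In units of \<open>c = (C + 1) * a\<close> the decay estimate contains neither
  \<open>a\<close> nor the data, so a single \<open>k\<close> from the iteration serves all
  equations at once. Keeping \<open>a\<close> free instead of fixing it as the quotient of the norm
  by \<open>lam\<close> allows for data of norm zero.\<close>

lemma subsolution_bound:
  fixes m lam :: real
  assumes m: "2 < m" and O: "orlicz_sobolev_bump \<Omega> A (Young m)" and lam: "0 < lam"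
  obtains K where "0 \<le> K" "\<And>\<A> \<phi>\<^sub>0 \<phi>\<^sub>1 u l a. \<lbrakk>\<And>x z. x \<in> \<Omega> \<Longrightarrow> sym_psd (\<A> x z);
      AE x in M. \<forall>\<xi> z. lam * (\<xi> \<bullet> (A x *v \<xi>)) \<le> \<xi> \<bullet> (\<A> x z *v \<xi>);
      admissible \<Omega> A \<phi>\<^sub>0 \<phi>\<^sub>1; weak_subsolution \<Omega> A \<A> \<phi>\<^sub>0 \<phi>\<^sub>1 u;
      (\<lambda>x. max (u x - l) 0) \<in> W12_0 \<Omega> A; 0 < a; enn2real (X_norm \<Omega> A \<phi>\<^sub>0 \<phi>\<^sub>1) \<le> lam * a\<rbrakk>
      \<Longrightarrow> AE x in M. u x \<le> l + K * a"
proof -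
  have m1: "1 < m" using m by simp
  obtain C where C: "0 \<le> C" "\<And>w. w \<in> Lip_c \<Omega> \<Longrightarrow>
    (LINT x|M. Young m \<bar>w x\<bar>) \<le> Young m (C * (LINT x|M. norm (grad_A A w x)))"
    by (rule orlicz_sobolev_constant[OF m1 O]) (rule that)
  define V where "V = measure M \<Omega> + 1"
  have V: "0 < V" by (simp add: V_def add_nonneg_pos)
  have "2 \<le> m" using m by simp
  from degiorgi_iteration[OF this V] obtain k where k: "0 < k"
    "\<forall>\<nu>::real \<Rightarrow> real. (\<forall>s\<ge>0. 0 \<le> \<nu> s \<and> \<nu> s \<le> V) \<longrightarrow> (\<forall>s\<ge>0. \<forall>t\<ge>s. \<nu> t \<le> \<nu> s) \<longrightarrow>
    (\<forall>s\<ge>0. \<forall>d>0. 0 < \<nu> s \<longrightarrow>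
      \<nu> (s + d) * Young m (exp (2 powr m) * d / \<nu> s) \<le> exp (3 powr m)) \<longrightarrow> \<nu> k = 0"
    by (elim exE conjE)
  show thesis
  proof
    show "0 \<le> (C + 1) * k" using C(1) k(1) by simp
    fix \<A> \<phi>\<^sub>0 \<phi>\<^sub>1 u l a
    assume \<A>: "\<And>x z. x \<in> \<Omega> \<Longrightarrow> sym_psd (\<A> x z)"
      and ell: "AE x in M. \<forall>\<xi> z. lam * (\<xi> \<bullet> (A x *v \<xi>)) \<le> \<xi> \<bullet> (\<A> x z *v \<xi>)"
      and adm: "admissible \<Omega> A \<phi>\<^sub>0 \<phi>\<^sub>1" and sub: "weak_subsolution \<Omega> A \<A> \<phi>\<^sub>0 \<phi>\<^sub>1 u"
      and v: "(\<lambda>x. max (u x - l) 0) \<in> W12_0 \<Omega> A" and a: "0 < a" "enn2real (X_norm \<Omega> A \<phi>\<^sub>0 \<phi>\<^sub>1) \<le> lam * a"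
    define \<mu> where "\<mu> t = measure M {x \<in> \<Omega>. t < max (u x - l) 0}" for t
    have um [measurable]: "(\<lambda>x. max (u x - l) 0) \<in> borel_measurable M"
      using v by (simp add: W12_0_def W12_def L2_def)
    have level: "{x \<in> \<Omega>. t < max (u x - l) 0} \<in> sets M" for t
      using borel_measurable_less[OF borel_measurable_const um, of t] by simp
    define c where "c = (C + 1) * a"
    have c: "0 < c" using C(1) a(1) by (simp add: c_def)
    have "\<mu> (c * k) = 0"
    proof (rule k(2)[rule_format, of "\<lambda>s. \<mu> (c * s)"])
      fix s :: real
      show "0 \<le> \<mu> (c * s) \<and> \<mu> (c * s) \<le> V"
      proof
        have "\<mu> (c * s) \<le> measure M \<Omega>" unfolding \<mu>_def using sets.top[of M] by (intro finite_measure_mono) auto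
        then show "\<mu> (c * s) \<le> V" by (simp add: V_def)
      qed (simp add: \<mu>_def)
    next
      fix s t :: real assume "s \<le> t"
      then have "c * s \<le> c * t" using c by simp
      then show "\<mu> (c * t) \<le> \<mu> (c * s)" unfolding \<mu>_def by (intro finite_measure_mono level) auto
    next
      fix s d :: real assume s: "0 \<le> s" "0 < d" "0 < \<mu> (c * s)"
      have "0 \<le> c * s" using s(1) c by simp
      from level_set_decay[OF m1 O C adm sub \<A> ell lam a v this s(3)[unfolded \<mu>_def] s(2)]
      show "\<mu> (c * (s + d)) * Young m (exp (2 powr m) * d / \<mu> (c * s)) \<le> exp (3 powr m)"
        by (simp add: \<mu>_def c_def distrib_left)
    qed
    then have "emeasure M {x \<in> \<Omega>. c * k < max (u x - l) 0} = 0"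
      by (simp add: \<mu>_def emeasure_eq_measure)
    then have "{x \<in> \<Omega>. c * k < max (u x - l) 0} \<in> null_sets M" using level by (simp add: null_setsI)
    then have "AE x in M. x \<notin> {x \<in> \<Omega>. c * k < max (u x - l) 0}" by (rule AE_not_in)
    with AE_in_\<Omega> show "AE x in M. u x \<le> l + (C + 1) * k * a"
    proof eventually_elim
      case (elim x)
      then have "max (u x - l) 0 \<le> c * k" by (simp add: not_less)
      then show ?case by (simp add: c_def mult_ac)
    qed
  qed
qed

end

theorem theorem10:
  fixes \<Omega> :: "(real ^ 'n) set"
    and A :: "real ^ 'n \<Rightarrow> real ^ 'n ^ 'n"
    and m lam Lam :: real
  assumes "open \<Omega>" "connected \<Omega>" "\<Omega> \<noteq> {}" "bounded \<Omega>"
    and "\<forall>x\<in>\<Omega>. sym_psd (A x)"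
    and "bounded ((\<lambda>x. mat_sqrt (A x)) ` \<Omega>)"
    and "\<exists>L. L-lipschitz_on \<Omega> (\<lambda>x. mat_sqrt (A x))"
    and "0 < lam" "lam \<le> Lam"
    and "m > 2"
    and "orlicz_sobolev_bump \<Omega> A (Young m)"
  shows "\<exists>C::real. 0 \<le> C \<and>
    (\<forall>(\<A> :: real ^ 'n \<Rightarrow> real \<Rightarrow> real ^ 'n ^ 'n) \<phi>\<^sub>0 \<phi>\<^sub>1 u.
      (\<forall>x\<in>\<Omega>. \<forall>z. sym_psd (\<A> x z)) \<and>
      (AE x in lebesgue_on \<Omega>. \<forall>\<xi> z.
         0 \<le> lam * (\<xi> \<bullet> (A x *v \<xi>)) \<and>
         lam * (\<xi> \<bullet> (A x *v \<xi>)) \<le> \<xi> \<bullet> (\<A> x z *v \<xi>) \<and>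
         \<xi> \<bullet> (\<A> x z *v \<xi>) \<le> Lam * (\<xi> \<bullet> (A x *v \<xi>))) \<and>
      admissible \<Omega> A \<phi>\<^sub>0 \<phi>\<^sub>1 \<and>
      weak_subsolution \<Omega> A \<A> \<phi>\<^sub>0 \<phi>\<^sub>1 u \<longrightarrow>
      esssup (lebesgue_on \<Omega>) (\<lambda>x. ereal (u x))
        \<le> boundary_sup \<Omega> A u + ereal C * enn2ereal (X_norm \<Omega> A \<phi>\<^sub>0 \<phi>\<^sub>1))"
proof -
  obtain L where L: "L-lipschitz_on \<Omega> (\<lambda>x. mat_sqrt (A x))" using assms by blast
  obtain B where B: "\<And>x. x \<in> \<Omega> \<Longrightarrow> norm (mat_sqrt (A x)) \<le> B" using assms(6) by (auto simp: bounded_iff)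
  interpret lipschitz_sqrt \<Omega> A B L by unfold_locales (use assms L B in auto)
  show ?thesis
  proof (rule subsolution_bound[OF assms(10,11,8)])
    fix K assume K: "0 \<le> K" "\<And>\<A> \<phi>\<^sub>0 \<phi>\<^sub>1 u l a. \<lbrakk>\<And>x z. x \<in> \<Omega> \<Longrightarrow> sym_psd (\<A> x z);
      AE x in M. \<forall>\<xi> z. lam * (\<xi> \<bullet> (A x *v \<xi>)) \<le> \<xi> \<bullet> (\<A> x z *v \<xi>);
      admissible \<Omega> A \<phi>\<^sub>0 \<phi>\<^sub>1; weak_subsolution \<Omega> A \<A> \<phi>\<^sub>0 \<phi>\<^sub>1 u;
      (\<lambda>x. max (u x - l) 0) \<in> W12_0 \<Omega> A; 0 < a; enn2real (X_norm \<Omega> A \<phi>\<^sub>0 \<phi>\<^sub>1) \<le> lam * a\<rbrakk>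
      \<Longrightarrow> AE x in M. u x \<le> l + K * a"
    show ?thesis
  proof (intro exI[of _ "K / lam"] conjI allI impI)
    show "0 \<le> K / lam" using K(1) assms(8) by simp
    fix \<A> :: "real ^ 'n \<Rightarrow> real \<Rightarrow> real ^ 'n ^ 'n" and \<phi>\<^sub>0 \<phi>\<^sub>1 u
    assume H: "(\<forall>x\<in>\<Omega>. \<forall>z. sym_psd (\<A> x z)) \<and>
      (AE x in lebesgue_on \<Omega>. \<forall>\<xi> z.
         0 \<le> lam * (\<xi> \<bullet> (A x *v \<xi>)) \<and>
         lam * (\<xi> \<bullet> (A x *v \<xi>)) \<le> \<xi> \<bullet> (\<A> x z *v \<xi>) \<and>
         \<xi> \<bullet> (\<A> x z *v \<xi>) \<le> Lam * (\<xi> \<bullet> (A x *v \<xi>))) \<and>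
      admissible \<Omega> A \<phi>\<^sub>0 \<phi>\<^sub>1 \<and> weak_subsolution \<Omega> A \<A> \<phi>\<^sub>0 \<phi>\<^sub>1 u"
    then have psd': "\<And>x z. x \<in> \<Omega> \<Longrightarrow> sym_psd (\<A> x z)" and adm: "admissible \<Omega> A \<phi>\<^sub>0 \<phi>\<^sub>1"
      and sub: "weak_subsolution \<Omega> A \<A> \<phi>\<^sub>0 \<phi>\<^sub>1 u" by auto
    from H have ell: "AE x in M. \<forall>\<xi> z. lam * (\<xi> \<bullet> (A x *v \<xi>)) \<le> \<xi> \<bullet> (\<A> x z *v \<xi>)"
      by (auto elim: eventually_mono)
    define X where "X = enn2real (X_norm \<Omega> A \<phi>\<^sub>0 \<phi>\<^sub>1)"
    have X0: "0 \<le> X" by (simp add: X_def)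
    have "X_norm \<Omega> A \<phi>\<^sub>0 \<phi>\<^sub>1 = ennreal X" using adm by (simp add: admissible_def X_def)
    then have Xe: "enn2ereal (X_norm \<Omega> A \<phi>\<^sub>0 \<phi>\<^sub>1) = ereal X" using X0 by simp
    have um: "(\<lambda>x. ereal (u x)) \<in> borel_measurable M"
    proof -
      have "u \<in> borel_measurable M" using sub by (simp add: weak_subsolution_def W12_def L2_def)
      then show ?thesis by simp
    qed
    have bound: "esssup M (\<lambda>x. ereal (u x)) \<le> ereal l + ereal (K / lam * X)"
      if v: "(\<lambda>x. max (u x - l) 0) \<in> W12_0 \<Omega> A" for l
    proof (rule ereal_le_epsilon2)
      fix e :: real assume e: "0 < e"
      \<comment> \<open>Positive even for data of norm zero; dividing by \<open>K + 1\<close> covers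
        \<open>K = 0\<close> and costs at most \<open>e\<close> in the end.\<close>
      define a where "a = X / lam + e / (K + 1)"
      have a: "0 < a" "X \<le> lam * a" using X0 assms(8) e K(1) by (auto simp: a_def distrib_left add_nonneg_pos)
      have "AE x in M. u x \<le> l + K * a" by (rule K(2)[OF psd' ell adm sub v a(1) a(2)[unfolded X_def]])
      then have "esssup M (\<lambda>x. ereal (u x)) \<le> ereal (l + K * a)"
        by (intro esssup_I[OF um]) (auto elim: eventually_mono)
      also have "K * a \<le> K / lam * X + e"
      proof -
        have "K * (e / (K + 1)) \<le> e" using K(1) e by (simp add: field_simps)
        then show ?thesis by (simp add: a_def distrib_left)
      qed
      then have "ereal (l + K * a) \<le> ereal l + ereal (K / lam * X) + ereal e" by simp
      finally show "esssup M (\<lambda>x. ereal (u x)) \<le> ereal l + ereal (K / lam * X) + ereal e" .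
    qed
    \<comment> \<open>The finite term moves to the left before the infimum is taken, so the case of
      an empty set, with infimum \<open>\<infinity>\<close>, is included.\<close>
    have "esssup M (\<lambda>x. ereal (u x)) - ereal (K / lam * X) \<le> boundary_sup \<Omega> A u"
      unfolding boundary_sup_def
    proof (rule Inf_greatest)
      fix t assume "t \<in> {ereal l |l. (\<lambda>x. max (u x - l) 0) \<in> W12_0 \<Omega> A}"
      then obtain l where l: "t = ereal l" "(\<lambda>x. max (u x - l) 0) \<in> W12_0 \<Omega> A" by blast
      show "esssup M (\<lambda>x. ereal (u x)) - ereal (K / lam * X) \<le> t"
        using bound[OF l(2)] unfolding l(1) by (simp add: ereal_minus_le)
    qed
    then show "esssup (lebesgue_on \<Omega>) (\<lambda>x. ereal (u x))
        \<le> boundary_sup \<Omega> A u + ereal (K / lam) * enn2ereal (X_norm \<Omega> A \<phi>\<^sub>0 \<phi>\<^sub>1)"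
      unfolding Xe by (simp add: ereal_minus_le)
  qed
  qed
qed

end
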